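(* Let $K$ be a field of characteristic zero, let $m,n,t$ be positive integers with $2\le t\le \min\{m,n\}$ and $t<\max\{m,n\}$, let $X=(X_{i,j})$ be an $m\times n$ matrix of indeterminates, and let $R=K[X]$ be the standard graded polynomial ring. Let $I_t\subseteq R$ be the ideal generated by the $t$-minors of $X$, and let $\mathrm{in}(I_t)$ be the initial ideal of $I_t$ with respect to a diagonal monomial order. Then the graded Betti number satisfies $$\beta_{h,\,h+t-1}(R/\mathrm{in}(I_t))\ge t,$$ where $h=(m-t+1)(n-t+1)$ is the height of $\mathrm{in}(I_t)$.
   Context: A monomial order on $R=K[X]$ is diagonal if the initial monomial of any minor of $X$ is the product of the indeterminates along its main diagonal. For a finitely generated graded $R$-module $M$, $\beta_{i,j}(M)=\dim_K \mathrm{Tor}_i^R(K,M)_j$. *)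

theory Defs
  imports
    Complex_Main
    "HOL-Library.Poly_Mapping"
    "HOL-Library.Extended_Nat"
    "HOL-Library.Function_Algebras"
    "HOL-Algebra.Ideal"
    "Jordan_Normal_Form.Determinant"
    "Jordan_Normal_Form.DL_Submatrix"
begin

text \<open>A monomial is a finitely supported exponent function, a polynomial is a finitely supported
  function from monomials to coefficients; the ring structure on the latter is the one of
  \<^theory>\<open>HOL-Library.Poly_Mapping\<close>. The polynomial ring in a set \<open>V\<close> of
  indeterminates consists of the polynomials which only involve indeterminates from \<open>V\<close>.\<close>

type_synonym 'v mon = "'v \<Rightarrow>\<^sub>0 nat"
type_synonym ('v, 'k) mpol = "'v mon \<Rightarrow>\<^sub>0 'k"

definition mons :: "'v set \<Rightarrow> 'v mon set" where
  "mons V = {u. Poly_Mapping.keys u \<subseteq> V}"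

definition poly_ring :: "'v set \<Rightarrow> ('v, 'k::comm_ring_1) mpol ring" where
  "poly_ring V = \<lparr>carrier = {p. Poly_Mapping.keys p \<subseteq> mons V},
     monoid.mult = (*), one = 1, zero = 0, add = (+)\<rparr>"

definition Var :: "'v \<Rightarrow> ('v, 'k::comm_ring_1) mpol" where
  "Var v = Poly_Mapping.single (Poly_Mapping.single v 1) 1"

definition mon_deg :: "'v mon \<Rightarrow> nat" where
  "mon_deg u = (\<Sum>v\<in>Poly_Mapping.keys u. Poly_Mapping.lookup u v)"

lemma keys_mult_mons:
  assumes "Poly_Mapping.keys p \<subseteq> mons V" and "Poly_Mapping.keys q \<subseteq> mons V"
  shows "Poly_Mapping.keys ((p :: ('v, 'k::comm_ring_1) mpol) * q) \<subseteq> mons V"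
proof
  fix w assume "w \<in> Poly_Mapping.keys (p * q)"
  then obtain u v where "w = u + v" "u \<in> Poly_Mapping.keys p" "v \<in> Poly_Mapping.keys q"
    using Poly_Mapping.keys_mult[of p q] by blast
  then show "w \<in> mons V"
    using assms Poly_Mapping.keys_add[of u v] unfolding mons_def by blast
qed

lemma cring_poly_ring: "cring (poly_ring V :: ('v, 'k::comm_ring_1) mpol ring)"
proof (rule cringI)
  show "abelian_group (poly_ring V :: ('v, 'k) mpol ring)"
  proof (rule abelian_groupI)
    fix x y :: "('v, 'k) mpol"
    assume x: "x \<in> carrier (poly_ring V)" and y: "y \<in> carrier (poly_ring V)"
    show "x \<oplus>\<^bsub>poly_ring V\<^esub> y \<in> carrier (poly_ring V)"
      using x y Poly_Mapping.keys_add[of x y] by (auto simp: poly_ring_def)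
  next
    fix x :: "('v, 'k) mpol"
    assume x: "x \<in> carrier (poly_ring V)"
    show "\<exists>y\<in>carrier (poly_ring V). y \<oplus>\<^bsub>poly_ring V\<^esub> x = \<zero>\<^bsub>poly_ring V\<^esub>"
      by (rule bexI[of _ "- x"]) (use x in \<open>auto simp: poly_ring_def\<close>)
  qed (auto simp: poly_ring_def algebra_simps)
  show "Group.comm_monoid (poly_ring V :: ('v, 'k) mpol ring)"
  proof (rule comm_monoidI)
    fix x y :: "('v, 'k) mpol"
    assume "x \<in> carrier (poly_ring V)" and "y \<in> carrier (poly_ring V)"
    then show "x \<otimes>\<^bsub>poly_ring V\<^esub> y \<in> carrier (poly_ring V)"
      using keys_mult_mons[of x V y] by (simp add: poly_ring_def)
  qed (auto simp: poly_ring_def algebra_simps mons_def)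
qed (auto simp: poly_ring_def algebra_simps)

text \<open>\<open>(u, v) \<in> r\<close> means \<open>u \<le> v\<close>.\<close>

definition monomial_order :: "'v set \<Rightarrow> 'v mon rel \<Rightarrow> bool" where
  "monomial_order V r \<longleftrightarrow> linear_order_on (mons V) r \<and>
     (\<forall>u\<in>mons V. (0, u) \<in> r) \<and>
     (\<forall>u v w. (u, v) \<in> r \<longrightarrow> w \<in> mons V \<longrightarrow> (u + w, v + w) \<in> r)"

definition initial_mon :: "'v mon rel \<Rightarrow> ('v, 'k::zero) mpol \<Rightarrow> 'v mon" where
  "initial_mon r f = (THE u. u \<in> Poly_Mapping.keys f \<and> (\<forall>v\<in>Poly_Mapping.keys f. (v, u) \<in> r))"

definition initial_ideal ::
  "'v set \<Rightarrow> 'v mon rel \<Rightarrow> ('v, 'k::comm_ring_1) mpol set \<Rightarrow> ('v, 'k) mpol set" where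
  "initial_ideal V r I =
     Idl\<^bsub>poly_ring V\<^esub> {Poly_Mapping.single (initial_mon r f) 1 | f. f \<in> I \<and> f \<noteq> 0}"

definition gen_vars :: "nat \<Rightarrow> nat \<Rightarrow> (nat \<times> nat) set" where
  "gen_vars m n = {..<m} \<times> {..<n}"

definition gen_mat :: "nat \<Rightarrow> nat \<Rightarrow> (nat \<times> nat, 'k::comm_ring_1) mpol mat" where
  "gen_mat m n = mat m n Var"

definition gen_minor ::
  "nat \<Rightarrow> nat \<Rightarrow> nat set \<Rightarrow> nat set \<Rightarrow> (nat \<times> nat, 'k::comm_ring_1) mpol" where
  "gen_minor m n A B = det (submatrix (gen_mat m n) A B)"

definition det_ideal :: "nat \<Rightarrow> nat \<Rightarrow> nat \<Rightarrow> (nat \<times> nat, 'k::comm_ring_1) mpol set" where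
  "det_ideal m n t = Idl\<^bsub>poly_ring (gen_vars m n)\<^esub>
     {gen_minor m n A B | A B. A \<subseteq> {..<m} \<and> B \<subseteq> {..<n} \<and> card A = t \<and> card B = t}"

text \<open>The main diagonal of the minor with rows \<open>a\<^sub>0 < a\<^sub>1 < \<dots>\<close> and columns
  \<open>b\<^sub>0 < b\<^sub>1 < \<dots>\<close> consists of the positions \<open>(a\<^sub>k, b\<^sub>k)\<close>, and
  \<^term>\<open>pick A k\<close> is \<open>a\<^sub>k\<close>. The coefficient ring is passed as a type argument, since
  the minors have to be taken in a definite polynomial ring.\<close>

definition diagonal_order ::
  "'k::comm_ring_1 itself \<Rightarrow> nat \<Rightarrow> nat \<Rightarrow> (nat \<times> nat) mon rel \<Rightarrow> bool" where
  "diagonal_order K m n r \<longleftrightarrow> monomial_order (gen_vars m n) r \<and>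
     (\<forall>A B. A \<subseteq> {..<m} \<longrightarrow> B \<subseteq> {..<n} \<longrightarrow> card A = card B \<longrightarrow>
        initial_mon r (gen_minor m n A B :: (nat \<times> nat, 'k) mpol) =
          (\<Sum>k<card A. Poly_Mapping.single (pick A k, pick B k) 1))"

definition prime_height :: "('a, 'b) ring_scheme \<Rightarrow> 'a set \<Rightarrow> enat" where
  "prime_height R P = Sup {enat k | k. \<exists>Q. (\<forall>i\<le>k. primeideal (Q i) R) \<and>
     (\<forall>i<k. Q i \<subset> Q (Suc i)) \<and> Q k = P}"

definition ideal_height :: "('a, 'b) ring_scheme \<Rightarrow> 'a set \<Rightarrow> enat" where
  "ideal_height R I = (INF P \<in> {P. primeideal P R \<and> I \<subseteq> P}. prime_height R P)"

text \<open>A complex \<open>F\<close> of finitely generated graded free modules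
  \<open>F\<^sub>i = \<Oplus>\<^bsub>k < rk i\<^esub> R(- shift i k)\<close> over \<open>R = K[V]\<close>, augmented to \<open>R\<close>.
  Elements of \<open>F\<^sub>i\<close> are the functions \<open>nat \<Rightarrow> R\<close> which vanish outside of
  \<open>{..<rk i}\<close>. The map \<open>F\<^sub>i\<^sub>+\<^sub>1 \<rightarrow> F\<^sub>i\<close> is given by the matrix
  with entries \<open>dmat F i k l\<close> in row \<open>k < rk i\<close> and column \<open>l < rk (i + 1)\<close>,
  and \<open>aug F\<close> is the row of the map \<open>F\<^sub>0 \<rightarrow> R\<close>.\<close>

record (overloaded) ('v, 'k) free_complex =
  rk :: "nat \<Rightarrow> nat"
  shift :: "nat \<Rightarrow> nat \<Rightarrow> nat"
  dmat :: "nat \<Rightarrow> nat \<Rightarrow> nat \<Rightarrow> ('v, 'k) mpol"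
  aug :: "nat \<Rightarrow> ('v, 'k) mpol"

definition chains ::
  "'v set \<Rightarrow> ('v, 'k::comm_ring_1) free_complex \<Rightarrow> nat \<Rightarrow> (nat \<Rightarrow> ('v, 'k) mpol) set" where
  "chains V F i = {x. (\<forall>k<rk F i. x k \<in> carrier (poly_ring V)) \<and> (\<forall>k\<ge>rk F i. x k = 0)}"

definition graded_chains ::
  "'v set \<Rightarrow> ('v, 'k::comm_ring_1) free_complex \<Rightarrow> nat \<Rightarrow> nat \<Rightarrow> (nat \<Rightarrow> ('v, 'k) mpol) set" where
  "graded_chains V F i j =
     {x \<in> chains V F i. \<forall>k<rk F i. \<forall>u\<in>Poly_Mapping.keys (x k). mon_deg u + shift F i k = j}"

text \<open>The differential \<open>F\<^sub>i \<rightarrow> F\<^sub>i\<^sub>-\<^sub>1\<close>, with \<open>F\<^sub>-\<^sub>1 = 0\<close>.\<close>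

fun bdry ::
  "('v, 'k::comm_ring_1) free_complex \<Rightarrow> nat \<Rightarrow> (nat \<Rightarrow> ('v, 'k) mpol) \<Rightarrow> nat \<Rightarrow> ('v, 'k) mpol" where
  "bdry F 0 x = (\<lambda>k. 0)"
| "bdry F (Suc i) x =
     (\<lambda>k. if k < rk F i then \<Sum>l<rk F (Suc i). dmat F i k l * x l else 0)"

definition aug_map ::
  "('v, 'k::comm_ring_1) free_complex \<Rightarrow> (nat \<Rightarrow> ('v, 'k) mpol) \<Rightarrow> ('v, 'k) mpol" where
  "aug_map F x = (\<Sum>l<rk F 0. aug F l * x l)"

text \<open>\<open>F\<close> is a graded free resolution of \<open>R/J\<close>, the map \<open>F\<^sub>0 \<rightarrow> R/J\<close> being
  \<open>F\<^sub>0 \<rightarrow> R\<close> followed by the projection. The first four conditions say that the maps are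
  defined over \<open>R\<close> and homogeneous of degree zero.\<close>

definition graded_free_resolution ::
  "'v set \<Rightarrow> ('v, 'k::comm_ring_1) mpol set \<Rightarrow> ('v, 'k) free_complex \<Rightarrow> bool" where
  "graded_free_resolution V J F \<longleftrightarrow>
     (\<forall>l<rk F 0. aug F l \<in> carrier (poly_ring V)) \<and>
     (\<forall>l<rk F 0. \<forall>u\<in>Poly_Mapping.keys (aug F l). mon_deg u = shift F 0 l) \<and>
     (\<forall>i. \<forall>k<rk F i. \<forall>l<rk F (Suc i). dmat F i k l \<in> carrier (poly_ring V)) \<and>
     (\<forall>i. \<forall>k<rk F i. \<forall>l<rk F (Suc i). \<forall>u\<in>Poly_Mapping.keys (dmat F i k l).
        mon_deg u + shift F i k = shift F (Suc i) l) \<and>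
     (\<forall>f\<in>carrier (poly_ring V). \<exists>x\<in>chains V F 0. f - aug_map F x \<in> J) \<and>
     {x \<in> chains V F 0. aug_map F x \<in> J} = bdry F 1 ` chains V F 1 \<and>
     (\<forall>i\<ge>1. {x \<in> chains V F i. bdry F i x = 0} = bdry F (Suc i) ` chains V F (Suc i))"

text \<open>\<open>F\<^sub>i \<otimes> R/I = F\<^sub>i / I F\<^sub>i\<close>, and \<open>I F\<^sub>i\<close> consists of the vectors
  with entries in \<open>I\<close>. The following two sets are the preimages in the degree \<open>j\<close> component
  of \<open>F\<^sub>i\<close> of the cycles and of the boundaries of \<open>F \<otimes> R/I\<close>, for a homogeneous ideal
  \<open>I\<close>; their quotient is \<open>H\<^sub>i(F \<otimes> R/I)\<^sub>j\<close>.\<close>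

definition tensor_cycles ::
  "'v set \<Rightarrow> ('v, 'k::comm_ring_1) free_complex \<Rightarrow> ('v, 'k) mpol set \<Rightarrow> nat \<Rightarrow> nat \<Rightarrow>
    (nat \<Rightarrow> ('v, 'k) mpol) set" where
  "tensor_cycles V F I i j = {x \<in> graded_chains V F i j. \<forall>k. bdry F i x k \<in> I}"

definition tensor_boundaries ::
  "'v set \<Rightarrow> ('v, 'k::comm_ring_1) free_complex \<Rightarrow> ('v, 'k) mpol set \<Rightarrow> nat \<Rightarrow> nat \<Rightarrow>
    (nat \<Rightarrow> ('v, 'k) mpol) set" where
  "tensor_boundaries V F I i j =
     {x \<in> graded_chains V F i j. \<exists>y\<in>graded_chains V F (Suc i) j.
        \<forall>k. x k - bdry F (Suc i) y k \<in> I}"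

definition vec_scale :: "'k::comm_ring_1 \<Rightarrow> (nat \<Rightarrow> ('v, 'k) mpol) \<Rightarrow> nat \<Rightarrow> ('v, 'k) mpol" where
  "vec_scale c x = (\<lambda>k. Poly_Mapping.single 0 c * x k)"

lemma vector_space_vec_scale:
  "vector_space (vec_scale :: 'k::field \<Rightarrow> (nat \<Rightarrow> ('v, 'k) mpol) \<Rightarrow> nat \<Rightarrow> ('v, 'k) mpol)"
  by unfold_locales
    (auto simp: vec_scale_def fun_eq_iff algebra_simps single_add mult_single
          simp flip: mult.assoc)

text \<open>\<open>dim\<^sub>K Tor\<^sub>i(R/J, R/I)\<^sub>j\<close> for homogeneous ideals \<open>I\<close>, \<open>J\<close> and finite
  \<open>V\<close>: the value at \<open>R/J\<close> of the \<open>i\<close>-th left derived functor of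
  \<open>_ \<otimes> R/I\<close>, computed with an arbitrary graded free resolution of \<open>R/J\<close>. The graded
  components of the modules \<open>F\<^sub>i\<close> have finite dimension, so that the dimension of the quotient
  is the difference of the dimensions.\<close>

definition tor_dim ::
  "'v set \<Rightarrow> ('v, 'k::field) mpol set \<Rightarrow> ('v, 'k) mpol set \<Rightarrow> nat \<Rightarrow> nat \<Rightarrow> nat" where
  "tor_dim V J I i j =
     (let F = (SOME F. graded_free_resolution V J F)
      in vector_space.dim vec_scale (tensor_cycles V F I i j) -
         vector_space.dim vec_scale (tensor_boundaries V F I i j))"

text \<open>\<open>\<beta>\<^sub>i\<^sub>,\<^sub>j(R/I) = dim\<^sub>K Tor\<^sub>i(K, R/I)\<^sub>j\<close>, where \<open>K\<close> is the quotient of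
  \<open>R\<close> by the ideal generated by the indeterminates.\<close>

definition betti :: "'v set \<Rightarrow> ('v, 'k::field) mpol set \<Rightarrow> nat \<Rightarrow> nat \<Rightarrow> nat" where
  "betti V I i j = tor_dim V (Idl\<^bsub>poly_ring V\<^esub> (Var ` V)) I i j"

end

theory Submission
  imports Defs
begin

text \<open>Put \<open>s = t - 1\<close>.

  The height. By diagonality \<open>in(I\<^sub>t)\<close> contains the monomial of every \<open>t\<close>-diagonal of the grid, so a
  prime above it contains a variable on each \<open>t\<close>-diagonal, and a counting argument along the lines
  parallel to the main diagonal gives at least \<open>h\<close> such variables. Conversely \<open>in(I\<^sub>t)\<close> is contained
  in the prime generated by the \<open>h\<close> variables outside of the first \<open>s\<close> rows and columns: the
  substitution of the generic matrix of rank \<open>s\<close> kills \<open>I\<^sub>t\<close>, but with denominators cleared it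
  does not increase the monomial order and would not kill a polynomial whose initial monomial
  lives in the first \<open>s\<close> rows and columns. The theorem that the \<open>t\<close>-minors form a Groebner basis
  is not needed.

  The Betti number. It belongs to the linear strand of \<open>in(I\<^sub>t)\<close>, and only two facts matter:
  \<open>in(I\<^sub>t)\<close> is zero in degrees less than \<open>t\<close> and contains the \<open>t\<close>-diagonals. If \<open>D\<close> consists of
  \<open>a\<close> points in the upper left and \<open>s - a\<close> points in the lower right corner of the grid and \<open>B\<close> is the
  block of size \<open>h\<close> between them, then \<open>x\<^sup>D e\<^sub>B\<close> is a Koszul cycle modulo \<open>in(I\<^sub>t)\<close>. The \<open>t\<close> cycles
  obtained for \<open>a = 0, \<dots>, s\<close> have different multidegrees \<open>B \<union> D\<close>, because \<open>t < max m n\<close>, and are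
  independent in homology.\<close>

section \<open>Polynomials as finitely supported functions\<close>

text \<open>\<open>betti\<close> refers to a resolution of the residue field chosen by
  \<open>SOME\<close>, known only to be exact and graded. The cycles are therefore written down in
  the Koszul complex and carried into that resolution and back by comparison maps. The round trip is
  the identity on the nose, because Koszul chains have no nonzero elements of internal degree below
  their homological degree; so relations between the transported cycles are tested in the Koszul
  complex without chain homotopies.

  The upper bound for the height must limit all chains of primes below a given one. It comes from
  counting independent families of polynomials with bounded exponents: each strict inclusion gains a
  factor \<open>N\<close>, while the available monomials number at most a constant times
  \<open>N ^ card V\<close>.

  The denominator of the rank \<open>s\<close> substitution is the corner minor. Clearing it shifts
  the bound for a monomial of degree \<open>e\<close> by \<open>e\<close> times the corner diagonal,
  so monomials compare as before only within one degree; homogeneity of the substitution separates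
  the degrees.\<close>

abbreviation "lookup \<equiv> Poly_Mapping.lookup"
abbreviation "keys \<equiv> Poly_Mapping.keys"
abbreviation "single \<equiv> Poly_Mapping.single"

lemma poly_eq_sum_single: "(\<Sum>u\<in>keys p. single u (lookup p u)) = p"
proof (rule poly_mapping_eqI)
  fix w
  have "lookup (\<Sum>u\<in>keys p. single u (lookup p u)) w
      = (\<Sum>u\<in>keys p. if u = w then lookup p w else 0)"
    unfolding lookup_sum by (rule sum.cong) (auto simp: lookup_single when_def)
  also have "\<dots> = lookup p w"
    by (simp add: sum.delta in_keys_iff)
  finally show "lookup (\<Sum>u\<in>keys p. single u (lookup p u)) w = lookup p w" .
qed

lemma lookup_mult_sum:
  fixes p q :: "'a::monoid_add \<Rightarrow>\<^sub>0 'b::semiring_0"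
  shows "lookup (p * q) w = (\<Sum>u\<in>keys p. \<Sum>v\<in>keys q. if w = u + v then lookup p u * lookup q v else 0)"
proof -
  have "p * q = (\<Sum>u\<in>keys p. \<Sum>v\<in>keys q. single (u + v) (lookup p u * lookup q v))"
    by (subst poly_eq_sum_single[of p, symmetric], subst poly_eq_sum_single[of q, symmetric])
      (simp add: sum_product mult_single)
  then show ?thesis
    by (simp add: lookup_sum lookup_single when_def eq_commute)
qed

lemma in_keys_multE:
  assumes "w \<in> keys (p * q)"
  obtains u v where "u \<in> keys p" "v \<in> keys q" "w = u + v"
  using assms keys_mult[of p q] by blast

lemma in_keys_sumE:
  assumes "w \<in> keys (sum f A)"
  obtains a where "a \<in> A" "w \<in> keys (f a)"
  using assms Poly_Mapping.keys_sum[of f A] by blast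

lemma in_keys_minusE:
  fixes p q :: "'a \<Rightarrow>\<^sub>0 'b::ab_group_add"
  assumes "w \<in> keys (p - q)"
  obtains "w \<in> keys p" | "w \<in> keys q"
  using assms by (cases "w \<in> keys p"; cases "w \<in> keys q") (auto simp: in_keys_iff lookup_minus)

lemma mon_add_minus: "lookup u v \<noteq> 0 \<Longrightarrow> single v 1 + (u - single v 1) = (u :: 'v mon)"
  by (rule poly_mapping_eqI) (auto simp: lookup_add lookup_minus lookup_single when_def)

text \<open>Exponents are natural numbers, so \<open>u - single v 1\<close> is truncated and undoes
  multiplication by \<open>v\<close> only if \<open>v\<close> occurs in \<open>u\<close>.\<close>

lemma lookup_Var_mult:
  "lookup (Var v * p) u = (if lookup u v \<noteq> 0 then lookup p (u - single v 1) else 0)"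
proof -
  have eq: "u = single v 1 + w \<longleftrightarrow> lookup u v \<noteq> 0 \<and> w = u - single v 1" for w
    using mon_add_minus[of u v] by (auto simp: lookup_add)
  have "lookup (Var v * p) u = (\<Sum>w\<in>keys p. if u = single v 1 + w then lookup p w else 0)"
    by (simp add: lookup_mult_sum Var_def cong: if_cong)
  also have "\<dots> = (\<Sum>w\<in>keys p. if w = u - single v 1 then (if lookup u v \<noteq> 0 then lookup p (u - single v 1) else 0) else 0)"
    by (rule sum.cong[OF refl], simp only: eq) auto
  also have "\<dots> = (if lookup u v \<noteq> 0 then lookup p (u - single v 1) else 0)"
    by (simp add: sum.delta' in_keys_iff)
  finally show ?thesis .
qed

lemma lookup_const_mult: "lookup (single 0 c * p) u = c * lookup p u"
  by (simp add: lookup_mult_sum sum.delta' in_keys_iff cong: if_cong)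

section \<open>Degrees, homogeneous polynomials and restriction to a set of monomials\<close>

lemma mon_deg_superset:
  assumes "finite A" "keys u \<subseteq> A"
  shows "mon_deg u = (\<Sum>v\<in>A. lookup u v)"
  unfolding mon_deg_def by (rule sum.mono_neutral_left) (use assms in \<open>auto simp: in_keys_iff\<close>)

lemma mon_deg_add: "mon_deg (u + v) = mon_deg u + mon_deg v"
proof -
  let ?A = "keys u \<union> keys v"
  have "keys (u + v) \<subseteq> ?A" by (rule Poly_Mapping.keys_add)
  then show ?thesis
    by (simp add: mon_deg_superset[of ?A] lookup_add sum.distrib)
qed

lemma mon_deg_0 [simp]: "mon_deg 0 = 0"
  by (simp add: mon_deg_def)

lemma mon_deg_single [simp]: "mon_deg (single v k) = k"
  by (cases "k = 0") (auto simp: mon_deg_def)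

lemma mon_deg_sum: "mon_deg (sum f A) = (\<Sum>a\<in>A. mon_deg (f a))"
  by (induction A rule: infinite_finite_induct) (auto simp: mon_deg_add)

lemma mon_deg_eq_0_iff: "mon_deg u = 0 \<longleftrightarrow> u = 0"
proof
  assume "mon_deg u = 0"
  then have "lookup u v = 0" for v
    by (cases "v \<in> keys u") (auto simp: mon_deg_def in_keys_iff)
  then show "u = 0" by (intro poly_mapping_eqI) simp
qed simp

definition homog :: "nat \<Rightarrow> ('v, 'k::zero) mpol \<Rightarrow> bool" where
  "homog d p \<longleftrightarrow> (\<forall>u\<in>keys p. mon_deg u = d)"

lemma homog_mult: "homog d p \<Longrightarrow> homog e q \<Longrightarrow> homog (d + e) (p * q)"
  unfolding homog_def by (blast elim: in_keys_multE intro: mon_deg_add[THEN trans] arg_cong2[of _ _ _ _ "(+)"])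

lemma homog_sum: "(\<And>a. a \<in> A \<Longrightarrow> homog d (f a)) \<Longrightarrow> homog d (sum f A)"
  unfolding homog_def by (blast elim: in_keys_sumE)

lemma homog_0 [simp]: "homog d 0"
  by (simp add: homog_def)

lemma homog_1: "homog 0 (1 :: ('v, 'k::comm_ring_1) mpol)"
  by (simp add: homog_def)

lemma homog_Var: "homog 1 (Var v :: ('v, 'k::comm_ring_1) mpol)"
  by (simp add: homog_def Var_def)

lemma homog_diff:
  fixes p q :: "('v, 'k::comm_ring_1) mpol"
  shows "homog d p \<Longrightarrow> homog d q \<Longrightarrow> homog d (p - q)"
  unfolding homog_def by (blast elim: in_keys_minusE)

lemma homog_power:
  fixes p :: "('v, 'k::comm_ring_1) mpol"
  shows "homog d p \<Longrightarrow> homog (k * d) (p ^ k)"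
  by (induction k) (auto simp: homog_1 intro: homog_mult)

lemma homog_prod:
  fixes f :: "'a \<Rightarrow> ('v, 'k::comm_ring_1) mpol"
  assumes "\<And>a. a \<in> A \<Longrightarrow> homog (d a) (f a)"
  shows "homog (sum d A) (prod f A)"
  using assms by (induction A rule: infinite_finite_induct) (auto simp: homog_1 intro: homog_mult)

text \<open>Serves for graded components, for reduction modulo a set of variables and for the case
  distinction in the homotopy \<open>khom\<close>.\<close>

definition restr :: "('a \<Rightarrow> bool) \<Rightarrow> ('a \<Rightarrow>\<^sub>0 'b::zero) \<Rightarrow> 'a \<Rightarrow>\<^sub>0 'b" where
  "restr P p = Poly_Mapping.mapp (\<lambda>u c. if P u then c else 0) p"

lemma lookup_restr [simp]: "lookup (restr P p) u = (if P u then lookup p u else 0)"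
  by (simp add: restr_def lookup_mapp when_def in_keys_iff)

lemma keys_restr [simp]: "keys (restr P p) = {u \<in> keys p. P u}"
  by (auto simp: in_keys_iff split: if_splits)

lemma restr_id: "(\<And>u. u \<in> keys p \<Longrightarrow> P u) \<Longrightarrow> restr P p = p"
  by (rule poly_mapping_eqI) (auto simp: in_keys_iff)

lemma restr_0 [simp]: "restr P 0 = 0"
  by (rule poly_mapping_eqI) simp

lemma restr_sum: "restr P (sum f A) = (\<Sum>a\<in>A. restr P (f a))"
  by (rule poly_mapping_eqI) (simp add: lookup_sum)

lemma restr_diff:
  fixes p q :: "'a \<Rightarrow>\<^sub>0 'b::ab_group_add"
  shows "restr P (p - q) = restr P p - restr P q"
  by (rule poly_mapping_eqI) (simp add: lookup_minus)

text \<open>If all terms of \<open>p\<close> translate the condition \<open>P\<close> into the same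
  condition \<open>Q\<close>, as a homogeneous \<open>p\<close> does with a degree condition, then
  taking components commutes with multiplication by \<open>p\<close>.\<close>

lemma restr_mult:
  fixes p q :: "'a::monoid_add \<Rightarrow>\<^sub>0 'b::semiring_0"
  assumes "\<And>u v. u \<in> keys p \<Longrightarrow> v \<in> keys q \<Longrightarrow> P (u + v) \<longleftrightarrow> Q v"
  shows "restr P (p * q) = p * restr Q q"
proof (rule poly_mapping_eqI)
  fix w
  have "lookup (p * restr Q q) w = (\<Sum>u\<in>keys p. \<Sum>v\<in>keys q. if Q v then if w = u + v then lookup p u * lookup q v else 0 else 0)"
    unfolding lookup_mult_sum
    by (intro sum.cong[OF refl] sum.mono_neutral_cong_left) auto
  also have "\<dots> = (\<Sum>u\<in>keys p. \<Sum>v\<in>keys q. if P w then if w = u + v then lookup p u * lookup q v else 0 else 0)"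
    by (intro sum.cong refl) (use assms in auto)
  also have "\<dots> = lookup (restr P (p * q)) w"
    by (simp add: lookup_mult_sum)
  finally show "lookup (restr P (p * q)) w = lookup (p * restr Q q) w" by simp
qed

section \<open>The polynomial ring in a set of variables and its ideals\<close>

lemma in_poly_ring: "p \<in> carrier (poly_ring V) \<longleftrightarrow> keys p \<subseteq> mons V"
  by (simp add: poly_ring_def)

lemma mons_add: "u + v \<in> mons V \<longleftrightarrow> u \<in> mons V \<and> v \<in> mons V"
  by (auto simp: mons_def subset_iff in_keys_iff lookup_add)

lemma mons_0 [simp]: "0 \<in> mons V"
  by (simp add: mons_def)

lemma mons_single [simp]: "v \<in> V \<Longrightarrow> single v k \<in> mons V"
  by (auto simp: mons_def)

lemma mons_sum: "(\<And>a. a \<in> A \<Longrightarrow> f a \<in> mons V) \<Longrightarrow> sum f A \<in> mons V"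
  by (induction A rule: infinite_finite_induct) (auto simp: mons_add)

lemma finite_mons_deg:
  assumes "finite V" shows "finite {u \<in> mons V. mon_deg u \<le> d}"
proof (rule finite_subset)
  let ?B = "{f. (\<forall>v\<in>V. f v \<in> {..d}) \<and> (\<forall>v. v \<notin> V \<longrightarrow> f v = 0)}"
  have "finite ?B"
    using finite_set_of_finite_funs[OF assms finite_atMost, of d 0]
    by (rule back_subst[of finite]) auto
  then show "finite (Poly_Mapping.lookup -` ?B)"
    by (rule finite_vimageI) (simp add: inj_def)
  show "{u \<in> mons V. mon_deg u \<le> d} \<subseteq> Poly_Mapping.lookup -` ?B"
  proof
    fix u assume "u \<in> {u \<in> mons V. mon_deg u \<le> d}"
    then have u: "u \<in> mons V" "mon_deg u \<le> d" by auto
    have "lookup u v \<le> d" if v: "v \<in> V" for v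
      using mon_deg_superset[of V u] u assms member_le_sum[OF v, of "lookup u"]
      by (simp add: mons_def)
    moreover have "lookup u v = 0" if "v \<notin> V" for v
      using u(1) that by (auto simp: mons_def in_keys_iff)
    ultimately show "u \<in> Poly_Mapping.lookup -` ?B" by auto
  qed
qed

definition sqfree_mon :: "'v set \<Rightarrow> 'v mon" where
  "sqfree_mon A = (\<Sum>v\<in>A. single v 1)"

lemma lookup_sqfree_mon: "finite A \<Longrightarrow> lookup (sqfree_mon A) v = (if v \<in> A then 1 else 0)"
  by (simp add: sqfree_mon_def lookup_sum lookup_single when_def)

lemma keys_sqfree_mon: "finite A \<Longrightarrow> keys (sqfree_mon A) = A"
  by (auto simp: in_keys_iff lookup_sqfree_mon split: if_splits)

lemma mon_deg_sqfree_mon: "mon_deg (sqfree_mon A) = card A"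
  by (simp add: sqfree_mon_def mon_deg_sum)

lemma sqfree_mon_minus: "finite A \<Longrightarrow> p \<in> A \<Longrightarrow> sqfree_mon A - single p 1 = sqfree_mon (A - {p})"
  by (rule poly_mapping_eqI) (auto simp: lookup_minus lookup_sqfree_mon lookup_single when_def)

named_theorems pcl

lemma pcl_0 [pcl]: "0 \<in> carrier (poly_ring V)"
  and pcl_1 [pcl]: "1 \<in> carrier (poly_ring V)"
  and pcl_single [pcl]: "u \<in> mons V \<Longrightarrow> single u c \<in> carrier (poly_ring V)"
  and pcl_Var [pcl]: "v \<in> V \<Longrightarrow> Var v \<in> carrier (poly_ring V)"
  and pcl_mult [pcl]: "p \<in> carrier (poly_ring V) \<Longrightarrow> q \<in> carrier (poly_ring V) \<Longrightarrow> p * q \<in> carrier (poly_ring V)"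
  and pcl_diff [pcl]: "p \<in> carrier (poly_ring V) \<Longrightarrow> q \<in> carrier (poly_ring V) \<Longrightarrow> p - q \<in> carrier (poly_ring V)"
  and pcl_add [pcl]: "p \<in> carrier (poly_ring V) \<Longrightarrow> q \<in> carrier (poly_ring V) \<Longrightarrow> p + q \<in> carrier (poly_ring V)"
  and pcl_uminus [pcl]: "p \<in> carrier (poly_ring V) \<Longrightarrow> - p \<in> carrier (poly_ring V)"
  and pcl_restr [pcl]: "p \<in> carrier (poly_ring V) \<Longrightarrow> restr P p \<in> carrier (poly_ring V)"
  using Poly_Mapping.keys_add[of p q] keys_mult_mons[of p V q]
  by (auto simp: in_poly_ring Var_def elim: in_keys_minusE)

lemma pcl_sum [pcl]: "(\<And>a. a \<in> A \<Longrightarrow> f a \<in> carrier (poly_ring V)) \<Longrightarrow> sum f A \<in> carrier (poly_ring V)"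
  by (induction A rule: infinite_finite_induct) (auto intro: pcl)

lemma pcl_prod [pcl]: "(\<And>a. a \<in> A \<Longrightarrow> f a \<in> carrier (poly_ring V)) \<Longrightarrow> prod f A \<in> carrier (poly_ring V)"
  by (induction A rule: infinite_finite_induct) (auto intro: pcl)

lemma pcl_power [pcl]: "p \<in> carrier (poly_ring V) \<Longrightarrow> p ^ k \<in> carrier (poly_ring V)"
  by (induction k) (auto intro: pcl)

lemma poly_ring_simps [simp]:
  "\<zero>\<^bsub>poly_ring V\<^esub> = 0" "\<one>\<^bsub>poly_ring V\<^esub> = 1" "x \<oplus>\<^bsub>poly_ring V\<^esub> y = x + y" "x \<otimes>\<^bsub>poly_ring V\<^esub> y = x * y"
  by (simp_all add: poly_ring_def)

context
  fixes V :: "'v set" and I :: "('v, 'k::comm_ring_1) mpol set"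
  assumes I: "ideal I (poly_ring V)"
begin

lemma poly_ideal_carrier: "p \<in> I \<Longrightarrow> p \<in> carrier (poly_ring V)"
  using I ideal.Icarr by metis

lemma poly_ideal_0: "0 \<in> I"
  using additive_subgroup.zero_closed[OF ideal.axioms(1)[OF I]] by simp

lemma poly_ideal_add: "p \<in> I \<Longrightarrow> q \<in> I \<Longrightarrow> p + q \<in> I"
  using additive_subgroup.a_closed[OF ideal.axioms(1)[OF I]] by simp

lemma poly_ideal_mult: "p \<in> I \<Longrightarrow> q \<in> carrier (poly_ring V) \<Longrightarrow> q * p \<in> I"
  using ideal.I_l_closed[OF I] by simp

lemma poly_ideal_uminus: "p \<in> I \<Longrightarrow> - p \<in> I"
  using poly_ideal_mult[of p "- 1"] by (auto intro: pcl)

lemma poly_ideal_diff: "p \<in> I \<Longrightarrow> q \<in> I \<Longrightarrow> p - q \<in> I"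
  using poly_ideal_add[of p "- q"] poly_ideal_uminus by simp

lemma poly_ideal_sum: "(\<And>a. a \<in> A \<Longrightarrow> f a \<in> I) \<Longrightarrow> sum f A \<in> I"
  by (induction A rule: infinite_finite_induct) (auto intro: poly_ideal_0 poly_ideal_add)

end

text \<open>An ideal as soon as \<open>P\<close> passes to multiples. Degree bounds and prime ideals
  generated by variables are both of this form, so that membership is tested term by term.\<close>

definition mon_ideal :: "'v set \<Rightarrow> ('v mon \<Rightarrow> bool) \<Rightarrow> ('v, 'k::comm_ring_1) mpol set" where
  "mon_ideal V P = {p \<in> carrier (poly_ring V). \<forall>u\<in>keys p. P u}"

lemma poly_idealI:
  fixes I :: "('v, 'k::comm_ring_1) mpol set"
  assumes "I \<subseteq> carrier (poly_ring V)" "0 \<in> I" "\<And>p q. p \<in> I \<Longrightarrow> q \<in> I \<Longrightarrow> p + q \<in> I"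
    and l: "\<And>p q. p \<in> I \<Longrightarrow> q \<in> carrier (poly_ring V) \<Longrightarrow> q * p \<in> I"
  shows "ideal I (poly_ring V)"
proof -
  interpret cring "poly_ring V :: ('v, 'k) mpol ring" by (rule cring_poly_ring)
  show ?thesis
  proof (rule idealI)
    show "ring (poly_ring V :: ('v, 'k) mpol ring)" by (rule ring_axioms)
    show "subgroup I (add_monoid (poly_ring V))"
    proof (rule subgroup.intro)
      fix x assume x: "x \<in> I"
      then have "inv\<^bsub>add_monoid (poly_ring V)\<^esub> x = - x"
        using assms(1) by (intro minus_equality[unfolded a_inv_def]) (auto simp: pcl)
      then show "inv\<^bsub>add_monoid (poly_ring V)\<^esub> x \<in> I"
        using l[OF x, of "- 1"] by (simp add: pcl)
    qed (use assms in auto)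
  qed (use l in \<open>auto simp: mult.commute\<close>)
qed

lemma ideal_mon_ideal:
  assumes "\<And>u w. P u \<Longrightarrow> P (w + u)"
  shows "ideal (mon_ideal V P :: ('v, 'k::comm_ring_1) mpol set) (poly_ring V)"
proof (rule poly_idealI)
  fix p q :: "('v, 'k) mpol" assume "p \<in> mon_ideal V P" "q \<in> mon_ideal V P"
  then show "p + q \<in> mon_ideal V P"
    using Poly_Mapping.keys_add[of p q] by (auto simp: mon_ideal_def pcl)
next
  fix p q :: "('v, 'k) mpol" assume "p \<in> mon_ideal V P" "q \<in> carrier (poly_ring V)"
  then show "q * p \<in> mon_ideal V P"
    using assms by (auto simp: mon_ideal_def pcl elim!: in_keys_multE)
qed (auto simp: mon_ideal_def pcl)

lemma Idl_subset:
  assumes "ideal I (poly_ring V)" "S \<subseteq> I"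
  shows "Idl\<^bsub>poly_ring V\<^esub> S \<subseteq> (I :: ('v, 'k::comm_ring_1) mpol set)"
  using ring.genideal_minimal[OF cring.axioms(1)[OF cring_poly_ring]] assms by blast

lemma Idl_superset:
  assumes "S \<subseteq> carrier (poly_ring V)"
  shows "(S :: ('v, 'k::comm_ring_1) mpol set) \<subseteq> Idl\<^bsub>poly_ring V\<^esub> S"
  using ring.genideal_self[OF cring.axioms(1)[OF cring_poly_ring]] assms by blast

lemma Idl_ideal:
  assumes "S \<subseteq> carrier (poly_ring V)"
  shows "ideal (Idl\<^bsub>poly_ring V\<^esub> S :: ('v, 'k::comm_ring_1) mpol set) (poly_ring V)"
  using ring.genideal_ideal[OF cring.axioms(1)[OF cring_poly_ring]] assms by blast

text \<open>Each term divisible by some variable of \<open>C\<close> splits off that variable, so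
  membership in the ideal becomes a condition on the support.\<close>

lemma Idl_vars:
  assumes "C \<subseteq> V"
  shows "Idl\<^bsub>poly_ring V\<^esub> (Var ` C) = (mon_ideal V (\<lambda>u. keys u \<inter> C \<noteq> {}) :: ('v, 'k::comm_ring_1) mpol set)"
    (is "?I = ?M")
proof
  have "ideal ?M (poly_ring V)"
    by (rule ideal_mon_ideal) (auto simp: in_keys_iff lookup_add disjoint_iff)
  moreover have "Var ` C \<subseteq> ?M"
    using assms by (auto simp: mon_ideal_def intro: pcl) (auto simp: Var_def)
  ultimately show "?I \<subseteq> ?M" by (rule Idl_subset)
  have S: "Var ` C \<subseteq> carrier (poly_ring V :: ('v, 'k) mpol ring)"
    using assms by (auto intro: pcl)
  note I = Idl_ideal[OF S]
  show "?M \<subseteq> ?I"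
  proof
    fix p :: "('v, 'k) mpol" assume p: "p \<in> ?M"
    have "single u (lookup p u) \<in> ?I" if u: "u \<in> keys p" for u
    proof -
      have "keys u \<inter> C \<noteq> {}" using p u unfolding mon_ideal_def by blast
      then obtain v where v: "v \<in> C" "lookup u v \<noteq> 0" by (auto simp: in_keys_iff)
      have m: "u \<in> mons V" using p u by (auto simp: mon_ideal_def in_poly_ring)
      have "single (u - single v 1) (lookup p u) * Var v = single u (lookup p u)"
        using mon_add_minus[OF v(2)] by (simp add: Var_def mult_single add.commute)
      moreover have "u - single v 1 \<in> mons V"
        using m mon_add_minus[OF v(2)] mons_add by metis
      ultimately show ?thesis
        using poly_ideal_mult[OF I, of "Var v" "single (u - single v 1) (lookup p u)"] v(1) Idl_superset[OF S]
        by (auto intro: pcl)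
    qed
    then have "(\<Sum>u\<in>keys p. single u (lookup p u)) \<in> ?I"
      by (rule poly_ideal_sum[OF I])
    then show "p \<in> ?I" by (simp add: poly_eq_sum_single)
  qed
qed

section \<open>Graded free resolutions\<close>

text \<open>The linear map on vectors of length \<open>N\<close> that sends the \<open>l\<close>-th
  basis vector to \<open>y l\<close>; chain maps and differentials are both handled in this
  form.\<close>

definition lmap :: "nat \<Rightarrow> (nat \<Rightarrow> nat \<Rightarrow> 'r::comm_ring_1) \<Rightarrow> (nat \<Rightarrow> 'r) \<Rightarrow> nat \<Rightarrow> 'r" where
  "lmap N y x = (\<lambda>k. \<Sum>l<N. x l * y l k)"

definition unit_vec :: "nat \<Rightarrow> nat \<Rightarrow> 'r::comm_ring_1" where
  "unit_vec l = (\<lambda>k. if k = l then 1 else 0)"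

lemma lmap_lmap: "lmap M z (lmap N y x) = lmap N (\<lambda>l. lmap M z (y l)) x"
proof
  fix k
  have "lmap M z (lmap N y x) k = (\<Sum>a<M. \<Sum>l<N. x l * y l a * z a k)"
    by (simp add: lmap_def sum_distrib_right)
  also have "\<dots> = (\<Sum>l<N. \<Sum>a<M. x l * y l a * z a k)"
    by (rule sum.swap)
  also have "\<dots> = lmap N (\<lambda>l. lmap M z (y l)) x k"
    by (simp add: lmap_def sum_distrib_left mult.assoc)
  finally show "lmap M z (lmap N y x) k = lmap N (\<lambda>l. lmap M z (y l)) x k" .
qed

lemma lmap_cong:
  assumes "\<And>l. l < N \<Longrightarrow> x l = x' l" "\<And>l. l < N \<Longrightarrow> y l = y' l"
  shows "lmap N y x = lmap N y' x'"
  unfolding lmap_def using assms by (intro ext sum.cong) auto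

lemma lmap_unit_vec: "l < N \<Longrightarrow> lmap N y (unit_vec l) = y l"
  by (simp add: lmap_def unit_vec_def if_distrib[of "\<lambda>x. x * _"] sum.delta cong: if_cong)

lemma lmap_diff: "lmap N y (\<lambda>k. x k - x' k) = (\<lambda>k. lmap N y x k - lmap N y x' k)"
  by (simp add: lmap_def algebra_simps sum_subtractf)

lemma lmap_sum: "lmap N y (\<lambda>k. \<Sum>a\<in>A. c a * x a k) = (\<lambda>k. \<Sum>a\<in>A. c a * lmap N y (x a) k)"
  by (rule ext, simp add: lmap_def sum_distrib_left sum_distrib_right mult.assoc, rule sum.swap)

lemma bdry_eq_lmap:
  "bdry F (Suc i) x = lmap (rk F (Suc i)) (\<lambda>l k. if k < rk F i then dmat F i k l else 0) x"
  by (rule ext) (simp add: lmap_def mult.commute)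

lemma bdry_lmap: "bdry F (Suc i) (lmap N y x) = lmap N (\<lambda>l. bdry F (Suc i) (y l)) x"
  unfolding bdry_eq_lmap by (rule lmap_lmap)

text \<open>Makes a composite with the differential determined by its values on unit vectors, which
  is how the square of a chain map is verified.\<close>

lemma lmap_bdry:
  "lmap N y (bdry F (Suc i) x) = lmap (rk F (Suc i)) (\<lambda>l. lmap N y (bdry F (Suc i) (unit_vec l))) x"
  unfolding bdry_eq_lmap lmap_lmap by (rule lmap_cong) (simp_all add: lmap_unit_vec)

declare bdry.simps(2) [simp del]

lemma bdry_diff: "bdry F i (\<lambda>k. x k - x' k) = (\<lambda>k. bdry F i x k - bdry F i x' k)"
  by (cases i) (simp_all add: bdry_eq_lmap lmap_diff)

lemma bdry_outside: "k \<ge> rk F i \<Longrightarrow> bdry F (Suc i) x k = 0"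
  by (simp add: bdry.simps)

lemma aug_map_lmap: "aug_map F (lmap N y x) = (\<Sum>l<N. x l * aug_map F (y l))"
proof -
  have "aug_map F (lmap N y x) = (\<Sum>a<rk F 0. \<Sum>l<N. x l * (aug F a * y l a))"
    by (simp add: aug_map_def lmap_def sum_distrib_left algebra_simps)
  also have "\<dots> = (\<Sum>l<N. \<Sum>a<rk F 0. x l * (aug F a * y l a))" by (rule sum.swap)
  finally show ?thesis by (simp add: aug_map_def sum_distrib_left)
qed

text \<open>Treats the kernel at position 0, taken modulo \<open>J\<close> after augmentation, and
  the kernels at later positions alike, so that exactness reads the same everywhere.\<close>

definition aug_cycle ::
  "('v, 'k::comm_ring_1) mpol set \<Rightarrow> ('v, 'k) free_complex \<Rightarrow> nat \<Rightarrow> (nat \<Rightarrow> ('v, 'k) mpol) \<Rightarrow> bool" where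
  "aug_cycle J F i x \<longleftrightarrow> (if i = 0 then aug_map F x \<in> J else bdry F i x = 0)"

definition homog_closed :: "('v, 'k::comm_ring_1) mpol set \<Rightarrow> bool" where
  "homog_closed J \<longleftrightarrow> (\<forall>p\<in>J. \<forall>d. restr (\<lambda>u. mon_deg u = d) p \<in> J)"

lemma graded_chains_chains: "x \<in> graded_chains V F i j \<Longrightarrow> x \<in> chains V F i"
  by (simp add: graded_chains_def)

lemma chains_carrier: "x \<in> chains V F i \<Longrightarrow> x k \<in> carrier (poly_ring V)"
  by (cases "k < rk F i") (auto simp: chains_def pcl)

lemma unit_vec_chains: "l < rk F i \<Longrightarrow> unit_vec l \<in> graded_chains V F i (shift F i l)"
  by (auto simp: unit_vec_def graded_chains_def chains_def pcl)

lemma lmap_chains: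
  assumes "\<And>l. l < N \<Longrightarrow> x l \<in> carrier (poly_ring V)" "\<And>l. l < N \<Longrightarrow> y l \<in> chains V G i"
  shows "lmap N y x \<in> chains V G i"
  using assms by (auto simp: chains_def lmap_def intro!: pcl sum.neutral)

lemma lmap_graded_chains:
  fixes x :: "nat \<Rightarrow> ('v, 'k::comm_ring_1) mpol"
  assumes x: "x \<in> graded_chains V F i j" and y: "\<And>l. l < rk F i \<Longrightarrow> y l \<in> graded_chains V G i' (shift F i l)"
  shows "lmap (rk F i) y x \<in> graded_chains V G i' j"
proof -
  have "mon_deg w + shift G i' k = j" if k: "k < rk G i'" and w: "w \<in> keys (lmap (rk F i) y x k)" for k w
  proof -
    obtain l u v where l: "l < rk F i" "u \<in> keys (x l)" "v \<in> keys (y l k)" "w = u + v"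
      using w unfolding lmap_def by (auto elim!: in_keys_sumE in_keys_multE)
    have "mon_deg u + shift F i l = j" using x l by (simp add: graded_chains_def)
    moreover have "mon_deg v + shift G i' k = shift F i l"
      using y[OF l(1)] l k by (simp add: graded_chains_def)
    ultimately show ?thesis by (simp add: l(4) mon_deg_add)
  qed
  moreover have "lmap (rk F i) y x \<in> chains V G i'"
    using x y by (intro lmap_chains) (auto intro: chains_carrier graded_chains_chains)
  ultimately show ?thesis by (simp add: graded_chains_def)
qed

lemma lmap_ideal:
  assumes "ideal I (poly_ring V)" "\<And>l. l < N \<Longrightarrow> x l \<in> I" "\<And>l. l < N \<Longrightarrow> y l k \<in> carrier (poly_ring V)"
  shows "lmap N y x k \<in> I"
proof -
  have "y l k * x l \<in> I" if "l < N" for l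
    using poly_ideal_mult[OF assms(1)] assms(2,3) that by blast
  then show ?thesis
    unfolding lmap_def by (intro poly_ideal_sum[OF assms(1)]) (simp add: mult.commute)
qed

context
  fixes V :: "'v set" and J :: "('v, 'k::comm_ring_1) mpol set" and F :: "('v, 'k) free_complex"
  assumes res: "graded_free_resolution V J F"
begin

lemma res_dmat: "k < rk F i \<Longrightarrow> l < rk F (Suc i) \<Longrightarrow> dmat F i k l \<in> carrier (poly_ring V)"
  and res_dmat_deg: "k < rk F i \<Longrightarrow> l < rk F (Suc i) \<Longrightarrow> u \<in> keys (dmat F i k l) \<Longrightarrow>
      mon_deg u + shift F i k = shift F (Suc i) l"
  and res_aug: "l < rk F 0 \<Longrightarrow> aug F l \<in> carrier (poly_ring V)"
  and res_aug_deg: "l < rk F 0 \<Longrightarrow> u \<in> keys (aug F l) \<Longrightarrow> mon_deg u = shift F 0 l"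
  and res_surj: "f \<in> carrier (poly_ring V) \<Longrightarrow> \<exists>x\<in>chains V F 0. f - aug_map F x \<in> J"
  using res by (simp_all add: graded_free_resolution_def)

lemma res_exact:
  "{x \<in> chains V F i. aug_cycle J F i x} = bdry F (Suc i) ` chains V F (Suc i)"
proof (cases i)
  case 0
  have "{x \<in> chains V F 0. aug_map F x \<in> J} = bdry F 1 ` chains V F 1"
    using res unfolding graded_free_resolution_def by blast
  then show ?thesis by (simp add: 0 aug_cycle_def)
next
  case (Suc i')
  have "\<forall>i\<ge>1. {x \<in> chains V F i. bdry F i x = 0} = bdry F (Suc i) ` chains V F (Suc i)"
    using res unfolding graded_free_resolution_def by blast
  then have "{x \<in> chains V F i. bdry F i x = 0} = bdry F (Suc i) ` chains V F (Suc i)"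
    using Suc by simp
  then show ?thesis by (simp add: Suc aug_cycle_def)
qed

lemma aug_cycle_bdry: "y \<in> chains V F (Suc i) \<Longrightarrow> aug_cycle J F i (bdry F (Suc i) y)"
  using res_exact[of i] by blast

lemma bdry_chains: "y \<in> chains V F (Suc i) \<Longrightarrow> bdry F (Suc i) y \<in> chains V F i"
  using res_exact[of i] by blast

lemma bdry_bdry: "y \<in> chains V F (Suc i) \<Longrightarrow> bdry F i (bdry F (Suc i) y) = (\<lambda>k. 0)"
  using aug_cycle_bdry[of y i] by (cases i) (auto simp: aug_cycle_def)

lemma bdry_graded_chains:
  assumes "y \<in> graded_chains V F (Suc i) j"
  shows "bdry F (Suc i) y \<in> graded_chains V F i j"
  unfolding bdry_eq_lmap using res_dmat res_dmat_deg
  by (intro lmap_graded_chains[OF assms]) (auto simp: graded_chains_def chains_def)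

text \<open>The differential is homogeneous of degree zero, so the component of degree
  \<open>j\<close> of any preimage is again a preimage.\<close>

lemma graded_exact:
  assumes x: "x \<in> graded_chains V F i j" and c: "aug_cycle J F i x"
  obtains y where "y \<in> graded_chains V F (Suc i) j" "bdry F (Suc i) y = x"
proof -
  obtain y where y: "y \<in> chains V F (Suc i)" "bdry F (Suc i) y = x"
  proof -
    have "x \<in> bdry F (Suc i) ` chains V F (Suc i)"
      using graded_chains_chains[OF x] c by (simp flip: res_exact)
    then show ?thesis using that by blast
  qed
  define y' where "y' = (\<lambda>l. restr (\<lambda>u. mon_deg u + shift F (Suc i) l = j) (y l))"
  have "y' \<in> graded_chains V F (Suc i) j"
    using y(1) by (auto simp: y'_def graded_chains_def chains_def pcl)
  moreover have "bdry F (Suc i) y' = x"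
  proof
    fix k show "bdry F (Suc i) y' k = x k"
    proof (cases "k < rk F i")
      case True
      have "dmat F i k l * y' l = restr (\<lambda>u. mon_deg u + shift F i k = j) (dmat F i k l * y l)"
        if "l < rk F (Suc i)" for l
      proof -
        have "mon_deg (u + v) + shift F i k = j \<longleftrightarrow> mon_deg v + shift F (Suc i) l = j" if "u \<in> keys (dmat F i k l)" for u v
          using res_dmat_deg[OF True \<open>l < _\<close> that] by (auto simp: mon_deg_add)
        then show ?thesis unfolding y'_def by (rule restr_mult[symmetric])
      qed
      then have "bdry F (Suc i) y' k = restr (\<lambda>u. mon_deg u + shift F i k = j) (bdry F (Suc i) y k)"
        using True by (simp add: bdry.simps restr_sum)
      also have "\<dots> = x k"
        using x True unfolding y(2) by (intro restr_id) (auto simp: graded_chains_def)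
      finally show ?thesis .
    next
      case False
      then show ?thesis using bdry_outside[of F i k] graded_chains_chains[OF x] by (simp add: chains_def)
    qed
  qed
  ultimately show thesis using that[of y'] by blast
qed

text \<open>As for preimages under the differential, but the error term is only known to lie in
  \<open>J\<close>; homogeneity of \<open>J\<close> keeps its component there.\<close>

lemma graded_surj:
  assumes J: "homog_closed J" and f: "f \<in> carrier (poly_ring V)" "homog j f"
  obtains x where "x \<in> graded_chains V F 0 j" "f - aug_map F x \<in> J"
proof -
  obtain x where x: "x \<in> chains V F 0" "f - aug_map F x \<in> J"
    using res_surj[OF f(1)] by blast
  define x' where "x' = (\<lambda>l. restr (\<lambda>u. mon_deg u + shift F 0 l = j) (x l))"
  have "x' \<in> graded_chains V F 0 j"
    using x(1) by (auto simp: x'_def graded_chains_def chains_def pcl)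
  moreover have "restr (\<lambda>u. mon_deg u = j) (f - aug_map F x) = f - aug_map F x'"
  proof -
    have "restr (\<lambda>u. mon_deg u = j) (aug F l * x l) = aug F l * x' l" if "l < rk F 0" for l
    proof -
      have "mon_deg (u + v) = j \<longleftrightarrow> mon_deg v + shift F 0 l = j" if "u \<in> keys (aug F l)" for u v
        using res_aug_deg[OF \<open>l < _\<close> that] by (auto simp: mon_deg_add)
      then show ?thesis unfolding x'_def by (rule restr_mult)
    qed
    then have "restr (\<lambda>u. mon_deg u = j) (aug_map F x) = aug_map F x'"
      by (simp add: aug_map_def restr_sum)
    moreover have "restr (\<lambda>u. mon_deg u = j) f = f"
      using f(2) by (intro restr_id) (simp add: homog_def)
    ultimately show ?thesis by (simp add: restr_diff)
  qed
  moreover have "restr (\<lambda>u. mon_deg u = j) (f - aug_map F x) \<in> J"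
    using J x(2) by (simp add: homog_closed_def)
  ultimately show thesis using that by simp
qed

end

section \<open>Comparison of graded free resolutions\<close>

definition chain_map ::
  "'v set \<Rightarrow> ('v, 'k::comm_ring_1) mpol set \<Rightarrow> ('v, 'k) free_complex \<Rightarrow> ('v, 'k) free_complex \<Rightarrow>
    (nat \<Rightarrow> nat \<Rightarrow> nat \<Rightarrow> ('v, 'k) mpol) \<Rightarrow> bool" where
  "chain_map V J F G \<phi> \<longleftrightarrow>
     (\<forall>i. \<forall>l<rk F i. \<phi> i l \<in> graded_chains V G i (shift F i l)) \<and>
     (\<forall>i x. bdry G (Suc i) (lmap (rk F (Suc i)) (\<phi> (Suc i)) x) = lmap (rk F i) (\<phi> i) (bdry F (Suc i) x)) \<and>
     (\<forall>x\<in>chains V F 0. aug_map F x - aug_map G (lmap (rk F 0) (\<phi> 0) x) \<in> J)"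

lemma chain_map_graded: "chain_map V J F G \<phi> \<Longrightarrow> l < rk F i \<Longrightarrow> \<phi> i l \<in> graded_chains V G i (shift F i l)"
  and chain_map_bdry: "chain_map V J F G \<phi> \<Longrightarrow>
    bdry G (Suc i) (lmap (rk F (Suc i)) (\<phi> (Suc i)) x) = lmap (rk F i) (\<phi> i) (bdry F (Suc i) x)"
  and chain_map_aug: "chain_map V J F G \<phi> \<Longrightarrow> x \<in> chains V F 0 \<Longrightarrow>
    aug_map F x - aug_map G (lmap (rk F 0) (\<phi> 0) x) \<in> J"
  by (simp_all add: chain_map_def)

text \<open>The comparison theorem: the images of basis vectors can be chosen freely, and exactness
  of \<open>G\<close> provides the lifts. The last clause of \<open>chain_map\<close> expresses that
  the identity of \<open>R/J\<close> is lifted.\<close>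

lemma chain_map_exists:
  fixes F G :: "('v, 'k::comm_ring_1) free_complex"
  assumes F: "graded_free_resolution V J F" and G: "graded_free_resolution V J G"
    and J: "ideal J (poly_ring V)" "homog_closed J"
  obtains \<phi> where "chain_map V J F G \<phi>"
proof -
  \<comment> \<open>\<open>P\<close> also records that cycles go to cycles, since this is what makes
    the next lifting problem solvable.\<close>
  define P where "P = (\<lambda>i \<phi>. (\<forall>l<rk F i. \<phi> l \<in> graded_chains V G i (shift F i l)) \<and>
      (\<forall>x\<in>chains V F i. aug_cycle J F i x \<longrightarrow> aug_cycle J G i (lmap (rk F i) \<phi> x)) \<and>
      (i = 0 \<longrightarrow> (\<forall>x\<in>chains V F 0. aug_map F x - aug_map G (lmap (rk F 0) \<phi> x) \<in> J)))"
  define Q where "Q = (\<lambda>i \<phi> \<phi>'. \<forall>x. bdry G (Suc i) (lmap (rk F (Suc i)) \<phi>' x) = lmap (rk F i) \<phi> (bdry F (Suc i) x))"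
  have "\<exists>\<phi>. \<forall>i. P i (\<phi> i) \<and> Q i (\<phi> i) (\<phi> (Suc i))"
  proof (rule dependent_nat_choice)
    have "\<exists>y. y \<in> graded_chains V G 0 (shift F 0 l) \<and> aug F l - aug_map G y \<in> J" if "l < rk F 0" for l
    proof -
      have "homog (shift F 0 l) (aug F l)"
        using res_aug_deg[OF F that] by (simp add: homog_def)
      from graded_surj[OF G J(2) res_aug[OF F that] this] show ?thesis by blast
    qed
    then obtain \<phi> where \<phi>: "\<And>l. l < rk F 0 \<Longrightarrow> \<phi> l \<in> graded_chains V G 0 (shift F 0 l) \<and> aug F l - aug_map G (\<phi> l) \<in> J"
      by moura
    have *: "aug_map F x - aug_map G (lmap (rk F 0) \<phi> x) \<in> J" if x: "x \<in> chains V F 0" for x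
    proof -
      have "aug_map F x - aug_map G (lmap (rk F 0) \<phi> x) = (\<Sum>l<rk F 0. x l * (aug F l - aug_map G (\<phi> l)))"
        unfolding aug_map_lmap by (simp add: aug_map_def sum_subtractf algebra_simps)
      also have "\<dots> \<in> J"
        using \<phi> chains_carrier[OF x] by (intro poly_ideal_sum[OF J(1)] poly_ideal_mult[OF J(1)]) auto
      finally show ?thesis .
    qed
    have "aug_map G (lmap (rk F 0) \<phi> x) \<in> J" if "x \<in> chains V F 0" "aug_map F x \<in> J" for x
      using poly_ideal_diff[OF J(1) that(2) *[OF that(1)]] by simp
    then show "\<exists>\<phi>. P 0 \<phi>"
      using \<phi> * by (intro exI[of _ \<phi>]) (simp add: P_def aug_cycle_def)
  next
    fix \<phi> i assume P: "P i \<phi>"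
    have "\<exists>y. y \<in> graded_chains V G (Suc i) (shift F (Suc i) l) \<and>
        bdry G (Suc i) y = lmap (rk F i) \<phi> (bdry F (Suc i) (unit_vec l))" if l: "l < rk F (Suc i)" for l
    proof -
      note u = unit_vec_chains[OF l]
      have "lmap (rk F i) \<phi> (bdry F (Suc i) (unit_vec l)) \<in> graded_chains V G i (shift F (Suc i) l)"
        using P by (intro lmap_graded_chains[OF bdry_graded_chains[OF F u]]) (simp add: P_def)
      moreover have "aug_cycle J G i (lmap (rk F i) \<phi> (bdry F (Suc i) (unit_vec l)))"
        using P aug_cycle_bdry[OF F graded_chains_chains[OF u]] bdry_chains[OF F graded_chains_chains[OF u]]
        by (simp add: P_def)
      ultimately obtain y where "y \<in> graded_chains V G (Suc i) (shift F (Suc i) l)"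
        "bdry G (Suc i) y = lmap (rk F i) \<phi> (bdry F (Suc i) (unit_vec l))"
        by (rule graded_exact[OF G])
      then show ?thesis by blast
    qed
    then obtain \<phi>' where \<phi>': "\<And>l. l < rk F (Suc i) \<Longrightarrow> \<phi>' l \<in> graded_chains V G (Suc i) (shift F (Suc i) l) \<and>
        bdry G (Suc i) (\<phi>' l) = lmap (rk F i) \<phi> (bdry F (Suc i) (unit_vec l))"
      by moura
    have Q: "Q i \<phi> \<phi>'"
      unfolding Q_def using \<phi>' by (intro allI, subst bdry_lmap, subst lmap_bdry, intro lmap_cong) auto
    have "bdry G (Suc i) (lmap (rk F (Suc i)) \<phi>' x) = 0" if "bdry F (Suc i) x = 0" for x
    proof -
      have "bdry G (Suc i) (lmap (rk F (Suc i)) \<phi>' x) = lmap (rk F i) \<phi> (bdry F (Suc i) x)"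
        using Q unfolding Q_def by blast
      also have "\<dots> = 0" unfolding that by (simp add: lmap_def fun_eq_iff)
      finally show ?thesis .
    qed
    then have "P (Suc i) \<phi>'" using \<phi>' by (simp add: P_def aug_cycle_def)
    with Q show "\<exists>\<phi>'. P (Suc i) \<phi>' \<and> Q i \<phi> \<phi>'" by blast
  qed
  then obtain \<phi> where \<phi>: "\<And>i. P i (\<phi> i) \<and> Q i (\<phi> i) (\<phi> (Suc i))" by blast
  have "chain_map V J F G \<phi>"
    unfolding chain_map_def
  proof (intro conjI allI impI)
    show "\<phi> i l \<in> graded_chains V G i (shift F i l)" if "l < rk F i" for i l
      using \<phi>[of i] that unfolding P_def by simp
    show "bdry G (Suc i) (lmap (rk F (Suc i)) (\<phi> (Suc i)) x) = lmap (rk F i) (\<phi> i) (bdry F (Suc i) x)" for i x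
      using \<phi>[of i] unfolding Q_def by simp
    show "\<forall>x\<in>chains V F 0. aug_map F x - aug_map G (lmap (rk F 0) (\<phi> 0) x) \<in> J"
      using \<phi>[of 0] unfolding P_def by simp
  qed
  then show thesis by (rule that)
qed

section \<open>Finite dimension and independence in homology\<close>

lemma sum_fun_apply: "sum f A x = (\<Sum>a\<in>A. f a x)"
  by (induction A rule: infinite_finite_induct) auto

text \<open>The space of all polynomial vectors has infinite dimension, while \<open>dim\<close>
  gives the right count only inside the span of a finite set.\<close>

lemma finite_spanning_graded_chains:
  fixes F :: "('v, 'k::field) free_complex"
  assumes "finite V"
  obtains W where "finite W" "graded_chains V F i j \<subseteq> module.span vec_scale W"
proof -
  interpret vector_space "vec_scale :: 'k \<Rightarrow> (nat \<Rightarrow> ('v, 'k) mpol) \<Rightarrow> nat \<Rightarrow> ('v, 'k) mpol"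
    by (rule vector_space_vec_scale)
  define w where "w = (\<lambda>(l, u) (k :: nat). if k = l then single u 1 else (0 :: ('v, 'k) mpol))"
  \<comment> \<open>Only \<open>mon_deg u \<le> j\<close> is imposed, so that one finite index set
    serves all shifts.\<close>
  let ?A = "{..<rk F i} \<times> {u \<in> mons V. mon_deg u \<le> j}"
  have "finite (w ` ?A)" using finite_mons_deg[OF assms] by blast
  moreover have "x \<in> span (w ` ?A)" if x: "x \<in> graded_chains V F i j" for x
  proof -
    have x_eq: "x = (\<Sum>l<rk F i. \<Sum>u\<in>keys (x l). vec_scale (lookup (x l) u) (w (l, u)))"
    proof
      fix k
      have "(\<Sum>l<rk F i. \<Sum>u\<in>keys (x l). vec_scale (lookup (x l) u) (w (l, u))) k
          = (\<Sum>l<rk F i. if l = k then (\<Sum>u\<in>keys (x l). single u (lookup (x l) u)) else 0)"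
        unfolding sum_fun_apply by (intro sum.cong refl) (auto simp: vec_scale_def w_def mult_single)
      also have "\<dots> = (if k < rk F i then x k else 0)" by (simp add: poly_eq_sum_single)
      also have "\<dots> = x k" using graded_chains_chains[OF x] by (simp add: chains_def)
      finally show "x k = (\<Sum>l<rk F i. \<Sum>u\<in>keys (x l). vec_scale (lookup (x l) u) (w (l, u))) k" by simp
    qed
    moreover have "w (l, u) \<in> w ` ?A" if "l < rk F i" "u \<in> keys (x l)" for l u
      using x that by (force simp: graded_chains_def chains_def in_poly_ring)
    ultimately show ?thesis
      by (subst x_eq, intro span_sum span_scale, intro span_base) blast
  qed
  ultimately show thesis using that by blast
qed

text \<open>Vectors independent modulo the boundaries enlarge a basis of the boundaries one at a
  time, and all of this takes place inside the cycles.\<close>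

lemma tensor_dim_lower_bound:
  fixes F :: "('v, 'k::field) free_complex"
  assumes V: "finite V" and I: "ideal I (poly_ring V)" and F: "graded_free_resolution V J F"
    and z: "\<And>a. a < t \<Longrightarrow> z a \<in> tensor_cycles V F I i j"
    and indep: "\<And>c. (\<lambda>k. \<Sum>a<t. single 0 (c a) * z a k) \<in> tensor_boundaries V F I i j \<Longrightarrow> (\<forall>a<t. c a = 0)"
  shows "t \<le> vector_space.dim vec_scale (tensor_cycles V F I i j) -
         vector_space.dim vec_scale (tensor_boundaries V F I i j)"
proof -
  interpret vector_space "vec_scale :: 'k \<Rightarrow> (nat \<Rightarrow> ('v, 'k) mpol) \<Rightarrow> nat \<Rightarrow> ('v, 'k) mpol"
    by (rule vector_space_vec_scale)
  let ?C = "tensor_cycles V F I i j" and ?B = "tensor_boundaries V F I i j"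
  \<comment> \<open>A single support condition at every index, with empty support demanded from
    \<open>rk F i\<close> on, makes closure under the vector space operations uniform.\<close>
  have gr: "graded_chains V F i j = {x. \<forall>k. keys (x k) \<subseteq> {u \<in> mons V. k < rk F i \<and> mon_deg u + shift F i k = j}}" for i
  proof -
    have e1: "(x k \<in> carrier (poly_ring V) \<and> (\<forall>u\<in>keys (x k). mon_deg u + shift F i k = j)) \<longleftrightarrow>
        keys (x k) \<subseteq> {u \<in> mons V. k < rk F i \<and> mon_deg u + shift F i k = j}" if "k < rk F i" for x :: "nat \<Rightarrow> ('v, 'k) mpol" and k
      using that by (auto simp: in_poly_ring)
    have e2: "x k = 0 \<longleftrightarrow> keys (x k) \<subseteq> {u \<in> mons V. k < rk F i \<and> mon_deg u + shift F i k = j}"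
      if "\<not> k < rk F i" for x :: "nat \<Rightarrow> ('v, 'k) mpol" and k
      using that by auto
    have eq: "(if k < rk F i then x k \<in> carrier (poly_ring V) \<and> (\<forall>u\<in>keys (x k). mon_deg u + shift F i k = j) else x k = 0)
        \<longleftrightarrow> keys (x k) \<subseteq> {u \<in> mons V. k < rk F i \<and> mon_deg u + shift F i k = j}" for x :: "nat \<Rightarrow> ('v, 'k) mpol" and k
    proof (cases "k < rk F i")
      case True then show ?thesis unfolding if_P[OF True] by (rule e1)
    next
      case False then show ?thesis unfolding if_not_P[OF False] by (rule e2)
    qed
    show ?thesis
      unfolding eq[symmetric] graded_chains_def chains_def by (auto simp: not_less[symmetric])
  qed
  have sum_keys: "(\<forall>k. keys (x k) \<subseteq> A k) \<Longrightarrow> (\<forall>k. keys (y k) \<subseteq> A k) \<Longrightarrow> (\<forall>k. keys ((x + y) k) \<subseteq> A k)"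
    for x y :: "nat \<Rightarrow> ('v, 'k) mpol" and A
    by (simp add: plus_fun_def) (meson Poly_Mapping.keys_add Un_least order_trans)
  have scale_keys: "(\<forall>k. keys (x k) \<subseteq> A k) \<Longrightarrow> (\<forall>k. keys (vec_scale c x k) \<subseteq> A k)"
    for x :: "nat \<Rightarrow> ('v, 'k) mpol" and A c
    by (auto simp: vec_scale_def in_keys_iff lookup_const_mult subset_iff)
  have sub_gr: "subspace (graded_chains V F i j)" for i
    unfolding gr
  proof (rule subspaceI, unfold mem_Collect_eq)
    show "\<forall>k. keys ((0 :: nat \<Rightarrow> ('v, 'k) mpol) k) \<subseteq> {u \<in> mons V. k < rk F i \<and> mon_deg u + shift F i k = j}"
      by simp
  qed (rule sum_keys scale_keys; assumption)+
  have bdry_add: "bdry F i (x + y) k = bdry F i x k + bdry F i y k" for i x y k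
    by (cases i) (simp_all add: bdry.simps algebra_simps sum.distrib)
  have bdry_scale: "bdry F i (vec_scale c x) k = single 0 c * bdry F i x k" for i x k c
    by (cases i) (simp_all add: bdry.simps vec_scale_def sum_distrib_left algebra_simps)
  have bdry_0: "bdry F i 0 k = 0" for i k
    by (cases i) (simp_all add: bdry.simps)
  have c: "single 0 c \<in> carrier (poly_ring V)" for c :: 'k by (simp add: pcl)
  have "subspace ?B"
  proof (rule subspaceI)
    show "0 \<in> ?B" using subspace_0[OF sub_gr] poly_ideal_0[OF I]
      by (auto simp: tensor_boundaries_def bdry_0 intro!: bexI[of _ 0])
  next
    fix x x' assume "x \<in> ?B" "x' \<in> ?B"
    then obtain y y' where x: "x \<in> graded_chains V F i j" "x' \<in> graded_chains V F i j"
      and y: "y \<in> graded_chains V F (Suc i) j" "y' \<in> graded_chains V F (Suc i) j"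
      and I': "\<And>k. x k - bdry F (Suc i) y k \<in> I" "\<And>k. x' k - bdry F (Suc i) y' k \<in> I"
      unfolding tensor_boundaries_def by blast
    have "(x + x') k - bdry F (Suc i) (y + y') k \<in> I" for k
      using poly_ideal_add[OF I I'(1)[of k] I'(2)[of k]] by (simp add: bdry_add algebra_simps)
    then show "x + x' \<in> ?B"
      using subspace_add[OF sub_gr x] subspace_add[OF sub_gr y] unfolding tensor_boundaries_def by blast
  next
    fix x c assume "x \<in> ?B"
    then obtain y where x: "x \<in> graded_chains V F i j" and y: "y \<in> graded_chains V F (Suc i) j"
      and I': "\<And>k. x k - bdry F (Suc i) y k \<in> I" 
      unfolding tensor_boundaries_def by blast
    have "vec_scale c x k - bdry F (Suc i) (vec_scale c y) k \<in> I" for k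
      using poly_ideal_mult[OF I I'[of k] c[of c]] by (simp add: bdry_scale) (simp add: vec_scale_def algebra_simps)
    then show "vec_scale c x \<in> ?B"
      using subspace_scale[OF sub_gr x] subspace_scale[OF sub_gr y] unfolding tensor_boundaries_def by blast
  qed
  have BC: "?B \<subseteq> ?C"
  proof
    fix x assume "x \<in> ?B"
    then obtain y where x: "x \<in> graded_chains V F i j" and y: "y \<in> graded_chains V F (Suc i) j"
      and I': "\<And>k. x k - bdry F (Suc i) y k \<in> I" 
      unfolding tensor_boundaries_def by blast
    have "bdry F i x k \<in> I" for k
    proof (cases i)
      case 0 then show ?thesis using poly_ideal_0[OF I] by simp
    next
      case (Suc i')
      have "bdry F i x k = bdry F i (\<lambda>k. x k - bdry F (Suc i) y k) k"
        unfolding bdry_diff bdry_bdry[OF F graded_chains_chains[OF y]] by simp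
      also have "\<dots> \<in> I"
        unfolding Suc bdry_eq_lmap[of F i'] using res_dmat[OF F] I'
        by (intro lmap_ideal[OF I]) (auto simp: Suc pcl)
      finally show ?thesis .
    qed
    with x show "x \<in> ?C" by (simp add: tensor_cycles_def)
  qed
  obtain W where W: "finite W" "graded_chains V F i j \<subseteq> span W"
    using finite_spanning_graded_chains[OF V] by blast
  have CW: "?C \<subseteq> span W" using W(2) by (auto simp: tensor_cycles_def)
  obtain A where A: "A \<subseteq> ?B" "independent A" "?B \<subseteq> span A" "card A = dim ?B"
    using basis_exists by blast
  have finA: "finite A" using independent_span_bound[OF W(1) A(2)] A(1) BC CW by blast
  have spanA: "span A = ?B"
    using A(1,3) \<open>subspace ?B\<close> span_minimal by blast
  \<comment> \<open>Coefficients are indexed by \<open>a\<close> and not by the vectors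
    \<open>z a\<close>, as \<open>z\<close> is not yet known to be injective.\<close>
  have span_z: "\<exists>c. x = (\<Sum>a<s. vec_scale (c a) (z a))" if "x \<in> span (z ` {..<s})" for x s
  proof -
    let ?S = "{x. \<exists>c. x = (\<Sum>a<s. vec_scale (c a) (z a))}"
    have "subspace ?S"
    proof (rule subspaceI)
      show "0 \<in> ?S" by (auto intro!: exI[of _ "\<lambda>_. 0"])
    next
      fix x y assume "x \<in> ?S" "y \<in> ?S"
      then obtain c d where "x = (\<Sum>a<s. vec_scale (c a) (z a))" "y = (\<Sum>a<s. vec_scale (d a) (z a))"
        by blast
      then have "x + y = (\<Sum>a<s. vec_scale (c a + d a) (z a))"
        by (simp add: scale_left_distrib sum.distrib)
      then show "x + y \<in> ?S" by (intro CollectI exI)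
    next
      fix x e assume "x \<in> ?S"
      then obtain c where "x = (\<Sum>a<s. vec_scale (c a) (z a))" by blast
      then have "vec_scale e x = (\<Sum>a<s. vec_scale (e * c a) (z a))"
        by (simp add: scale_sum_right)
      then show "vec_scale e x \<in> ?S" by (intro CollectI exI)
    qed
    moreover have "z b \<in> ?S" if "b < s" for b
    proof -
      have "z b = (\<Sum>a<s. vec_scale (if a = b then 1 else 0) (z a))"
        using that by (subst sum.remove[of _ b]) auto
      then show ?thesis by (intro CollectI exI)
    qed
    ultimately have "span (z ` {..<s}) \<subseteq> ?S" by (intro span_minimal) auto
    then show ?thesis using that by blast
  qed
  \<comment> \<open>The cardinality is carried along because it excludes coincidences among the
    \<open>z a\<close> and with the basis \<open>A\<close>.\<close>
  have "independent (z ` {..<s} \<union> A) \<and> card (z ` {..<s} \<union> A) = s + card A" if "s \<le> t" for s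
    using that
  proof (induction s)
    case 0 then show ?case using A(2) by simp
  next
    case (Suc s)
    have nspan: "z s \<notin> span (z ` {..<s} \<union> A)"
    proof
      assume "z s \<in> span (z ` {..<s} \<union> A)"
      then obtain x b where xb: "z s = x + b" "x \<in> span (z ` {..<s})" "b \<in> ?B"
        unfolding span_Un spanA by blast
      obtain c where c: "x = (\<Sum>a<s. vec_scale (c a) (z a))" using span_z[OF xb(2)] by blast
      \<comment> \<open>A relation \<open>z s = x + b\<close> becomes a combination of all the
        \<open>z a\<close>, with coefficient one at \<open>s\<close> and zero beyond, that is a
        boundary; this contradicts \<open>indep\<close>.\<close>
      define c' where "c' a = (if a = s then 1 else if a < s then - c a else 0)" for a
      have "(\<Sum>a<t. vec_scale (c' a) (z a)) = (\<Sum>a<Suc s. vec_scale (c' a) (z a))"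
        by (rule sum.mono_neutral_right) (use Suc.prems in \<open>auto simp: c'_def\<close>)
      also have "\<dots> = (\<Sum>a<s. vec_scale (- c a) (z a)) + z s"
        by (simp add: c'_def)
      also have "\<dots> = - x + z s"
        by (simp add: c sum_negf)
      also have "\<dots> = b" using xb(1) by simp
      finally have "(\<Sum>a<t. vec_scale (c' a) (z a)) \<in> ?B" using xb(3) by simp
      moreover have "(\<Sum>a<t. vec_scale (c' a) (z a)) = (\<lambda>k. \<Sum>a<t. single 0 (c' a) * z a k)"
        by (simp add: fun_eq_iff sum_fun_apply vec_scale_def)
      ultimately have "\<forall>a<t. c' a = 0" by (intro indep) simp
      then have "c' s = 0" using Suc.prems by simp
      then show False by (simp add: c'_def)
    qed
    have "z s \<notin> z ` {..<s} \<union> A"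
      using nspan span_superset[of "z ` {..<s} \<union> A"] by (rule contra_subsetD[rotated])
    moreover have "z ` {..<Suc s} \<union> A = insert (z s) (z ` {..<s} \<union> A)"
      by (simp add: lessThan_Suc)
    moreover have "independent (z ` {..<s} \<union> A)" "card (z ` {..<s} \<union> A) = s + card A"
      using Suc by simp_all
    ultimately show ?case
      using finA independent_insertI[OF nspan] by simp
  qed
  from this[of t] have ind: "independent (z ` {..<t} \<union> A)" and card: "card (z ` {..<t} \<union> A) = t + dim ?B"
    using A(4) by auto
  have "z ` {..<t} \<union> A \<subseteq> ?C" using A(1) BC z by blast
  then obtain D where D: "z ` {..<t} \<union> A \<subseteq> D" "D \<subseteq> ?C" "independent D" "?C \<subseteq> span D"
    by (rule maximal_independent_subset_extend[OF _ ind])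
  have "finite D" using independent_span_bound[OF W(1) D(3)] D(2) CW by blast
  moreover have "dim ?C = card D" by (rule dim_unique[OF D(2,4,3) refl])
  ultimately have "t + dim ?B \<le> dim ?C"
    using card_mono[OF _ D(1)] unfolding card by simp
  then show ?thesis by simp
qed

section \<open>The Koszul complex\<close>

text \<open>The sign that moves \<open>p\<close> from the front to its place when \<open>S\<close>
  is listed by increasing \<open>\<iota>\<close>.\<close>

definition ksgn :: "('v \<Rightarrow> nat) \<Rightarrow> 'v \<Rightarrow> 'v set \<Rightarrow> 'r::comm_ring_1" where
  "ksgn \<iota> p S = (- 1) ^ card {q \<in> S. \<iota> q < \<iota> p}"

text \<open>The component at \<open>S\<close> of the Koszul differential of the chain with
  coefficient \<open>X T\<close> at each \<open>T\<close>; collecting by the target set avoids any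
  enumeration of bases.\<close>

definition kd :: "'v set \<Rightarrow> ('v \<Rightarrow> nat) \<Rightarrow> ('v set \<Rightarrow> ('v, 'k::comm_ring_1) mpol) \<Rightarrow> 'v set \<Rightarrow> ('v, 'k) mpol" where
  "kd V \<iota> X S = (\<Sum>p\<in>V - S. ksgn \<iota> p S * (Var p * X (insert p S)))"

lemma ksgn_cases: "ksgn \<iota> p S = (1 :: 'r::comm_ring_1) \<or> ksgn \<iota> p S = (- 1 :: 'r)"
  unfolding ksgn_def by (metis neg_one_even_power neg_one_odd_power)

lemma ksgn_insert:
  assumes "finite S" "p \<notin> S"
  shows "ksgn \<iota> q (insert p S) = (if \<iota> p < \<iota> q then - ksgn \<iota> q S else (ksgn \<iota> q S :: 'r::comm_ring_1))"
proof -
  have "{r \<in> insert p S. \<iota> r < \<iota> q} = (if \<iota> p < \<iota> q then insert p {r \<in> S. \<iota> r < \<iota> q} else {r \<in> S. \<iota> r < \<iota> q})"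
    by auto
  then show ?thesis using assms by (simp add: ksgn_def)
qed

lemma ksgn_min: "(\<And>q. q \<in> S \<Longrightarrow> \<iota> p \<le> \<iota> q) \<Longrightarrow> ksgn \<iota> p S = 1"
proof -
  assume "\<And>q. q \<in> S \<Longrightarrow> \<iota> p \<le> \<iota> q"
  then have "{q \<in> S. \<iota> q < \<iota> p} = {}" by force
  then show ?thesis unfolding ksgn_def by (simp only: card.empty power_0)
qed

lemma lookup_ksgn_mult:
  "lookup (ksgn \<iota> p S * (Q :: ('v, 'k::comm_ring_1) mpol)) u = ksgn \<iota> p S * lookup Q u"
proof -
  have "lookup ((- 1) ^ n * Q) u = (- 1) ^ n * lookup Q u" for n
    by (cases "even n") simp_all
  then show ?thesis by (simp add: ksgn_def)
qed

lemma keys_ksgn_mult: "keys (ksgn \<iota> p S * (Q :: ('v, 'k::comm_ring_1) mpol)) = keys Q"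
  using ksgn_cases[of \<iota> p S, where 'r = "('v, 'k) mpol"] by auto

lemma lookup_kd:
  "lookup (kd V \<iota> X S) u =
    (\<Sum>p\<in>V - S. ksgn \<iota> p S * (if lookup u p \<noteq> 0 then lookup (X (insert p S)) (u - single p 1) else 0))"
  by (simp add: kd_def lookup_sum lookup_ksgn_mult lookup_Var_mult cong: if_cong)

text \<open>Cancels the pairs \<open>(p, q)\<close> and \<open>(q, p)\<close> by induction on
  \<open>T\<close>; comparing the sum with its own negative would not suffice when two is a zero
  divisor.\<close>

lemma sum_antisym_eq_0:
  fixes A :: "'a \<Rightarrow> 'a \<Rightarrow> 'r::comm_ring_1"
  assumes "finite T" "\<And>p q. p \<in> T \<Longrightarrow> q \<in> T \<Longrightarrow> p \<noteq> q \<Longrightarrow> A p q = - A q p"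
  shows "(\<Sum>p\<in>T. \<Sum>q\<in>T - {p}. A p q) = 0"
  using assms
proof (induction T rule: finite_induct)
  case (insert x T)
  have "(\<Sum>q\<in>insert x T - {p}. A p q) = A p x + (\<Sum>q\<in>T - {p}. A p q)" if "p \<in> T" for p
  proof -
    have "insert x T - {p} = insert x (T - {p})" using that insert.hyps by auto
    then show ?thesis using insert.hyps by simp
  qed
  then have "(\<Sum>p\<in>insert x T. \<Sum>q\<in>insert x T - {p}. A p q)
      = (\<Sum>q\<in>T. A x q) + (\<Sum>p\<in>T. A p x + (\<Sum>q\<in>T - {p}. A p q))"
    using insert.hyps by simp
  also have "\<dots> = (\<Sum>q\<in>T. A x q + A q x) + (\<Sum>p\<in>T. \<Sum>q\<in>T - {p}. A p q)"
    by (simp add: sum.distrib)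
  also have "(\<Sum>q\<in>T. A x q + A q x) = 0"
    using insert.prems insert.hyps(2) by (intro sum.neutral) (metis add.right_inverse insertCI add.commute)
  also have "(\<Sum>p\<in>T. \<Sum>q\<in>T - {p}. A p q) = 0"
    by (rule insert.IH) (use insert.prems in blast)
  finally show ?case by simp
qed simp

lemma arg_min_on_eqI:
  assumes "finite T" "v \<in> T" "\<And>q. q \<in> T \<Longrightarrow> \<iota> v \<le> (\<iota> q :: nat)" "inj_on \<iota> T"
  shows "arg_min_on \<iota> T = v"
proof -
  have "T \<noteq> {}" using assms(2) by auto
  then have "arg_min_on \<iota> T \<in> T" "\<not> (\<exists>x\<in>T. \<iota> x < \<iota> (arg_min_on \<iota> T))"
    using arg_min_if_finite[OF assms(1)] by blast+
  then show ?thesis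
    using assms(2,3,4) by (metis inj_onD le_antisym not_le)
qed

text \<open>The coefficient of \<open>e\<^sub>T\<close> in the contracting homotopy applied to \<open>X\<close>: the term
  \<open>x\<^sup>w e\<^sub>S\<close> is sent to \<open>(x\<^sup>w / x\<^sub>v) e\<^sub>v \<and> e\<^sub>S\<close> if the least indeterminate \<open>v\<close> occurring in
  \<open>x\<^sup>w\<close> or \<open>S\<close> is not in \<open>S\<close>, and to zero otherwise.\<close>

definition khom :: "('v \<Rightarrow> nat) \<Rightarrow> ('v set \<Rightarrow> ('v, 'k::comm_ring_1) mpol) \<Rightarrow> 'v set \<Rightarrow> ('v, 'k) mpol" where
  "khom \<iota> X T = (let v = arg_min_on \<iota> T in
     restr (\<lambda>u. \<forall>q\<in>keys u. \<iota> v \<le> \<iota> q) (Poly_Mapping.map_key (\<lambda>u. u + single v 1) (X (T - {v}))))"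

lemma lookup_khom:
  "lookup (khom \<iota> X T) u = (if \<forall>q\<in>keys u. \<iota> (arg_min_on \<iota> T) \<le> \<iota> q
     then lookup (X (T - {arg_min_on \<iota> T})) (u + single (arg_min_on \<iota> T) 1) else 0)"
proof -
  have "inj (\<lambda>u. u + single (arg_min_on \<iota> T) (1::nat))" by (simp add: inj_def)
  then show ?thesis by (simp add: khom_def Let_def map_key.rep_eq)
qed

context
  fixes V :: "'v set" and \<iota> :: "'v \<Rightarrow> nat"
  assumes finV: "finite V" and inj: "inj_on \<iota> V"
begin

lemma kd_carrier:
  "(\<And>p. p \<in> V - S \<Longrightarrow> X (insert p S) \<in> carrier (poly_ring V)) \<Longrightarrow> kd V \<iota> X S \<in> carrier (poly_ring V)"
  unfolding kd_def by (rule pcl_sum) (simp add: in_poly_ring keys_ksgn_mult, simp flip: in_poly_ring add: pcl)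

text \<open>Taking \<open>p\<close> and \<open>q\<close> in either order gives the same product with
  opposite signs, since exactly one of them precedes the other in the injective numbering.\<close>

lemma kd_kd:
  assumes "S \<subseteq> V"
  shows "kd V \<iota> (kd V \<iota> X) S = 0"
proof -
  define A where "A p q = ksgn \<iota> p S * ksgn \<iota> q (insert p S) * (Var p * Var q * X (insert q (insert p S)))" for p q
  have fin: "finite S" using assms finV finite_subset by blast
  have "kd V \<iota> (kd V \<iota> X) S = (\<Sum>p\<in>V - S. \<Sum>q\<in>V - S - {p}. A p q)"
  proof -
    have "V - insert p S = V - S - {p}" for p by auto
    then show ?thesis by (simp add: kd_def A_def sum_distrib_left algebra_simps)
  qed
  also have "\<dots> = 0"
  proof (rule sum_antisym_eq_0)
    fix p q assume pq: "p \<in> V - S" "q \<in> V - S" "p \<noteq> q"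
    then have "\<iota> p \<noteq> \<iota> q" using inj by (auto dest: inj_onD)
    then have "ksgn \<iota> p S * ksgn \<iota> q (insert p S) = - (ksgn \<iota> q S * ksgn \<iota> p (insert q S) :: ('v, 'a) mpol)"
      using pq fin by (auto simp: ksgn_insert)
    moreover have "insert q (insert p S) = insert p (insert q S)" by auto
    ultimately show "A p q = - A q p" by (simp add: A_def mult.commute[of "Var p"])
  qed (use finV in simp)
  finally show ?thesis .
qed

lemma khom_carrier:
  assumes "T \<subseteq> V" "T \<noteq> {}" "X (T - {arg_min_on \<iota> T}) \<in> carrier (poly_ring V)"
  shows "khom \<iota> X T \<in> carrier (poly_ring V)"
proof -
  have "u \<in> mons V" if "u \<in> keys (khom \<iota> X T)" for u
  proof -
    have "u + single (arg_min_on \<iota> T) 1 \<in> keys (X (T - {arg_min_on \<iota> T}))"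
      using that by (auto simp: in_keys_iff lookup_khom split: if_splits)
    then show ?thesis using assms(3) by (auto simp: in_poly_ring mons_add)
  qed
  then show ?thesis by (auto simp: in_poly_ring)
qed

text \<open>With \<open>h\<close> the homotopy \<open>khom\<close> and \<open>d\<close> the
  differential, \<open>d h + h d\<close> is the identity away from the constants in position 0, and
  for a cycle only \<open>d h\<close> remains. Coefficients are compared at \<open>x^u e_S\<close>,
  and the argument depends on whether the least variable \<open>v\<close> occurring there belongs to
  \<open>S\<close>.\<close>

lemma kd_khom:
  fixes X :: "'v set \<Rightarrow> ('v, 'k::comm_ring_1) mpol"
  assumes S: "S \<subseteq> V"
    and X: "\<And>T. T \<subseteq> V \<Longrightarrow> card T = card S \<Longrightarrow> X T \<in> carrier (poly_ring V)"
    and cyc: "\<And>T. T \<subseteq> V \<Longrightarrow> Suc (card T) = card S \<Longrightarrow> kd V \<iota> X T = 0"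
    and aug: "S = {} \<Longrightarrow> lookup (X {}) 0 = 0"
  shows "kd V \<iota> (khom \<iota> X) S = X S"
proof (rule poly_mapping_eqI)
  fix u
  have finS: "finite S" using S finV finite_subset by blast
  have inj': "inj_on \<iota> T" if "T \<subseteq> V" for T using inj that inj_on_subset by blast
  have finT: "finite T" if "T \<subseteq> V" for T using finV that finite_subset by blast
  show "lookup (kd V \<iota> (khom \<iota> X) S) u = lookup (X S) u"
  proof (cases "u \<in> mons V")
    case False
    have "khom \<iota> X (insert p S) \<in> carrier (poly_ring V)" if p: "p \<in> V - S" for p
    proof (rule khom_carrier)
      have "arg_min_on \<iota> (insert p S) \<in> insert p S"
        using arg_min_if_finite[of "insert p S"] finS by simp
      then show "X (insert p S - {arg_min_on \<iota> (insert p S)}) \<in> carrier (poly_ring V)"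
        using p S finS by (intro X) auto
    qed (use p S in auto)
    then have "kd V \<iota> (khom \<iota> X) S \<in> carrier (poly_ring V)" by (rule kd_carrier)
    then have "u \<notin> keys (kd V \<iota> (khom \<iota> X) S)" "u \<notin> keys (X S)"
      using X[OF S refl] False by (auto simp: in_poly_ring)
    then show ?thesis by (simp add: in_keys_iff)
  next
    case True
    then have W: "keys u \<union> S \<subseteq> V" using S by (auto simp: mons_def)
    show ?thesis
    proof (cases "keys u \<union> S = {}")
      case True
      \<comment> \<open>A least variable is missing only for the constant term in position 0, which
        \<open>aug\<close> removes.\<close>
      then have "S = {}" "u = 0" by auto
      then show ?thesis using aug by (simp add: lookup_kd)
    next
      case False
      define v where "v = arg_min_on \<iota> (keys u \<union> S)"
      have v: "v \<in> keys u \<union> S" and min: "\<And>q. q \<in> keys u \<union> S \<Longrightarrow> \<iota> v \<le> \<iota> q"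
        using arg_min_if_finite[where f = \<iota>, OF finT[OF W] False] unfolding v_def by (auto simp: not_less)
      have vV: "v \<in> V" using v W by blast
      show ?thesis
      proof (cases "v \<in> S")
        case False
        then have vu: "lookup u v \<noteq> 0" using v by (simp add: in_keys_iff)
        \<comment> \<open>For \<open>p \<noteq> v\<close> the variable \<open>v\<close> still
          divides \<open>x^u / x_p\<close> and precedes everything in \<open>insert p S\<close>, so
          the homotopy gives zero there; only \<open>p = v\<close> survives.\<close>
        have "(if lookup u p \<noteq> 0 then lookup (khom \<iota> X (insert p S)) (u - single p 1) else 0) = 0"
          if p: "p \<in> V - S" "p \<noteq> v" for p
        proof (cases "lookup u p = 0")
          case False
          define w where "w = arg_min_on \<iota> (insert p S)"
          have "w \<in> insert p S"
            using arg_min_if_finite[of "insert p S"] finS unfolding w_def by simp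
          then have "w \<noteq> v" "w \<in> keys u \<union> S" "w \<in> V"
            using p \<open>v \<notin> S\<close> False S by (auto simp: in_keys_iff)
          then have "\<iota> v < \<iota> w"
            using min[of w] inj vV by (metis inj_onD le_neq_implies_less)
          moreover have "v \<in> keys (u - single p 1)"
            using vu p(2) by (simp add: in_keys_iff lookup_minus lookup_single)
          ultimately show ?thesis unfolding lookup_khom w_def[symmetric] by auto
        qed simp
        then have "lookup (kd V \<iota> (khom \<iota> X) S) u = (\<Sum>p\<in>V - S. if p = v then lookup (khom \<iota> X (insert v S)) (u - single v 1) else 0)"
          unfolding lookup_kd using vu min by (intro sum.cong refl) (auto simp: ksgn_min)
        also have "\<dots> = lookup (khom \<iota> X (insert v S)) (u - single v 1)"
          using False vV finV by simp
        also have "arg_min_on \<iota> (insert v S) = v"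
          using finS min S vV by (intro arg_min_on_eqI inj') auto
        then have "lookup (khom \<iota> X (insert v S)) (u - single v 1) = lookup (X S) (single v 1 + (u - single v 1))"
          using min False by (auto simp: lookup_khom in_keys_iff lookup_minus lookup_single add.commute)
        finally show ?thesis using mon_add_minus[OF vu] by simp
      next
        case True
        have am: "arg_min_on \<iota> (insert p S) = v" if "p \<in> V" "lookup u p \<noteq> 0" for p
          using that True finS min S by (intro arg_min_on_eqI inj') (auto simp: in_keys_iff)
        define g where "g p = (if lookup u p \<noteq> 0 then lookup (X (insert p (S - {v}))) (u - single p 1 + single v 1) else 0)" for p
        have g: "(if lookup u p \<noteq> 0 then lookup (khom \<iota> X (insert p S)) (u - single p 1) else 0) = g p"
          if p: "p \<in> V - S" for p
        proof (cases "lookup u p = 0")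
          case False
          have "insert p S - {v} = insert p (S - {v})" using p True by auto
          moreover have "\<forall>q\<in>keys (u - single p 1). \<iota> v \<le> \<iota> q"
            using min by (auto simp: in_keys_iff lookup_minus)
          ultimately show ?thesis using False p by (simp add: lookup_khom am g_def)
        qed (simp add: g_def)
        \<comment> \<open>The cycle condition at \<open>S - {v}\<close>, read at the monomial
          \<open>x^u x_v\<close>: its term for \<open>v\<close> is the wanted coefficient, and the
          others are the terms of \<open>d h X\<close> with reversed sign.\<close>
        have "0 = lookup (kd V \<iota> X (S - {v})) (u + single v 1)"
          using cyc[OF _ card_Suc_Diff1[OF finS True]] S by (simp add: subset_iff)
        also have "V - (S - {v}) = insert v (V - S)" using True vV by auto
        then have "lookup (kd V \<iota> X (S - {v})) (u + single v 1) =
            ksgn \<iota> v (S - {v}) * lookup (X S) u +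
            (\<Sum>p\<in>V - S. ksgn \<iota> p (S - {v}) * (if lookup (u + single v 1) p \<noteq> 0 then lookup (X (insert p (S - {v}))) (u + single v 1 - single p 1) else 0))"
          using True finV by (simp add: lookup_kd lookup_add insert_absorb del: One_nat_def)
        also have "ksgn \<iota> v (S - {v}) = (1 :: 'k)" using min by (intro ksgn_min) auto
        also have "(\<Sum>p\<in>V - S. ksgn \<iota> p (S - {v}) * (if lookup (u + single v 1) p \<noteq> 0 then lookup (X (insert p (S - {v}))) (u + single v 1 - single p 1) else 0))
            = (\<Sum>p\<in>V - S. - (ksgn \<iota> p S * g p))"
        proof (rule sum.cong[OF refl])
          fix p assume p: "p \<in> V - S"
          then have pv: "p \<noteq> v" using True by auto
          show "ksgn \<iota> p (S - {v}) * (if lookup (u + single v 1) p \<noteq> 0 then lookup (X (insert p (S - {v}))) (u + single v 1 - single p 1) else 0) = - (ksgn \<iota> p S * g p)"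
          proof (cases "lookup u p = 0")
            case True
            then show ?thesis using pv by (simp add: g_def lookup_add lookup_single)
          next
            case False
            have "\<iota> v < \<iota> p" using min[of p] False pv inj vV p by (auto simp: in_keys_iff le_less dest: inj_onD)
            then have "ksgn \<iota> p S = (- ksgn \<iota> p (S - {v}) :: 'k)"
              using ksgn_insert[of "S - {v}" v \<iota> p, where 'r = 'k] finS True by (simp add: insert_absorb)
            moreover have "u + single v 1 - single p 1 = u - single p 1 + single v 1"
              using False by (intro poly_mapping_eqI) (auto simp: lookup_add lookup_minus lookup_single when_def)
            ultimately show ?thesis using False pv by (simp add: g_def lookup_add lookup_single del: One_nat_def)
          qed
        qed
        finally have "lookup (X S) u = (\<Sum>p\<in>V - S. ksgn \<iota> p S * g p)"
          by (simp add: sum_negf)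
        also have "\<dots> = lookup (kd V \<iota> (khom \<iota> X) S) u"
          unfolding lookup_kd by (intro sum.cong refl) (simp only: g)
        finally show ?thesis by simp
      qed
    qed
  qed
qed

end

section \<open>The Koszul complex as a graded free resolution\<close>

definition koszul :: "'v set \<Rightarrow> ('v \<Rightarrow> nat) \<Rightarrow> (nat \<Rightarrow> nat \<Rightarrow> 'v set) \<Rightarrow> ('v, 'k::comm_ring_1) free_complex" where
  "koszul V \<iota> es = \<lparr>rk = (\<lambda>i. card V choose i), shift = (\<lambda>i _. i),
     dmat = (\<lambda>i k l. \<Sum>p\<in>V - es i k. if insert p (es i k) = es (Suc i) l then ksgn \<iota> p (es i k) * Var p else 0),
     aug = (\<lambda>_. 1)\<rparr>"

lemma koszul_simps [simp]:
  "rk (koszul V \<iota> es) i = card V choose i" "shift (koszul V \<iota> es) i k = i" "aug (koszul V \<iota> es) l = 1"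
  by (simp_all add: koszul_def)

context
  fixes V :: "'v set" and \<iota> :: "'v \<Rightarrow> nat" and es :: "nat \<Rightarrow> nat \<Rightarrow> 'v set"
  assumes finV: "finite V" and inj: "inj_on \<iota> V"
    and es: "\<And>i. bij_betw (es i) {..<card V choose i} {S. S \<subseteq> V \<and> card S = i}"
begin

definition kidx :: "'v set \<Rightarrow> nat" where
  "kidx S = inv_into {..<card V choose card S} (es (card S)) S"

lemma es_kidx: "S \<subseteq> V \<Longrightarrow> es (card S) (kidx S) = S"
  and kidx_less: "S \<subseteq> V \<Longrightarrow> kidx S < card V choose card S"
  using es[of "card S"] unfolding kidx_def bij_betw_def
  by (auto intro!: f_inv_into_f) (metis (mono_tags, lifting) inv_into_into lessThan_iff mem_Collect_eq)

lemma es_props: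
  assumes "k < card V choose i"
  shows "es i k \<subseteq> V" "card (es i k) = i" "kidx (es i k) = k"
proof -
  have "es i k \<in> {S. S \<subseteq> V \<and> card S = i}" using es[of i] assms unfolding bij_betw_def by blast
  then show 1: "es i k \<subseteq> V" "card (es i k) = i" by auto
  then show "kidx (es i k) = k"
    using es[of i] assms unfolding kidx_def bij_betw_def by (simp add: inv_into_f_f)
qed

text \<open>For each \<open>p\<close> exactly one column of the matrix belongs to
  \<open>insert p (es i k)\<close>, which turns the matrix differential into
  \<open>kd\<close>.\<close>

lemma bdry_koszul:
  assumes "k < card V choose i"
  shows "bdry (koszul V \<iota> es) (Suc i) x k = kd V \<iota> (\<lambda>S. x (kidx S)) (es i k)"
proof -
  let ?N = "card V choose Suc i" and ?S = "es i k"
  note S = es_props[OF assms]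
  have finS: "finite ?S" using S(1) finV finite_subset by blast
  have eq: "insert p ?S = es (Suc i) l \<longleftrightarrow> l = kidx (insert p ?S)" if "p \<in> V - ?S" "l < ?N" for p l
    using es_props[OF that(2)] es_kidx[of "insert p ?S"] that S finS by auto
  have lt: "kidx (insert p ?S) < ?N" if "p \<in> V - ?S" for p
    using kidx_less[of "insert p ?S"] that S finS by auto
  have "bdry (koszul V \<iota> es) (Suc i) x k =
      (\<Sum>l<?N. \<Sum>p\<in>V - ?S. if insert p ?S = es (Suc i) l then ksgn \<iota> p ?S * (Var p * x l) else 0)"
    using assms by (simp add: bdry.simps) (simp add: koszul_def sum_distrib_right if_distrib[of "\<lambda>c. c * _"] mult.assoc cong: if_cong)
  also have "\<dots> = (\<Sum>p\<in>V - ?S. \<Sum>l<?N. if insert p ?S = es (Suc i) l then ksgn \<iota> p ?S * (Var p * x l) else 0)"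
    by (rule sum.swap)
  also have "\<dots> = (\<Sum>p\<in>V - ?S. \<Sum>l<?N. if l = kidx (insert p ?S) then ksgn \<iota> p ?S * (Var p * x (kidx (insert p ?S))) else 0)"
    by (intro sum.cong refl) (simp add: eq cong: if_cong)
  also have "\<dots> = kd V \<iota> (\<lambda>S. x (kidx S)) ?S"
    unfolding kd_def by (intro sum.cong refl) (simp add: lt)
  finally show ?thesis .
qed

lemma kd_cong:
  "(\<And>p. p \<in> V - S \<Longrightarrow> X (insert p S) = Y (insert p S)) \<Longrightarrow> kd V \<iota> X S = kd V \<iota> Y S"
  unfolding kd_def by (intro sum.cong) auto

lemma bdry_koszul_kidx:
  assumes "S \<subseteq> V" "card S = i"
  shows "bdry (koszul V \<iota> es) (Suc i) x (kidx S) = kd V \<iota> (\<lambda>S. x (kidx S)) S"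
  using bdry_koszul[of "kidx S" "card S" x] kidx_less[OF assms(1)] es_kidx[OF assms(1)] assms(2) by simp

lemma koszul_dd:
  "bdry (koszul V \<iota> es) (Suc i) (bdry (koszul V \<iota> es) (Suc (Suc i)) x) = (\<lambda>k. 0 :: ('v, 'k::comm_ring_1) mpol)"
proof
  fix k
  show "bdry (koszul V \<iota> es) (Suc i) (bdry (koszul V \<iota> es) (Suc (Suc i)) x) k = (0 :: ('v, 'k) mpol)"
  proof (cases "k < card V choose i")
    case True
    note S = es_props[OF True]
    have finS: "finite (es i k)" using S(1) finV finite_subset by blast
    have "bdry (koszul V \<iota> es) (Suc i) (bdry (koszul V \<iota> es) (Suc (Suc i)) x) k
       = kd V \<iota> (\<lambda>S. bdry (koszul V \<iota> es) (Suc (Suc i)) x (kidx S)) (es i k)"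
      by (rule bdry_koszul[OF True])
    also have "\<dots> = kd V \<iota> (kd V \<iota> (\<lambda>S. x (kidx S))) (es i k)"
      using S finS by (intro kd_cong bdry_koszul_kidx) auto
    also have "\<dots> = 0" by (rule kd_kd[OF finV inj S(1)])
    finally show ?thesis .
  qed (simp add: bdry_outside)
qed

text \<open>The contracting homotopy gives an explicit preimage of each cycle, at position 0 as well
  as later.\<close>

lemma graded_free_resolution_koszul:
  "graded_free_resolution V (Idl\<^bsub>poly_ring V\<^esub> (Var ` V)) (koszul V \<iota> es :: ('v, 'k::comm_ring_1) free_complex)"
proof -
  let ?K = "koszul V \<iota> es :: ('v, 'k) free_complex"
  let ?J = "Idl\<^bsub>poly_ring V\<^esub> (Var ` V) :: ('v, 'k) mpol set"
  have J: "p \<in> ?J \<longleftrightarrow> p \<in> carrier (poly_ring V) \<and> lookup p 0 = 0" for p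
  proof -
    have "(\<forall>u\<in>keys p. keys u \<inter> V \<noteq> {}) \<longleftrightarrow> lookup p 0 = 0" if "keys p \<subseteq> mons V"
    proof -
      have "keys u \<inter> V = {} \<longleftrightarrow> u = 0" if "u \<in> keys p" for u
      proof -
        have "keys u \<subseteq> V" using that \<open>keys p \<subseteq> mons V\<close> by (auto simp: mons_def)
        then show ?thesis by (metis Int_absorb2 keys_eq_empty)
      qed
      then show ?thesis by (auto simp: in_keys_iff)
    qed
    then show ?thesis by (auto simp: Idl_vars mon_ideal_def in_poly_ring)
  qed
  have dmat: "dmat ?K i k l \<in> carrier (poly_ring V)"
    and dmat_deg: "u \<in> keys (dmat ?K i k l) \<Longrightarrow> mon_deg u = 1" for i k l u
  proof -
    have k: "keys (if insert p (es i k) = es (Suc i) l then ksgn \<iota> p (es i k) * Var p else (0 :: ('v, 'k) mpol)) \<subseteq> {single p 1}" for p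
      by (auto simp: keys_ksgn_mult Var_def)
    show "dmat ?K i k l \<in> carrier (poly_ring V)"
      unfolding koszul_def free_complex.simps using k
      by (intro pcl_sum) (unfold in_poly_ring, rule order_trans[OF k], simp)
    show "mon_deg u = 1" if mem: "u \<in> keys (dmat ?K i k l)"
    proof -
      obtain p where "u \<in> keys (if insert p (es i k) = es (Suc i) l then ksgn \<iota> p (es i k) * Var p else (0 :: ('v, 'k) mpol))"
        using mem unfolding koszul_def free_complex.simps by (rule in_keys_sumE)
      then have "u = single p 1" using k[of p] by blast
      then show ?thesis by simp
    qed
  qed
  have es0: "es 0 0 = {}"
  proof -
    have "es 0 0 \<subseteq> V" "card (es 0 0) = 0" using es_props(1,2)[of 0 0] by simp_all
    then show ?thesis using finite_subset[OF _ finV] by (simp add: card_eq_0_iff)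
  qed
  have kidx0: "kidx {} = 0" using es_props(3)[of 0 0] es0 by simp
  have bdry_carrier: "bdry ?K (Suc i) x \<in> chains V ?K i" if "x \<in> chains V ?K (Suc i)" for x i
    unfolding bdry_eq_lmap using chains_carrier[OF that] dmat
    by (intro lmap_chains) (auto simp: chains_def)
  have exact: "\<exists>y\<in>chains V ?K (Suc i). bdry ?K (Suc i) y = x"
    if x: "x \<in> chains V ?K i" and cyc: "if i = 0 then aug_map ?K x \<in> ?J else bdry ?K i x = 0" for x i
  proof -
    define X where "X S = x (kidx S)" for S
    define y where "y l = (if l < card V choose Suc i then khom \<iota> X (es (Suc i) l) else 0)" for l
    have X: "X S \<in> carrier (poly_ring V)" for S
      unfolding X_def by (rule chains_carrier[OF x])
    have fin: "finite S" if "S \<subseteq> V" for S using that finV finite_subset by blast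
    have "y \<in> chains V ?K (Suc i)"
    proof -
      have "khom \<iota> X (es (Suc i) l) \<in> carrier (poly_ring V)" if "l < card V choose Suc i" for l
        using es_props[OF that] X by (intro khom_carrier[OF finV inj]) auto
      then show ?thesis by (simp add: chains_def y_def)
    qed
    moreover have "bdry ?K (Suc i) y k = x k" for k
    proof (cases "k < card V choose i")
      case True
      note S = es_props[OF True]
      have "bdry ?K (Suc i) y k = kd V \<iota> (\<lambda>S. y (kidx S)) (es i k)"
        by (rule bdry_koszul[OF True])
      also have "\<dots> = kd V \<iota> (khom \<iota> X) (es i k)"
      proof (rule kd_cong)
        fix p assume p: "p \<in> V - es i k"
        then have "card (insert p (es i k)) = Suc i" "insert p (es i k) \<subseteq> V"
          using S fin[OF S(1)] by auto
        then show "y (kidx (insert p (es i k))) = khom \<iota> X (insert p (es i k))"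
          using kidx_less es_kidx unfolding y_def by metis
      qed
      also have "\<dots> = X (es i k)"
      proof (rule kd_khom[OF finV inj S(1) X])
        fix T assume T: "T \<subseteq> V" "Suc (card T) = card (es i k)"
        then obtain i' where i: "i = Suc i'" "card T = i'" using S(2) by simp
        have "kd V \<iota> X T = bdry ?K (Suc i') x (kidx T)"
          unfolding X_def by (rule bdry_koszul_kidx[OF T(1) i(2), symmetric])
        then show "kd V \<iota> X T = 0" using cyc by (simp add: i(1))
      next
        assume "es i k = {}"
        then have i: "i = 0" using S(2) by auto
        then have "aug_map ?K x = x 0" by (simp add: aug_map_def)
        then show "lookup (X {}) 0 = 0" using cyc i J by (simp add: X_def kidx0)
      qed
      finally show ?thesis using S(3) by (simp add: X_def)
    next
      case False
      then show ?thesis using x by (simp add: chains_def bdry_outside)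
    qed
    ultimately show ?thesis by blast
  qed
  have aug_bdry: "aug_map ?K (bdry ?K 1 x) \<in> ?J" if x: "x \<in> chains V ?K 1" for x
  proof -
    have "aug_map ?K (bdry ?K 1 x) = kd V \<iota> (\<lambda>S. x (kidx S)) {}"
      using bdry_koszul[of 0 0 x] es0 by (simp add: aug_map_def)
    moreover have "kd V \<iota> (\<lambda>S. x (kidx S)) {} \<in> carrier (poly_ring V)"
      using chains_carrier[OF x] by (intro kd_carrier[OF finV inj])
    ultimately show ?thesis by (simp add: J lookup_kd)
  qed
  show ?thesis
    unfolding graded_free_resolution_def
  proof (intro conjI allI impI ballI)
    fix f :: "('v, 'k) mpol" assume f: "f \<in> carrier (poly_ring V)"
    show "\<exists>x\<in>chains V ?K 0. f - aug_map ?K x \<in> ?J"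
      using f by (intro bexI[of _ "\<lambda>k. if k = 0 then f else 0"]) (simp_all add: aug_map_def J chains_def pcl)
  next
    show "{x \<in> chains V ?K 0. aug_map ?K x \<in> ?J} = bdry ?K 1 ` chains V ?K 1"
      using exact[of _ 0] aug_bdry bdry_carrier[of _ 0] by (auto simp: image_iff)
  next
    fix i :: nat assume i: "i \<ge> 1"
    then obtain i' where i': "i = Suc i'" by (cases i) auto
    show "{x \<in> chains V ?K i. bdry ?K i x = 0} = bdry ?K (Suc i) ` chains V ?K (Suc i)"
    proof (intro equalityI subsetI)
      fix x assume "x \<in> {x \<in> chains V ?K i. bdry ?K i x = 0}"
      then show "x \<in> bdry ?K (Suc i) ` chains V ?K (Suc i)" using exact[of x i] i by force
    next
      fix x assume "x \<in> bdry ?K (Suc i) ` chains V ?K (Suc i)"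
      then show "x \<in> {x \<in> chains V ?K i. bdry ?K i x = 0}"
        using bdry_carrier koszul_dd[of i'] by (auto simp: i' zero_fun_def)
    qed
  qed (auto simp: pcl dmat dest!: dmat_deg)
qed

end

section \<open>The Koszul complex inside an arbitrary resolution\<close>

lemma lmap_unit_vec_chains: "x \<in> chains V F i \<Longrightarrow> lmap (rk F i) unit_vec x = x"
  by (auto simp: lmap_def unit_vec_def chains_def fun_eq_iff if_distrib[of "\<lambda>x. _ * x"] cong: if_cong)

text \<open>The Koszul complex is generated in internal degree \<open>i\<close> in homological degree \<open>i\<close>, so that a
  graded endomorphism of it lifting the identity of the residue field is the
  identity itself and not only homotopic to it.\<close>

lemma koszul_chain_map_retract:
  fixes G :: "('v, 'k::comm_ring_1) free_complex" and V \<iota> es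
  defines "K \<equiv> koszul V \<iota> es" and "J \<equiv> Idl\<^bsub>poly_ring V\<^esub> (Var ` V)"
  assumes K: "graded_free_resolution V J K" and G: "graded_free_resolution V J G"
    and \<phi>: "chain_map V J K G \<phi>" and \<psi>: "chain_map V J G K \<psi>"
    and l: "l < rk K i"
  shows "lmap (rk G i) (\<psi> i) (\<phi> i l) = unit_vec l"
  using l
proof (induction i arbitrary: l)
  case (0 l)
  have rk: "rk K 0 = 1" and sh: "shift K 0 0 = 0" by (simp_all add: K_def)
  have J: "lookup p 0 = 0" if "p \<in> J" for p
  proof -
    have "p \<in> mon_ideal V (\<lambda>u. keys u \<inter> V \<noteq> {})" using that by (simp add: J_def Idl_vars)
    then have "0 \<notin> keys p" by (auto simp: mon_ideal_def)
    then show ?thesis by (simp add: in_keys_iff)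
  qed
  have Jid: "ideal J (poly_ring V)" unfolding J_def by (intro Idl_ideal) (auto intro: pcl)
  let ?\<theta> = "lmap (rk G 0) (\<psi> 0) (\<phi> 0 0)"
  have \<phi>0: "\<phi> 0 0 \<in> graded_chains V G 0 0"
    using chain_map_graded[OF \<phi>, of 0 0] rk sh by simp
  have u: "unit_vec 0 \<in> chains V K 0"
    using unit_vec_chains[of 0 K 0 V] rk by (simp add: graded_chains_def)
  have \<theta>: "?\<theta> \<in> graded_chains V K 0 0"
    by (rule lmap_graded_chains[OF \<phi>0 chain_map_graded[OF \<psi>]])
  have "aug_map K (unit_vec 0) - aug_map G (lmap (rk K 0) (\<phi> 0) (unit_vec 0)) \<in> J"
    by (rule chain_map_aug[OF \<phi> u])
  moreover have "aug_map G (\<phi> 0 0) - aug_map K ?\<theta> \<in> J"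
    by (rule chain_map_aug[OF \<psi> graded_chains_chains[OF \<phi>0]])
  ultimately have "aug_map K (unit_vec 0) - aug_map K ?\<theta> \<in> J"
    using poly_ideal_add[OF Jid, of "aug_map K (unit_vec 0) - aug_map G (\<phi> 0 0)" "aug_map G (\<phi> 0 0) - aug_map K ?\<theta>"] rk
    by (simp add: lmap_unit_vec)
  then have "1 - ?\<theta> 0 \<in> J" by (simp add: aug_map_def K_def unit_vec_def)
  then have "lookup (?\<theta> 0) 0 = 1" using J[of "1 - ?\<theta> 0"] by (simp add: lookup_minus)
  moreover have "lookup (?\<theta> 0) w = 0" if "w \<noteq> 0" for w
  proof (rule ccontr)
    assume "lookup (?\<theta> 0) w \<noteq> 0"
    then have "mon_deg w = 0" using \<theta> rk sh by (simp add: graded_chains_def in_keys_iff)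
    then show False using that by (simp add: mon_deg_eq_0_iff)
  qed
  \<comment> \<open>Degree zero leaves only a constant, and \<open>J\<close> contains no nonzero
    constant, so it must be one.\<close>
  ultimately have "?\<theta> 0 = 1" by (intro poly_mapping_eqI) (auto simp: lookup_one when_def)
  moreover have "?\<theta> k = 0" if "k \<noteq> 0" for k
    using \<theta> rk that by (simp add: graded_chains_def chains_def)
  ultimately have "?\<theta> = unit_vec 0" by (auto simp: unit_vec_def)
  then show ?case using 0 rk by simp
next
  case (Suc i l)
  have sh: "shift K i k = i" for i k by (simp add: K_def)
  have \<phi>l: "\<phi> (Suc i) l \<in> graded_chains V G (Suc i) (Suc i)"
    using chain_map_graded[OF \<phi> Suc.prems] sh by simp
  let ?\<theta> = "lmap (rk G (Suc i)) (\<psi> (Suc i)) (\<phi> (Suc i) l)"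
  have \<theta>: "?\<theta> \<in> graded_chains V K (Suc i) (Suc i)"
    by (rule lmap_graded_chains[OF \<phi>l chain_map_graded[OF \<psi>]])
  have u: "unit_vec l \<in> graded_chains V K (Suc i) (Suc i)"
    using unit_vec_chains[OF Suc.prems, of V] sh by simp
  \<comment> \<open>The error \<open>d\<close> is a cycle of internal degree \<open>Suc i\<close> at
    position \<open>Suc i\<close>, hence a boundary from position \<open>Suc (Suc i)\<close>, where
    nonzero chains have degree at least \<open>Suc (Suc i)\<close>.\<close>
  define d where "d = (\<lambda>k. ?\<theta> k - unit_vec l k)"
  have d: "d \<in> graded_chains V K (Suc i) (Suc i)"
    using \<theta> u unfolding d_def graded_chains_def chains_def by (auto simp: pcl elim!: in_keys_minusE)
  have "bdry K (Suc i) ?\<theta> = lmap (rk G i) (\<psi> i) (bdry G (Suc i) (lmap (rk K (Suc i)) (\<phi> (Suc i)) (unit_vec l)))"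
    using chain_map_bdry[OF \<psi>] Suc.prems by (simp add: lmap_unit_vec)
  also have "\<dots> = lmap (rk G i) (\<psi> i) (lmap (rk K i) (\<phi> i) (bdry K (Suc i) (unit_vec l)))"
    by (simp only: chain_map_bdry[OF \<phi>])
  also have "\<dots> = lmap (rk K i) unit_vec (bdry K (Suc i) (unit_vec l))"
    unfolding lmap_lmap by (intro lmap_cong refl Suc.IH)
  also have "\<dots> = bdry K (Suc i) (unit_vec l)"
    by (rule lmap_unit_vec_chains[OF bdry_chains[OF K graded_chains_chains[OF u]]])
  finally have "bdry K (Suc i) d = 0"
    unfolding d_def by (simp add: bdry_diff zero_fun_def)
  then have "aug_cycle J K (Suc i) d" by (simp add: aug_cycle_def)
  then obtain y where y: "y \<in> graded_chains V K (Suc (Suc i)) (Suc i)" "bdry K (Suc (Suc i)) y = d"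
    using graded_exact[OF K d] by blast
  have "y k = 0" for k
  proof (cases "k < rk K (Suc (Suc i))")
    case True
    then have "keys (y k) = {}" using y(1) sh by (fastforce simp: graded_chains_def)
    then show ?thesis by simp
  next
    case False
    then show ?thesis using y(1) by (simp add: graded_chains_def chains_def)
  qed
  then have "d = (\<lambda>k. 0)" using y(2) by (auto simp: bdry.simps)
  then show ?case by (simp add: d_def fun_eq_iff)
qed

lemma homog_closed_Idl_vars:
  "homog_closed (Idl\<^bsub>poly_ring V\<^esub> (Var ` V) :: ('v, 'k::comm_ring_1) mpol set)"
  by (auto simp: homog_closed_def Idl_vars mon_ideal_def pcl)

text \<open>A boundary modulo \<open>I\<close> has the same differential as a vector over \<open>I\<close>, so its differential
  vanishes in degrees \<open>\<le> t\<close>; but the differentials of the Koszul chains \<open>x\<^bsup>D a\<^esup> e\<^bsub>B a\<^esub>\<close> live in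
  degree \<open>t\<close> and are linearly independent.\<close>

lemma betti_lower_bound:
  fixes V :: "'v set" and I :: "('v, 'k::field) mpol set"
  assumes finV: "finite V" and I: "ideal I (poly_ring V)"
    and deg: "\<And>p u. p \<in> I \<Longrightarrow> u \<in> keys p \<Longrightarrow> t \<le> mon_deg u"
    and B: "\<And>a. a < N \<Longrightarrow> B a \<subseteq> V" "\<And>a. a < N \<Longrightarrow> card (B a) = h"
    and D: "\<And>a. a < N \<Longrightarrow> D a \<subseteq> V" "\<And>a. a < N \<Longrightarrow> Suc (card (D a)) = t" "\<And>a. a < N \<Longrightarrow> D a \<inter> B a = {}"
    and mem: "\<And>a b. a < N \<Longrightarrow> b \<in> B a \<Longrightarrow> single (sqfree_mon (insert b (D a))) 1 \<in> I"
    and dist: "\<And>a a'. a < N \<Longrightarrow> a' < N \<Longrightarrow> B a \<union> D a = B a' \<union> D a' \<Longrightarrow> a = a'"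
    and h: "h > 0"
  shows "N \<le> betti V I h (h + t - 1)"
proof -
  let ?J = "Idl\<^bsub>poly_ring V\<^esub> (Var ` V) :: ('v, 'k) mpol set"
  obtain \<iota> :: "'v \<Rightarrow> nat" where \<iota>: "inj_on \<iota> V"
    using finite_imp_inj_to_nat_seg[OF finV] by blast
  have "\<exists>f. bij_betw f {..<card V choose i} {S. S \<subseteq> V \<and> card S = i}" for i
    using n_subsets[OF finV, of i] finV by (metis (no_types, lifting) bij_betw_iff_card card_lessThan finite_Collect_subsets finite_lessThan finite_subset Collect_mono)
  then obtain es where es: "\<And>i. bij_betw (es i) {..<card V choose i} {S. S \<subseteq> V \<and> card S = i}"
    by metis
  define K :: "('v, 'k) free_complex" where "K = koszul V \<iota> es"
  define ix where "ix = kidx V es"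
  note es_kidx = es_kidx[OF finV \<iota> es, folded ix_def]
    and kidx_less = kidx_less[OF finV \<iota> es, folded ix_def]
    and es_props = es_props[OF finV \<iota> es, folded ix_def]
  have bdry_koszul: "bdry K (Suc i) v k = kd V \<iota> (\<lambda>S. v (ix S)) (es i k)"
    if "k < card V choose i" for i k v
    unfolding K_def ix_def by (rule bdry_koszul[OF finV \<iota> es that])
  have bdry_koszul_kidx: "bdry K (Suc i) v (ix S) = kd V \<iota> (\<lambda>S. v (ix S)) S"
    if "S \<subseteq> V" "card S = i" for i S v
    unfolding K_def ix_def by (rule bdry_koszul_kidx[OF finV \<iota> es that])
  have rkK: "rk K i = card V choose i" and shK: "shift K i k = i" for i k by (simp_all add: K_def)
  have K: "graded_free_resolution V ?J K"
    unfolding K_def by (rule graded_free_resolution_koszul[OF finV \<iota> es])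
  define G where "G = (SOME F. graded_free_resolution V ?J F)"
  have G: "graded_free_resolution V ?J G" unfolding G_def using K by (rule someI)
  have J: "ideal ?J (poly_ring V)" by (intro Idl_ideal) (auto intro: pcl)
  obtain \<phi> where \<phi>: "chain_map V ?J K G \<phi>"
    using chain_map_exists[OF K G J homog_closed_Idl_vars] .
  obtain \<psi> where \<psi>: "chain_map V ?J G K \<psi>"
    using chain_map_exists[OF G K J homog_closed_Idl_vars] .
  have retract: "lmap (rk G i) (\<psi> i) (lmap (rk K i) (\<phi> i) x) = x" if "x \<in> chains V K i" for i x
  proof -
    have "lmap (rk G i) (\<psi> i) (\<phi> i l) = unit_vec l" if "l < rk K i" for l
      using koszul_chain_map_retract[of V \<iota> es G \<phi> \<psi> l i] K G \<phi> \<psi> that unfolding K_def by blast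
    then have "lmap (rk G i) (\<psi> i) (lmap (rk K i) (\<phi> i) x) = lmap (rk K i) unit_vec x"
      unfolding lmap_lmap by (intro lmap_cong) auto
    then show ?thesis using lmap_unit_vec_chains[OF that] by simp
  qed
  have \<phi>_gr: "\<phi> i l \<in> graded_chains V G i i" if "l < rk K i" for i l
    using chain_map_graded[OF \<phi> that] shK by simp
  have \<phi>_bdry: "bdry G (Suc i) (lmap (rk K (Suc i)) (\<phi> (Suc i)) x) = lmap (rk K i) (\<phi> i) (bdry K (Suc i) x)" for i x
    by (rule chain_map_bdry[OF \<phi>])
  have \<psi>_gr: "\<psi> i l \<in> graded_chains V K i (shift G i l)" if "l < rk G i" for i l
    by (rule chain_map_graded[OF \<psi> that])
  have \<psi>_bdry: "bdry K (Suc i) (lmap (rk G (Suc i)) (\<psi> (Suc i)) x) = lmap (rk G i) (\<psi> i) (bdry G (Suc i) x)" for i x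
    by (rule chain_map_bdry[OF \<psi>])
  obtain h' where h': "h = Suc h'" using h by (cases h) auto
  have fin: "finite S" if "S \<subseteq> V" for S using that finV finite_subset by blast
  have finB: "finite (B a)" and finD: "finite (D a)" if "a < N" for a
    using B(1)[OF that] D(1)[OF that] fin by auto
  define z :: "nat \<Rightarrow> nat \<Rightarrow> ('v, 'k) mpol" where
    "z a k = (if k < card V choose h \<and> es h k = B a then single (sqfree_mon (D a)) 1 else 0)" for a k
  define x where "x a = lmap (rk K h) (\<phi> h) (z a)" for a
  have z_gr: "z a \<in> graded_chains V K h (h + t - 1)" if a: "a < N" for a
    using D(1,2)[OF a] finD[OF a]
    by (auto simp: graded_chains_def chains_def z_def rkK shK mon_deg_sqfree_mon mons_def keys_sqfree_mon intro!: pcl)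
  have z_ix: "z a (ix T) = (if T = B a then single (sqfree_mon (D a)) 1 else 0)"
    if "T \<subseteq> V" "card T = h" for a T
    using es_kidx[OF that(1)] kidx_less[OF that(1)] that(2) by (simp add: z_def)
  \<comment> \<open>The differential of \<open>x^D e_B\<close> has the entries
    \<open>x_p x^D\<close> up to sign, with \<open>p\<close> in \<open>B\<close>, and these
    monomials are in \<open>I\<close> by \<open>mem\<close>.\<close>
  have z_bdry: "bdry K h (z a) k \<in> I" if a: "a < N" for a k
  proof (cases "k < card V choose h'")
    case True
    note S = es_props[OF True]
    have "ksgn \<iota> p (es h' k) * (Var p * z a (ix (insert p (es h' k)))) \<in> I" if p: "p \<in> V - es h' k" for p
    proof -
      have "Var p * z a (ix (insert p (es h' k))) \<in> I"
      proof (cases "insert p (es h' k) = B a")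
        case True
        then have "p \<notin> D a" "p \<in> B a" using D(3)[OF a] by auto
        then have "Var p * single (sqfree_mon (D a)) 1 = (single (sqfree_mon (insert p (D a))) 1 :: ('v, 'k) mpol)"
          using finD[OF a] by (simp add: Var_def mult_single sqfree_mon_def)
        then show ?thesis using mem[OF a \<open>p \<in> B a\<close>] z_ix[of "insert p (es h' k)" a] True B[OF a] by simp
      next
        case False
        then show ?thesis using z_ix[of "insert p (es h' k)" a] p S fin[OF S(1)] h' poly_ideal_0[OF I] by simp
      qed
      then show ?thesis
        using ksgn_cases[of \<iota> p "es h' k", where 'r = "('v, 'k) mpol"] poly_ideal_uminus[OF I] by auto
    qed
    then show ?thesis
      unfolding h' bdry_koszul[OF True] kd_def by (intro poly_ideal_sum[OF I])
  next
    case False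
    then show ?thesis using poly_ideal_0[OF I] by (simp add: h' bdry_outside rkK)
  qed
  have "N \<le> vector_space.dim vec_scale (tensor_cycles V G I h (h + t - 1)) -
      vector_space.dim vec_scale (tensor_boundaries V G I h (h + t - 1))"
  proof (rule tensor_dim_lower_bound[OF finV I G])
    fix a assume a: "a < N"
    have "x a \<in> graded_chains V G h (h + t - 1)"
      unfolding x_def using \<phi>_gr by (intro lmap_graded_chains[OF z_gr[OF a]]) (simp add: shK)
    moreover have "bdry G h (x a) k \<in> I" for k
      using z_bdry[OF a] unfolding x_def h' \<phi>_bdry
      by (intro lmap_ideal[OF I]) (auto intro: chains_carrier graded_chains_chains \<phi>_gr)
    ultimately show "x a \<in> tensor_cycles V G I h (h + t - 1)" by (simp add: tensor_cycles_def)
  next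
    fix c :: "nat \<Rightarrow> 'k"
    assume "(\<lambda>k. \<Sum>a<N. single 0 (c a) * x a k) \<in> tensor_boundaries V G I h (h + t - 1)"
    then obtain y where y: "y \<in> graded_chains V G (Suc h) (h + t - 1)"
      and yI: "\<And>k. (\<Sum>a<N. single 0 (c a) * x a k) - bdry G (Suc h) y k \<in> I"
      unfolding tensor_boundaries_def by blast
    define Z where "Z k = (\<Sum>a<N. single 0 (c a) * z a k)" for k
    define w where "w k = (\<Sum>a<N. single 0 (c a) * x a k) - bdry G (Suc h) y k" for k
    \<comment> \<open>Back in the Koszul complex the relation says that \<open>Z\<close> differs
      from a boundary by the vector \<open>w'\<close> with entries in \<open>I\<close>.\<close>
    define w' where "w' = lmap (rk G h) (\<psi> h) w"
    have Z: "Z \<in> chains V K h"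
      using graded_chains_chains[OF z_gr] unfolding Z_def chains_def by (auto intro!: pcl sum.neutral)
    have "w = (\<lambda>k. lmap (rk K h) (\<phi> h) Z k - bdry G (Suc h) y k)"
      unfolding w_def x_def Z_def lmap_sum ..
    then have "w' = (\<lambda>k. Z k - bdry K (Suc h) (lmap (rk G (Suc h)) (\<psi> (Suc h)) y) k)"
      by (simp add: w'_def lmap_diff retract[OF Z] \<psi>_bdry)
    moreover have "lmap (rk G (Suc h)) (\<psi> (Suc h)) y \<in> chains V K (Suc h)"
      using graded_chains_chains[OF y] \<psi>_gr
      by (intro lmap_chains) (auto intro: chains_carrier graded_chains_chains)
    ultimately have "bdry K h w' = bdry K h Z"
      by (simp add: bdry_diff bdry_bdry[OF K])
    moreover have w'I: "w' k \<in> I" for k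
      unfolding w'_def by (intro lmap_ideal[OF I])
        (auto simp: w_def yI intro: chains_carrier graded_chains_chains \<psi>_gr)
    show "\<forall>a<N. c a = 0"
    proof (intro allI impI)
      fix a assume a: "a < N"
      \<comment> \<open>The entry at \<open>S = B a - {b}\<close> of the differential of
        \<open>Z\<close> has at the monomial of \<open>A = insert b (D a)\<close> the coefficient
        \<open>c a\<close> up to sign; any \<open>b\<close> in \<open>B a\<close> works.\<close>
      obtain b where b: "b \<in> B a" using B(2)[OF a] h by (metis all_not_in_conv card.empty less_irrefl)
      define S where "S = B a - {b}"
      define A where "A = insert b (D a)"
      have S: "S \<subseteq> V" "card S = h'" "finite S"
        using B[OF a] b finB[OF a] by (auto simp: S_def h')
      have bD: "b \<notin> D a" using b D(3)[OF a] by auto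
      have A: "finite A" "card A = t" using finD[OF a] D(2)[OF a] bD by (auto simp: A_def)
      have *: "lookup (bdry K h v (ix S)) (sqfree_mon A) =
          (\<Sum>p\<in>V - S. ksgn \<iota> p S * (if p \<in> A then lookup (v (ix (insert p S))) (sqfree_mon (A - {p})) else 0))" for v
        unfolding h' bdry_koszul_kidx[OF S(1,2)] lookup_kd
        using A(1) by (intro sum.cong refl) (simp add: lookup_sqfree_mon sqfree_mon_minus del: One_nat_def)
      have "lookup (bdry K h w' (ix S)) (sqfree_mon A) = 0"
      proof -
        \<comment> \<open>The monomials that could contribute have degree \<open>t - 1\<close>,
          below every monomial occurring in \<open>I\<close>.\<close>
        have "lookup (w' k) (sqfree_mon (A - {p})) = 0" if "p \<in> A" for k p
        proof (rule ccontr)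
          assume "lookup (w' k) (sqfree_mon (A - {p})) \<noteq> 0"
          then have "t \<le> mon_deg (sqfree_mon (A - {p}))"
            using deg[OF w'I] by (simp add: in_keys_iff)
          then show False using card_Diff1_less[OF A(1) that] unfolding mon_deg_sqfree_mon A(2) by linarith
        qed
        then show ?thesis unfolding * by (intro sum.neutral) simp
      qed
      moreover have "lookup (bdry K h Z (ix S)) (sqfree_mon A) = ksgn \<iota> b S * c a"
      proof -
        have t: "(if p \<in> A then lookup (Z (ix (insert p S))) (sqfree_mon (A - {p})) else 0)
            = (if p = b then c a else 0)" if p: "p \<in> V - S" for p
        proof -
          have T: "insert p S \<subseteq> V" "card (insert p S) = h" using p S by (auto simp: h')
          have "lookup (Z (ix (insert p S))) (sqfree_mon (A - {p})) =
              (\<Sum>a'<N. if a' = a \<and> p = b then c a else 0)" if pA: "p \<in> A"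
            unfolding Z_def lookup_sum
          proof (rule sum.cong[OF refl])
            fix a' assume "a' \<in> {..<N}"
            then have a': "a' < N" by simp
            have "insert p S = B a' \<and> sqfree_mon (D a') = sqfree_mon (A - {p}) \<longleftrightarrow> a' = a \<and> p = b"
            proof
              assume eq: "insert p S = B a' \<and> sqfree_mon (D a') = sqfree_mon (A - {p})"
              then have "keys (sqfree_mon (D a')) = keys (sqfree_mon (A - {p}))" by (simp only:)
              then have "D a' = A - {p}" using finD[OF a'] A(1) by (simp only: keys_sqfree_mon finite_Diff)
              \<comment> \<open>Moving a point between block and monomial does not change the union,
                so \<open>dist\<close> identifies \<open>a'\<close>; then \<open>p\<close>, being in
                \<open>B a\<close> but not in \<open>S\<close>, is \<open>b\<close>.\<close>
              then have "B a' \<union> D a' = insert p (B a - {b}) \<union> (insert b (D a) - {p})"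
                using eq by (simp add: S_def A_def)
              also have "\<dots> = B a \<union> D a" using pA b by (auto simp: A_def)
              finally have "a' = a" using dist[OF a' a] by simp
              moreover from this have "p \<in> B a" using eq by auto
              ultimately show "a' = a \<and> p = b" using p by (auto simp: S_def)
            next
              assume "a' = a \<and> p = b"
              then show "insert p S = B a' \<and> sqfree_mon (D a') = sqfree_mon (A - {p})"
                using b bD by (auto simp: S_def A_def)
            qed
            then show "lookup (single 0 (c a') * z a' (ix (insert p S))) (sqfree_mon (A - {p})) = (if a' = a \<and> p = b then c a else 0)"
              by (auto simp: lookup_const_mult z_ix[OF T] lookup_single when_def)
          qed
          then show ?thesis using a b by (auto simp: A_def)
        qed
        have "lookup (bdry K h Z (ix S)) (sqfree_mon A) = (\<Sum>p\<in>V - S. if p = b then ksgn \<iota> b S * c a else 0)"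
          unfolding * by (intro sum.cong refl) (simp add: t)
        also have "\<dots> = ksgn \<iota> b S * c a"
          using finV b B(1)[OF a] by (auto simp: S_def)
        finally show ?thesis .
      qed
      ultimately have "ksgn \<iota> b S * c a = 0" using \<open>bdry K h w' = bdry K h Z\<close> by simp
      then show "c a = 0" using ksgn_cases[of \<iota> b S, where 'r = 'k] by auto
    qed
  qed
  then show ?thesis by (simp add: betti_def tor_dim_def G_def Let_def)
qed

section \<open>Monomial orders and heights of prime ideals\<close>

lemma monomial_order_trans: "monomial_order V r \<Longrightarrow> (a, b) \<in> r \<Longrightarrow> (b, c) \<in> r \<Longrightarrow> (a, c) \<in> r"
  and monomial_order_antisym: "monomial_order V r \<Longrightarrow> (a, b) \<in> r \<Longrightarrow> (b, a) \<in> r \<Longrightarrow> a = b"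
  and monomial_order_total: "monomial_order V r \<Longrightarrow> a \<in> mons V \<Longrightarrow> b \<in> mons V \<Longrightarrow> (a, b) \<in> r \<or> (b, a) \<in> r"
  and monomial_order_refl: "monomial_order V r \<Longrightarrow> a \<in> mons V \<Longrightarrow> (a, a) \<in> r"
  and monomial_order_add: "monomial_order V r \<Longrightarrow> (a, b) \<in> r \<Longrightarrow> c \<in> mons V \<Longrightarrow> (a + c, b + c) \<in> r"
  unfolding monomial_order_def linear_order_on_def partial_order_on_def preorder_on_def
    trans_def antisym_def total_on_def refl_on_def by metis+

lemma monomial_order_add_mono:
  assumes r: "monomial_order V r" and "(a, b) \<in> r" "(c, d) \<in> r" "b \<in> mons V" "c \<in> mons V"
  shows "(a + c, b + d) \<in> r"
  using monomial_order_trans[OF r] monomial_order_add[OF r assms(2,5)] monomial_order_add[OF r assms(3,4)]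
  by (metis add.commute)

text \<open>The order is strict under addition: if one summand were smaller than its bound, so would
  be the sum.\<close>

lemma monomial_order_add_eqD:
  assumes r: "monomial_order V r" and ab: "(a, b) \<in> r" and cd: "(c, d) \<in> r"
    and m: "b \<in> mons V" "c \<in> mons V" and eq: "a + c = b + d"
  shows "a = b \<and> c = d"
proof -
  have "(a + c, b + c) \<in> r" by (rule monomial_order_add[OF r ab m(2)])
  moreover have "(b + c, b + d) \<in> r"
    using monomial_order_add[OF r cd m(1)] by (simp add: add.commute)
  ultimately have "b + c = b + d" using monomial_order_antisym[OF r] eq by metis
  then show ?thesis using eq by simp
qed

lemma monomial_order_max:
  assumes r: "monomial_order V r" and "finite A" "A \<noteq> {}" "A \<subseteq> mons V"
  obtains u where "u \<in> A" "\<And>v. v \<in> A \<Longrightarrow> (v, u) \<in> r"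
proof -
  have "\<exists>u\<in>A. \<forall>v\<in>A. (v, u) \<in> r"
    using assms(2-4)
  proof (induction A rule: finite_ne_induct)
    case (singleton x)
    then show ?case using monomial_order_refl[OF r] by simp
  next
    case (insert x A)
    then obtain u where u: "u \<in> A" "\<forall>v\<in>A. (v, u) \<in> r" by auto
    have x: "x \<in> mons V" "u \<in> mons V" using insert.prems u by auto
    consider "(x, u) \<in> r" | "(u, x) \<in> r" using monomial_order_total[OF r x] by blast
    then show ?case
    proof cases
      case 1 then show ?thesis using u by blast
    next
      case 2
      have "(v, x) \<in> r" if "v \<in> A" for v
        using monomial_order_trans[OF r _ 2] u(2) that by blast
      then show ?thesis using monomial_order_refl[OF r x(1)] by blast
    qed
  qed
  then show thesis using that by blast
qed

lemma initial_mon_props: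
  assumes r: "monomial_order V r" and f: "f \<in> carrier (poly_ring V)" "f \<noteq> 0"
  shows "initial_mon r f \<in> keys f" "\<And>v. v \<in> keys f \<Longrightarrow> (v, initial_mon r f) \<in> r"
proof -
  obtain u where u: "u \<in> keys f" "\<And>v. v \<in> keys f \<Longrightarrow> (v, u) \<in> r"
    using monomial_order_max[OF r, of "keys f"] f by (auto simp: in_poly_ring)
  have "initial_mon r f = u"
    unfolding initial_mon_def
    by (rule the_equality) (use u monomial_order_antisym[OF r] in blast)+
  then show "initial_mon r f \<in> keys f" "\<And>v. v \<in> keys f \<Longrightarrow> (v, initial_mon r f) \<in> r"
    using u by simp_all
qed

text \<open>Only an upper bound for the support: \<open>w\<close> need not occur in
  \<open>p\<close>, and \<open>p\<close> may be zero, so cancellation does no harm.\<close>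

definition keys_below :: "'v mon rel \<Rightarrow> 'v mon \<Rightarrow> ('v, 'k::zero) mpol \<Rightarrow> bool" where
  "keys_below r w p \<longleftrightarrow> (\<forall>x\<in>keys p. (x, w) \<in> r)"

lemma monomial_order_mem: "monomial_order V r \<Longrightarrow> (a, b) \<in> r \<Longrightarrow> a \<in> mons V \<and> b \<in> mons V"
  unfolding monomial_order_def linear_order_on_def partial_order_on_def preorder_on_def by blast

lemma keys_below_mult:
  assumes r: "monomial_order V r" and p: "keys_below r a p" and q: "keys_below r b q"
  shows "keys_below r (a + b) (p * q)"
  unfolding keys_below_def
proof
  fix x assume "x \<in> keys (p * q)"
  then obtain u v where uv: "u \<in> keys p" "v \<in> keys q" "x = u + v" by (rule in_keys_multE)
  then have "(u, a) \<in> r" "(v, b) \<in> r" using p q by (auto simp: keys_below_def)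
  then show "(x, a + b) \<in> r"
    unfolding uv(3) using monomial_order_mem[OF r] by (intro monomial_order_add_mono[OF r]) auto
qed

text \<open>Only the pair \<open>(a, b)\<close> reaches the bound \<open>a + b\<close>. This
  includes the case that one of the two coefficients vanishes.\<close>

lemma lookup_mult_top:
  fixes p q :: "('v, 'k::comm_ring_1) mpol"
  assumes r: "monomial_order V r" and p: "keys_below r a p" and q: "keys_below r b q"
  shows "lookup (p * q) (a + b) = lookup p a * lookup q b"
proof -
  have eq: "a + b = u + v \<longleftrightarrow> u = a \<and> v = b" if "u \<in> keys p" "v \<in> keys q" for u v
  proof -
    have "(u, a) \<in> r" "(v, b) \<in> r" using p q that by (auto simp: keys_below_def)
    then show ?thesis
      using monomial_order_add_eqD[OF r, of u a v b] monomial_order_mem[OF r] by auto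
  qed
  have "lookup (p * q) (a + b) = (\<Sum>u\<in>keys p. \<Sum>v\<in>keys q. if u = a then if v = b then lookup p a * lookup q b else 0 else 0)"
    unfolding lookup_mult_sum by (intro sum.cong refl) (auto simp: eq)
  also have "\<dots> = (\<Sum>u\<in>keys p. if u = a then (\<Sum>v\<in>keys q. if v = b then lookup p a * lookup q b else 0) else 0)"
    by (intro sum.cong refl) auto
  also have "\<dots> = lookup p a * lookup q b"
    by (auto simp: in_keys_iff)
  finally show ?thesis .
qed

text \<open>After dropping all terms that involve \<open>C\<close> from both factors, the product of
  the largest remaining monomials survives; the monomial order serves to select these.\<close>

lemma primeideal_mon_ideal:
  assumes r: "monomial_order V r" and C: "C \<subseteq> V"
  shows "primeideal (mon_ideal V (\<lambda>u. keys u \<inter> C \<noteq> {}) :: ('v, 'k::field) mpol set) (poly_ring V)"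
    (is "primeideal ?P _")
proof (rule primeidealI)
  show "ideal ?P (poly_ring V)"
    by (rule ideal_mon_ideal) (auto simp: in_keys_iff lookup_add disjoint_iff)
  show "cring (poly_ring V :: ('v, 'k) mpol ring)" by (rule cring_poly_ring)
  have "(1 :: ('v, 'k) mpol) \<notin> ?P" by (auto simp: mon_ideal_def)
  then show "carrier (poly_ring V) \<noteq> ?P" using pcl_1 by blast
  have max: "\<exists>u\<in>keys p. keys u \<inter> C = {} \<and> keys_below r u (restr (\<lambda>u. keys u \<inter> C = {}) p)"
    if p: "p \<in> carrier (poly_ring V)" "p \<notin> ?P" for p :: "('v, 'k) mpol"
  proof -
    let ?A = "keys (restr (\<lambda>u. keys u \<inter> C = {}) p)"
    have "?A \<noteq> {}" "?A \<subseteq> mons V" using p by (auto simp: mon_ideal_def in_poly_ring)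
    then obtain u where "u \<in> ?A" "\<And>v. v \<in> ?A \<Longrightarrow> (v, u) \<in> r"
      using monomial_order_max[OF r, of ?A] by (metis finite_keys)
    then show ?thesis by (auto simp: keys_below_def)
  qed
  fix p q :: "('v, 'k) mpol"
  assume p: "p \<in> carrier (poly_ring V)" and q: "q \<in> carrier (poly_ring V)" and "p \<otimes>\<^bsub>poly_ring V\<^esub> q \<in> ?P"
  then have pq: "p * q \<in> ?P" by simp
  show "p \<in> ?P \<or> q \<in> ?P"
  proof (rule ccontr)
    let ?\<rho> = "restr (\<lambda>u. keys u \<inter> C = {}) :: ('v, 'k) mpol \<Rightarrow> _"
    assume "\<not> (p \<in> ?P \<or> q \<in> ?P)"
    then have "p \<notin> ?P" "q \<notin> ?P" by auto
    obtain u where u: "u \<in> keys p" "keys u \<inter> C = {}" "keys_below r u (?\<rho> p)"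
      using max[OF p \<open>p \<notin> ?P\<close>] by blast
    obtain v where v: "v \<in> keys q" "keys v \<inter> C = {}" "keys_below r v (?\<rho> q)"
      using max[OF q \<open>q \<notin> ?P\<close>] by blast
    have add: "keys (a + b) \<inter> C = {} \<longleftrightarrow> keys a \<inter> C = {} \<and> keys b \<inter> C = {}" for a b :: "'v mon"
      by (auto simp: in_keys_iff lookup_add disjoint_iff)
    \<comment> \<open>A factor of a monomial free of \<open>C\<close> is free of \<open>C\<close>,
      so the coefficient at \<open>u + v\<close> is the same for the product and for the product of
      the reduced factors.\<close>
    have avoid: "keys a \<inter> C = {} \<and> keys b \<inter> C = {}" if "u + v = a + b" for a b
      using add[of a b] add[of u v] u(2) v(2) that by simp
    have "lookup (?\<rho> p * ?\<rho> q) (u + v) = (\<Sum>a\<in>keys p. if keys a \<inter> C = {} then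
        (\<Sum>b\<in>keys q. if keys b \<inter> C = {} then if u + v = a + b then lookup p a * lookup q b else 0 else 0) else 0)"
      unfolding lookup_mult_sum keys_restr sum.inter_filter[OF finite_keys]
      by (intro sum.cong refl if_cong) auto
    also have "\<dots> = lookup (p * q) (u + v)"
      unfolding lookup_mult_sum
    proof (rule sum.cong[OF refl])
      fix a assume "a \<in> keys p"
      have "(\<Sum>b\<in>keys q. if keys b \<inter> C = {} then if u + v = a + b then lookup p a * lookup q b else 0 else 0)
          = (\<Sum>b\<in>keys q. if u + v = a + b then lookup p a * lookup q b else 0)"
        by (rule sum.cong[OF refl]) (simp add: avoid)
      moreover have "(\<Sum>b\<in>keys q. if u + v = a + b then lookup p a * lookup q b else 0) = 0" if "keys a \<inter> C \<noteq> {}"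
        by (rule sum.neutral) (use avoid that in auto)
      ultimately show "(if keys a \<inter> C = {} then
          (\<Sum>b\<in>keys q. if keys b \<inter> C = {} then if u + v = a + b then lookup p a * lookup q b else 0 else 0) else 0)
          = (\<Sum>b\<in>keys q. if u + v = a + b then lookup p a * lookup q b else 0)" by simp
    qed
    finally have "lookup (p * q) (u + v) = lookup (?\<rho> p * ?\<rho> q) (u + v)" by simp
    also have "\<dots> = lookup p u * lookup q v"
      using lookup_mult_top[OF r u(3) v(3)] u v by simp
    finally have "u + v \<in> keys (p * q)" using u(1) v(1) by (simp add: in_keys_iff)
    moreover have "keys (u + v) \<inter> C = {}" using add u(2) v(2) by blast
    ultimately show False using pq unfolding mon_ideal_def by blast
  qed
qed

section \<open>Bounding heights by growth\<close>

definition box :: "nat \<Rightarrow> ('v, 'k::zero) mpol set" where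
  "box D = {p. \<forall>u\<in>keys p. \<forall>v. lookup u v < D}"

definition indep_mod :: "('v, 'k::comm_ring_1) mpol set \<Rightarrow> nat \<Rightarrow> (nat \<Rightarrow> ('v, 'k) mpol) \<Rightarrow> bool" where
  "indep_mod Q M g \<longleftrightarrow> (\<forall>c. (\<Sum>k<M. single 0 (c k) * g k) \<in> Q \<longrightarrow> (\<forall>k<M. c k = 0))"

text \<open>An elementary substitute for \<open>dim R/Q \<ge> s\<close>.\<close>

definition growth :: "'v set \<Rightarrow> ('v, 'k::comm_ring_1) mpol set \<Rightarrow> nat \<Rightarrow> bool" where
  "growth V Q s \<longleftrightarrow> (\<exists>C>0. \<forall>N>0. \<exists>g. (\<forall>k<N ^ s. g k \<in> carrier (poly_ring V) \<inter> box (C * N)) \<and> indep_mod Q (N ^ s) g)"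

lemma box_mult: "p \<in> box a \<Longrightarrow> q \<in> box b \<Longrightarrow> p * q \<in> box (a + b)"
  by (auto simp: box_def lookup_add elim!: in_keys_multE intro!: add_strict_mono)

lemma box_mono: "p \<in> box a \<Longrightarrow> a \<le> b \<Longrightarrow> p \<in> box b"
  by (auto simp: box_def intro: less_le_trans)

text \<open>Carries the factor \<open>q\<close> because \<open>p ^ 0 = 1\<close> does not lie in
  \<open>box 0\<close>, the exponent bound being strict.\<close>

lemma box_power_mult: "p \<in> box a \<Longrightarrow> q \<in> box b \<Longrightarrow> p ^ i * q \<in> box (i * a + b)"
proof (induction i)
  case (Suc i)
  have "p * (p ^ i * q) \<in> box (a + (i * a + b))"
    by (rule box_mult[OF Suc.prems(1) Suc.IH[OF Suc.prems]])
  then show ?case by (simp add: algebra_simps)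
qed simp

lemma box_exists:
  obtains e where "p \<in> box e"
proof -
  have "lookup u v < Suc (\<Sum>u\<in>keys p. mon_deg u)" if "u \<in> keys p" for u v
  proof -
    have "lookup u v \<le> mon_deg u"
      by (cases "v \<in> keys u") (auto simp: mon_deg_def in_keys_iff intro: member_le_sum)
    also have "\<dots> \<le> (\<Sum>u\<in>keys p. mon_deg u)" using that by (intro member_le_sum) auto
    finally show ?thesis by simp
  qed
  then have "p \<in> box (Suc (\<Sum>u\<in>keys p. mon_deg u))" by (simp add: box_def)
  then show thesis by (rule that)
qed

lemma sum_lessThan_mult:
  fixes h :: "nat \<Rightarrow> 'a::comm_monoid_add"
  shows "(\<Sum>k<N * M. h k) = (\<Sum>i<N. \<Sum>j<M. h (i * M + j))"
proof (induction N)
  case (Suc N)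
  have "(\<Sum>k<a + b. h k) = (\<Sum>k<a. h k) + (\<Sum>j<b. h (a + j))" for a b
    by (induction b) (auto simp: add.assoc)
  then show ?case using Suc by (simp add: add.commute[of M])
qed simp

text \<open>Choose \<open>f\<close> in \<open>Q'\<close> but not in \<open>Q\<close>. The products
  \<open>f ^ i * g j\<close> with \<open>i < N\<close> are independent modulo \<open>Q\<close>:
  modulo \<open>Q'\<close> only \<open>i = 0\<close> remains, and once its coefficients vanish,
  primality of \<open>Q\<close> cancels a factor \<open>f\<close>.\<close>

lemma growth_prime_subset:
  fixes Q Q' :: "('v, 'k::field) mpol set"
  assumes Q: "primeideal Q (poly_ring V)" and Q': "ideal Q' (poly_ring V)" and sub: "Q \<subset> Q'"
    and gr: "growth V Q' s"
  shows "growth V Q (Suc s)"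
proof -
  obtain f where f: "f \<in> Q'" "f \<notin> Q" using sub by blast
  have fc: "f \<in> carrier (poly_ring V)" using poly_ideal_carrier[OF Q' f(1)] .
  have Qi: "ideal Q (poly_ring V)" using Q by (rule primeideal.axioms(1))
  obtain e where e: "f \<in> box e" by (rule box_exists)
  obtain C where C: "C > 0" "\<And>N. N > 0 \<Longrightarrow> \<exists>g. (\<forall>k<N ^ s. g k \<in> carrier (poly_ring V) \<inter> box (C * N)) \<and> indep_mod Q' (N ^ s) g"
    using gr unfolding growth_def by blast
  have "\<exists>g. (\<forall>k<N ^ Suc s. g k \<in> carrier (poly_ring V) \<inter> box ((C + e) * N)) \<and> indep_mod Q (N ^ Suc s) g" if N: "N > 0" for N
  proof -
    define M where "M = N ^ s"
    obtain g where g: "\<And>k. k < M \<Longrightarrow> g k \<in> carrier (poly_ring V)" "\<And>k. k < M \<Longrightarrow> g k \<in> box (C * N)" "indep_mod Q' M g"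
      using C(2)[OF N] unfolding M_def by blast
    have indep: "\<forall>i<n. \<forall>j<M. c i j = 0"
      if "(\<Sum>i<n. f ^ i * (\<Sum>j<M. single 0 (c i j) * g j)) \<in> Q" for n and c :: "nat \<Rightarrow> nat \<Rightarrow> 'k"
      using that
    proof (induction n arbitrary: c)
      case (Suc n)
      let ?b = "\<lambda>i. \<Sum>j<M. single 0 (c i j) * g j"
      let ?T = "\<Sum>i<n. f ^ i * ?b (Suc i)"
      have b: "?b i \<in> carrier (poly_ring V)" for i using g(1) by (intro pcl_sum pcl_mult pcl_single) auto
      have T: "?T \<in> carrier (poly_ring V)" by (intro pcl_sum pcl_mult pcl_power fc b)
      have "(\<Sum>i<Suc n. f ^ i * ?b i) = ?b 0 + f * ?T"
        by (subst sum.lessThan_Suc_shift) (simp add: sum_distrib_left mult.assoc)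
      then have bT: "?b 0 + f * ?T \<in> Q" using Suc.prems by simp
      have "f * ?T \<in> Q'" using poly_ideal_mult[OF Q' f(1) T] by (simp add: mult.commute)
      moreover have "?b 0 + f * ?T \<in> Q'" using bT sub by blast
      ultimately have "?b 0 \<in> Q'" using poly_ideal_diff[OF Q', of "?b 0 + f * ?T" "f * ?T"] by simp
      then have c0: "\<forall>j<M. c 0 j = 0" using g(3) unfolding indep_mod_def by blast
      then have "?b 0 = 0" by simp
      then have "f * ?T \<in> Q" using bT by simp
      then have "?T \<in> Q" using primeideal.I_prime[OF Q fc T] f(2) by simp
      from Suc.IH[of "\<lambda>i. c (Suc i)", OF this] show ?case using c0 by (auto simp: less_Suc_eq_0_disj)
    qed simp
    \<comment> \<open>Numbers the pairs \<open>(i, j)\<close> as \<open>i * M + j\<close>. At most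
      \<open>N - 1\<close> factors \<open>f\<close> raise the exponent bound by at most
      \<open>e * N\<close>, whence the constant \<open>C + e\<close>.\<close>
    define g' where "g' k = f ^ (k div M) * g (k mod M)" for k
    have "g' k \<in> carrier (poly_ring V) \<inter> box ((C + e) * N)" if "k < N * M" for k
    proof -
      have "M > 0" using that by (cases M) auto
      then have M: "k mod M < M" "k div M < N" using that by (auto simp: less_mult_imp_div_less)
      have "(k div M) * e + C * N \<le> (C + e) * N"
        using M(2) by (simp add: algebra_simps)
      then show ?thesis
        unfolding g'_def using box_mono[OF box_power_mult[OF e g(2)[OF M(1)]]] g(1)[OF M(1)] fc by (auto intro: pcl)
    qed
    moreover have "indep_mod Q (N * M) g'"
      unfolding indep_mod_def
    proof (intro allI impI)
      fix c :: "nat \<Rightarrow> 'k" and k assume c: "(\<Sum>k<N * M. single 0 (c k) * g' k) \<in> Q" and k: "k < N * M"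
      have "(\<Sum>k<N * M. single 0 (c k) * g' k) = (\<Sum>i<N. f ^ i * (\<Sum>j<M. single 0 (c (i * M + j)) * g j))"
        unfolding sum_lessThan_mult by (intro sum.cong refl) (auto simp: g'_def sum_distrib_left mult.left_commute intro!: sum.cong)
      then have *: "\<forall>i<N. \<forall>j<M. c (i * M + j) = 0" using indep[where n = N and c = "\<lambda>i j. c (i * M + j)"] c by simp
      have "M > 0" using k by (cases M) auto
      then have "k div M < N" "k mod M < M" using k by (auto simp: less_mult_imp_div_less)
      then have "c (k div M * M + k mod M) = 0" using * by blast
      then show "c k = 0" by simp
    qed
    ultimately show ?thesis by (auto simp: M_def)
  qed
  then show ?thesis unfolding growth_def using C(1) by (intro exI[of _ "C + e"]) auto
qed

text \<open>The monomials in the remaining variables with exponents below \<open>N\<close> stay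
  independent, because the ideal contains no polynomial having a term free of
  \<open>C\<close>.\<close>

lemma growth_mon_ideal:
  assumes "finite V"
  shows "growth V (mon_ideal V (\<lambda>u. keys u \<inter> C \<noteq> {}) :: ('v, 'k::field) mpol set) (card (V - C))"
proof -
  have "\<exists>g. (\<forall>k<N ^ card (V - C). g k \<in> carrier (poly_ring V) \<inter> box (1 * N)) \<and>
      indep_mod (mon_ideal V (\<lambda>u. keys u \<inter> C \<noteq> {}) :: ('v, 'k) mpol set) (N ^ card (V - C)) g" if "N > 0" for N
  proof -
    have fin: "finite (V - C)" using assms by simp
    let ?E = "(V - C) \<rightarrow>\<^sub>E {..<N}"
    have "card ?E = N ^ card (V - C)" using fin by (simp add: card_PiE)
    moreover have "finite ?E" using fin by (intro finite_PiE) auto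
    ultimately obtain e where e: "bij_betw e {..<N ^ card (V - C)} ?E"
      using ex_bij_betw_nat_finite[of ?E] by (auto simp: lessThan_atLeast0)
    define \<mu> :: "('v \<Rightarrow> nat) \<Rightarrow> 'v mon" where "\<mu> f = (\<Sum>v\<in>V - C. single v (f v))" for f
    have \<mu>: "lookup (\<mu> f) v = (if v \<in> V - C then f v else 0)" for f v
      using fin by (simp add: \<mu>_def lookup_sum lookup_single when_def)
    have inj: "k = l" if "\<mu> (e k) = \<mu> (e l)" "k < N ^ card (V - C)" "l < N ^ card (V - C)" for k l
    proof -
      have E: "e k \<in> ?E" "e l \<in> ?E" using e that by (auto simp: bij_betw_def)
      have "e k v = e l v" if "v \<in> V - C" for v
        using \<mu>[of "e k" v] \<mu>[of "e l" v] \<open>\<mu> (e k) = \<mu> (e l)\<close> that by simp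
      then have "e k = e l" using E by (intro PiE_ext)
      then show ?thesis using e that by (auto simp: bij_betw_def dest: inj_onD)
    qed
    define g where "g k = (single (\<mu> (e k)) 1 :: ('v, 'k) mpol)" for k
    have "g k \<in> carrier (poly_ring V) \<inter> box (1 * N)" if k: "k < N ^ card (V - C)" for k
    proof -
      have "e k \<in> ?E" using e k by (auto simp: bij_betw_def)
      then show ?thesis
        using \<open>N > 0\<close> by (auto simp: g_def box_def in_poly_ring mons_def in_keys_iff \<mu> PiE_def Pi_def split: if_splits)
    qed
    moreover have "indep_mod (mon_ideal V (\<lambda>u. keys u \<inter> C \<noteq> {})) (N ^ card (V - C)) g"
      unfolding indep_mod_def
    proof (intro allI impI)
      fix c :: "nat \<Rightarrow> 'k" and k
      assume c: "(\<Sum>k<N ^ card (V - C). single 0 (c k) * g k) \<in> mon_ideal V (\<lambda>u. keys u \<inter> C \<noteq> {})"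
        and k: "k < N ^ card (V - C)"
      have "lookup (\<Sum>k<N ^ card (V - C). single 0 (c k) * g k) (\<mu> (e k)) = (\<Sum>l<N ^ card (V - C). if l = k then c k else 0)"
        unfolding lookup_sum
        by (intro sum.cong refl) (use inj k in \<open>auto simp: g_def mult_single lookup_single when_def\<close>)
      then have "lookup (\<Sum>k<N ^ card (V - C). single 0 (c k) * g k) (\<mu> (e k)) = c k" using k by simp
      moreover have "keys (\<mu> (e k)) \<inter> C = {}" by (auto simp: in_keys_iff \<mu>)
      moreover have "\<mu> (e k) \<notin> keys (\<Sum>k<N ^ card (V - C). single 0 (c k) * g k)"
        using c calculation(2) unfolding mon_ideal_def by blast
      ultimately show "c k = 0" by (simp only: in_keys_iff not_not)
    qed
    ultimately show ?thesis by blast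
  qed
  then show ?thesis unfolding growth_def by (intro exI[of _ 1]) simp
qed

text \<open>Independent polynomials inside a box are at most as many as its monomials, so
  \<open>N ^ s \<le> (C * N) ^ card V\<close> for all positive \<open>N\<close>, which fails for
  large \<open>N\<close> if \<open>s > card V\<close>.\<close>

lemma growth_le_card:
  fixes Q :: "('v, 'k::field) mpol set"
  assumes V: "finite V" and Q: "ideal Q (poly_ring V)" and gr: "growth V Q s"
  shows "s \<le> card V"
proof (rule ccontr)
  assume "\<not> s \<le> card V"
  define scale :: "'k \<Rightarrow> ('v, 'k) mpol \<Rightarrow> ('v, 'k) mpol" where "scale c p = single 0 c * p" for c p
  interpret vector_space scale
    by unfold_locales (auto simp: scale_def algebra_simps single_add mult_single simp flip: mult.assoc)
  obtain C where C: "C > 0" "\<And>N. N > 0 \<Longrightarrow> \<exists>g. (\<forall>k<N ^ s. g k \<in> carrier (poly_ring V) \<inter> box (C * N)) \<and> indep_mod Q (N ^ s) g"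
    using gr unfolding growth_def by blast
  have le: "N ^ s \<le> (C * N) ^ card V" if "N > 0" for N
  proof -
    obtain g where g: "\<And>k. k < N ^ s \<Longrightarrow> g k \<in> carrier (poly_ring V)" "\<And>k. k < N ^ s \<Longrightarrow> g k \<in> box (C * N)"
      and ind: "indep_mod Q (N ^ s) g"
      using C(2)[OF \<open>N > 0\<close>] by blast
    \<comment> \<open>A repeated polynomial would give a relation with coefficients \<open>1\<close>
      and \<open>- 1\<close>; this allows passing from families to sets.\<close>
    have inj: "inj_on g {..<N ^ s}"
    proof (rule inj_onI, rule ccontr)
      fix k l assume kl: "k \<in> {..<N ^ s}" "l \<in> {..<N ^ s}" "g k = g l" "k \<noteq> l"
      define c :: "nat \<Rightarrow> 'k" where "c i = (if i = k then 1 else 0) - (if i = l then 1 else 0)" for i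
      have "(\<Sum>i<N ^ s. single 0 (c i) * g i) = (\<Sum>i<N ^ s. (if i = k then g k else 0) - (if i = l then g l else 0))"
        by (intro sum.cong) (auto simp: c_def single_uminus)
      also have "\<dots> = 0" using kl by (simp add: sum_subtractf)
      finally have "c k = 0" using ind kl(1) poly_ideal_0[OF Q] unfolding indep_mod_def by auto
      then show False using kl(4) by (simp add: c_def)
    qed
    have "independent (g ` {..<N ^ s})"
    proof -
      have "u v = 0" if "(\<Sum>v\<in>g ` {..<N ^ s}. scale (u v) v) = 0" "v \<in> g ` {..<N ^ s}" for u v
      proof -
        have "(\<Sum>k<N ^ s. single 0 (u (g k)) * g k) = 0"
          using that(1) by (simp add: sum.reindex[OF inj] scale_def)
        then have "(\<Sum>k<N ^ s. single 0 (u (g k)) * g k) \<in> Q" using poly_ideal_0[OF Q] by simp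
        moreover have "(\<Sum>k<N ^ s. single 0 (u (g k)) * g k) \<in> Q \<longrightarrow> (\<forall>k<N ^ s. u (g k) = 0)"
          using ind unfolding indep_mod_def by (rule spec)
        ultimately show ?thesis using that(2) by auto
      qed
      then show ?thesis by (subst dependent_finite) auto
    qed
    moreover define W where "W = (\<lambda>u. single u 1 :: ('v, 'k) mpol) ` {u \<in> mons V. \<forall>v. lookup u v < C * N}"
    let ?L = "{u \<in> mons V. \<forall>v. lookup u v < C * N}"
    have L: "finite ?L \<and> card ?L \<le> (C * N) ^ card V"
    proof -
      let ?E = "V \<rightarrow>\<^sub>E {..<C * N}"
      have fin: "finite ?E" using V by (intro finite_PiE) auto
      have injr: "inj_on (\<lambda>u. restrict (lookup u) V) ?L"
      proof (rule inj_onI)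
        fix x y assume xy: "x \<in> ?L" "y \<in> ?L" "restrict (lookup x) V = restrict (lookup y) V"
        show "x = y"
        proof (rule poly_mapping_eqI)
          fix v show "lookup x v = lookup y v"
          proof (cases "v \<in> V")
            case True then show ?thesis using fun_cong[OF xy(3), of v] by simp
          next
            case False
            then have "v \<notin> keys x" "v \<notin> keys y" using xy(1,2) by (auto simp: mons_def)
            then show ?thesis by (simp add: in_keys_iff)
          qed
        qed
      qed
      have sub: "(\<lambda>u. restrict (lookup u) V) ` ?L \<subseteq> ?E" by auto
      have "card ?E = (C * N) ^ card V" using V by (simp add: card_PiE)
      then show ?thesis
        using inj_on_finite[OF injr sub fin] card_inj_on_le[OF injr sub fin] by simp
    qed
    have "g ` {..<N ^ s} \<subseteq> span W"
    proof
      fix p assume "p \<in> g ` {..<N ^ s}"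
      then have p: "p \<in> carrier (poly_ring V)" "p \<in> box (C * N)" using g by auto
      have "single u (lookup p u) \<in> span W" if "u \<in> keys p" for u
      proof -
        have "single u 1 \<in> W" using p that by (auto simp: W_def in_poly_ring box_def)
        then have "scale (lookup p u) (single u 1) \<in> span W" by (intro span_scale span_base)
        then show ?thesis by (simp add: scale_def mult_single)
      qed
      then have "(\<Sum>u\<in>keys p. single u (lookup p u)) \<in> span W" by (rule span_sum)
      then show "p \<in> span W" by (simp add: poly_eq_sum_single)
    qed
    ultimately have "card (g ` {..<N ^ s}) \<le> card W"
      using independent_span_bound[of W] L by (simp add: W_def)
    then have "N ^ s \<le> card W" using card_image[OF inj] by simp
    also have "\<dots> \<le> card ?L" unfolding W_def using L by (intro card_image_le) simp
    finally show ?thesis using L by simp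
  qed
  \<comment> \<open>Just large enough to exceed the constant \<open>C ^ card V\<close>.\<close>
  define N where "N = Suc (C ^ card V)"
  have "N ^ Suc (card V) \<le> N ^ s" using \<open>\<not> s \<le> card V\<close> by (intro power_increasing) (auto simp: N_def)
  also have "\<dots> \<le> (C * N) ^ card V" by (rule le) (simp add: N_def)
  also have "\<dots> = C ^ card V * N ^ card V" by (rule power_mult_distrib)
  also have "\<dots> < N * N ^ card V" by (intro mult_strict_right_mono) (auto simp: N_def)
  finally show False by simp
qed

text \<open>Descending along a chain of primes from \<open>P\<close> gains one in the growth
  exponent at each step, and the exponent cannot exceed \<open>card V\<close>.\<close>

lemma prime_height_le:
  fixes P :: "('v, 'k::field) mpol set"
  assumes V: "finite V" and gr: "growth V P s" and s: "s + h = card V"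
  shows "prime_height (poly_ring V) P \<le> enat h"
  unfolding prime_height_def
proof (rule Sup_least, clarify)
  fix k and Q :: "nat \<Rightarrow> ('v, 'k) mpol set"
  assume prime: "\<forall>i\<le>k. primeideal (Q i) (poly_ring V)" and chain: "\<forall>i<k. Q i \<subset> Q (Suc i)" and P: "P = Q k"
  have gr': "growth V (Q (k - j)) (s + j)" if "j \<le> k" for j
    using that
  proof (induction j)
    case 0 then show ?case using gr P by simp
  next
    case (Suc j)
    have e: "Suc (k - Suc j) = k - j" using Suc.prems by simp
    have "growth V (Q (k - Suc j)) (Suc (s + j))"
    proof (rule growth_prime_subset)
      show "primeideal (Q (k - Suc j)) (poly_ring V)" using prime by simp
      show "ideal (Q (k - j)) (poly_ring V)" using prime primeideal.axioms(1) by (metis diff_le_self)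
      show "Q (k - Suc j) \<subset> Q (k - j)" using chain e Suc.prems by (metis diff_Suc_less less_le_trans zero_less_Suc)
      show "growth V (Q (k - j)) (s + j)" using Suc by simp
    qed
    then show ?case by simp
  qed
  have "growth V (Q 0) (s + k)" using gr'[of k] by simp
  then have "s + k \<le> card V" using prime primeideal.axioms(1) by (intro growth_le_card[OF V, of "Q 0"]) auto
  then show "enat k \<le> enat h" using s by simp
qed

text \<open>The primes generated by the first \<open>i\<close> variables of \<open>C\<close> form a
  strict chain inside \<open>P\<close>.\<close>

lemma prime_height_ge:
  fixes P :: "('v, 'k::field) mpol set"
  assumes r: "monomial_order V r" and P: "primeideal P (poly_ring V)"
    and C: "C \<subseteq> V" "finite C" "Var ` C \<subseteq> P"
  shows "enat (card C) \<le> prime_height (poly_ring V) P"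
proof -
  obtain e where e: "bij_betw e {..<card C} C"
    using ex_bij_betw_nat_finite[OF C(2)] by (auto simp: lessThan_atLeast0)
  define M :: "nat \<Rightarrow> ('v, 'k) mpol set" where "M i = mon_ideal V (\<lambda>u. keys u \<inter> e ` {..<i} \<noteq> {})" for i
  have eV: "e ` {..<i} \<subseteq> C" if "i \<le> card C" for i
    using e that by (auto simp: bij_betw_def)
  have prime: "primeideal (M i) (poly_ring V)" if "i \<le> card C" for i
    unfolding M_def using eV[OF that] C(1) by (intro primeideal_mon_ideal[OF r]) blast
  have MP: "M i \<subseteq> P" if "i \<le> card C" for i
  proof -
    have "M i = Idl\<^bsub>poly_ring V\<^esub> (Var ` (e ` {..<i}))"
      unfolding M_def by (rule Idl_vars[symmetric]) (use eV[OF that] C(1) in blast)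
    also have "\<dots> \<subseteq> P"
      using eV[OF that] C(3) by (intro Idl_subset primeideal.axioms(1)[OF P]) blast
    finally show ?thesis .
  qed
  have new: "Var (e i) \<notin> M i" if "i < card C" for i
  proof -
    have "e i \<notin> e ` {..<i}" using e that by (auto simp: bij_betw_def dest!: inj_onD)
    then show ?thesis by (auto simp: M_def mon_ideal_def Var_def)
  qed
  have old: "Var (e i) \<in> M (Suc i)" if "i < card C" for i
  proof -
    have "e i \<in> V" using eV[of "Suc i"] that C(1) by auto
    then show ?thesis by (auto simp: M_def mon_ideal_def pcl) (auto simp: Var_def)
  qed
  have mono: "M i \<subseteq> M (Suc i)" for i by (auto simp: M_def mon_ideal_def lessThan_Suc)
  \<comment> \<open>The last prime is replaced by \<open>P\<close> itself, which may be larger than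
    the ideal generated by the variables of \<open>C\<close>.\<close>
  define Q where "Q i = (if i < card C then M i else P)" for i
  have "primeideal (Q i) (poly_ring V)" if "i \<le> card C" for i
    using prime[OF that] P by (simp add: Q_def)
  moreover have "Q i \<subset> Q (Suc i)" if i: "i < card C" for i
  proof -
    have "Q i \<subseteq> Q (Suc i)" using i mono MP[of i] by (auto simp: Q_def)
    moreover have "Var (e i) \<in> Q (Suc i)" using old[OF i] MP[of "Suc i"] i by (auto simp: Q_def)
    moreover have "Var (e i) \<notin> Q i" using new[OF i] i by (simp add: Q_def)
    ultimately show ?thesis by blast
  qed
  moreover have "Q (card C) = P" by (simp add: Q_def)
  ultimately show ?thesis
    unfolding prime_height_def by (intro Sup_upper) blast
qed

section \<open>Minors and substitutions\<close>

text \<open>Such sets of positions are the main diagonals of minors.\<close>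

definition increasing :: "(nat \<times> nat) set \<Rightarrow> bool" where
  "increasing T \<longleftrightarrow> (\<forall>x\<in>T. \<forall>y\<in>T. x \<noteq> y \<longrightarrow>
     fst x < fst y \<and> snd x < snd y \<or> fst y < fst x \<and> snd y < snd x)"

text \<open>In an increasing set a point has the same rank by row as by column, so the
  \<open>k\<close>-th row and the \<open>k\<close>-th column meet in a point of the set.\<close>

lemma increasing_pick:
  assumes fin: "finite T" and T: "increasing T"
  shows "card (fst ` T) = card T" "card (snd ` T) = card T"
    "(\<Sum>k<card T. single (pick (fst ` T) k, pick (snd ` T) k) 1) = sqfree_mon T"
proof -
  have i1: "inj_on fst T" and i2: "inj_on snd T"
    using T unfolding increasing_def inj_on_def by (metis less_irrefl)+
  show "card (fst ` T) = card T" "card (snd ` T) = card T" using i1 i2 by (simp_all add: card_image)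
  let ?g = "\<lambda>k. (pick (fst ` T) k, pick (snd ` T) k)"
  have "x \<in> ?g ` {..<card T}" if x: "x \<in> T" for x
  proof -
    let ?B = "{y \<in> T. fst y < fst x}"
    have "{a \<in> fst ` T. a < fst x} = fst ` ?B" by auto
    then have "card {a \<in> fst ` T. a < fst x} = card ?B"
      using inj_on_subset[OF i1, of ?B] by (simp add: card_image)
    then have 1: "pick (fst ` T) (card ?B) = fst x" using pick_card_in_set[of "fst x" "fst ` T"] x by simp
    have "snd y < snd x \<longleftrightarrow> fst y < fst x" if "y \<in> T" for y
      using T that x unfolding increasing_def by (metis less_asym less_irrefl)
    then have "{a \<in> snd ` T. a < snd x} = snd ` ?B" by auto
    then have "card {a \<in> snd ` T. a < snd x} = card ?B"
      using inj_on_subset[OF i2, of ?B] by (simp add: card_image)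
    then have 2: "pick (snd ` T) (card ?B) = snd x" using pick_card_in_set[of "snd x" "snd ` T"] x by simp
    have "?B \<subset> T" using x by auto
    then have "card ?B < card T" by (rule psubset_card_mono[OF fin])
    then show ?thesis using 1 2 by (auto intro!: image_eqI[of _ _ "card ?B"])
  qed
  then have sub: "T \<subseteq> ?g ` {..<card T}" by blast
  \<comment> \<open>Counting replaces the reverse inclusion: the image has at most
    \<open>card T\<close> elements.\<close>
  have eq: "?g ` {..<card T} = T"
    using card_seteq[OF _ sub] card_image_le[of "{..<card T}" ?g] by simp
  then have "inj_on ?g {..<card T}" by (intro eq_card_imp_inj_on) simp_all
  then show "(\<Sum>k<card T. single (?g k) 1) = sqfree_mon T"
    unfolding sqfree_mon_def using sum.reindex[of ?g "{..<card T}" "\<lambda>v. single v (1 :: nat)"] eq by simp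
qed

section \<open>Substitution of polynomials for the variables\<close>

definition msub :: "('v \<Rightarrow> 'r) \<Rightarrow> 'v mon \<Rightarrow> 'r::comm_ring_1" where
  "msub \<sigma> u = (\<Prod>v\<in>keys u. \<sigma> v ^ lookup u v)"

definition psubst :: "('v \<Rightarrow> ('w, 'k) mpol) \<Rightarrow> ('v, 'k::comm_ring_1) mpol \<Rightarrow> ('w, 'k) mpol" where
  "psubst \<sigma> p = (\<Sum>u\<in>keys p. single 0 (lookup p u) * msub \<sigma> u)"

lemma msub_superset: "finite A \<Longrightarrow> keys u \<subseteq> A \<Longrightarrow> msub \<sigma> u = (\<Prod>v\<in>A. \<sigma> v ^ lookup u v)"
  unfolding msub_def by (rule prod.mono_neutral_left) (auto simp: in_keys_iff)

lemma msub_add: "msub \<sigma> (u + v) = msub \<sigma> u * msub \<sigma> v"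
proof -
  let ?A = "keys u \<union> keys v"
  have "keys (u + v) \<subseteq> ?A" by (rule Poly_Mapping.keys_add)
  then show ?thesis
    by (simp add: msub_superset[of ?A] lookup_add power_add prod.distrib)
qed

lemma psubst_superset:
  "finite A \<Longrightarrow> keys p \<subseteq> A \<Longrightarrow> psubst \<sigma> p = (\<Sum>u\<in>A. single 0 (lookup p u) * msub \<sigma> u)"
  unfolding psubst_def by (rule sum.mono_neutral_left) (auto simp: in_keys_iff)

lemma psubst_add: "psubst \<sigma> (p + q) = psubst \<sigma> p + psubst \<sigma> q"
proof -
  let ?A = "keys p \<union> keys q"
  have "keys (p + q) \<subseteq> ?A" by (rule Poly_Mapping.keys_add)
  then show ?thesis
    by (simp add: psubst_superset[of ?A] lookup_add single_add algebra_simps sum.distrib)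
qed

lemma psubst_0: "psubst \<sigma> 0 = 0"
  by (simp add: psubst_def)

lemma psubst_sum: "psubst \<sigma> (sum f A) = (\<Sum>a\<in>A. psubst \<sigma> (f a))"
  by (induction A rule: infinite_finite_induct) (simp_all add: psubst_0 psubst_add)

lemma psubst_single: "psubst \<sigma> (single u c) = single 0 c * msub \<sigma> u"
  by (simp add: psubst_def)

lemma psubst_Var: "psubst \<sigma> (Var v) = \<sigma> v"
  by (simp add: Var_def psubst_single msub_def)

lemma single_0_mult: "single 0 (a * b) = single 0 a * (single 0 b :: ('v, 'k::comm_ring_1) mpol)"
  by (simp add: mult_single)

lemma psubst_mult: "psubst \<sigma> (p * q) = psubst \<sigma> p * psubst \<sigma> q"
proof -
  have "p * q = (\<Sum>u\<in>keys p. \<Sum>v\<in>keys q. single (u + v) (lookup p u * lookup q v))"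
    by (subst poly_eq_sum_single[of p, symmetric], subst poly_eq_sum_single[of q, symmetric])
      (simp add: sum_product mult_single)
  then have "psubst \<sigma> (p * q) = (\<Sum>u\<in>keys p. \<Sum>v\<in>keys q. psubst \<sigma> (single (u + v) (lookup p u * lookup q v)))"
    by (simp add: psubst_sum)
  also have "\<dots> = (\<Sum>u\<in>keys p. \<Sum>v\<in>keys q. (single 0 (lookup p u) * msub \<sigma> u) * (single 0 (lookup q v) * msub \<sigma> v))"
    by (simp add: psubst_single msub_add single_0_mult algebra_simps)
  also have "\<dots> = psubst \<sigma> p * psubst \<sigma> q"
    by (simp add: psubst_def sum_product)
  finally show ?thesis .
qed

lemma psubst_1: "psubst \<sigma> 1 = 1"
  using psubst_single[of \<sigma> 0 1] by (simp add: msub_def)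

lemma psubst_det:
  "psubst \<sigma> (det (mat s s f)) = det (mat s s (\<lambda>ij. psubst \<sigma> (f ij)))"
proof -
  interpret comm_ring_hom "psubst \<sigma>"
    by unfold_locales (simp_all add: psubst_add psubst_mult psubst_0 psubst_1)
  have "map_mat (psubst \<sigma>) (mat s s f) = mat s s (\<lambda>ij. psubst \<sigma> (f ij))" by auto
  then show ?thesis using hom_det[of "mat s s f"] by simp
qed

section \<open>Generic minors\<close>

lemma gen_minor_eq:
  assumes A: "A \<subseteq> {..<m}" "card A = s" and B: "B \<subseteq> {..<n}" "card B = s"
  shows "gen_minor m n A B = det (mat s s (\<lambda>(p, q). Var (pick A p, pick B q)))"
proof -
  have eA: "{i. i < m \<and> i \<in> A} = A" and eB: "{i. i < n \<and> i \<in> B} = B" using A B by auto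
  have "pick A p < m" if "p < s" for p using pick_le[of p m A] eA A that by simp
  moreover have "pick B p < n" if "p < s" for p using pick_le[of p n B] eB B that by simp
  ultimately show ?thesis
    unfolding gen_minor_def submatrix_def gen_mat_def
    by (intro arg_cong[where f = det]) (auto simp: eA eB A B)
qed

lemma homog_det:
  fixes f :: "nat \<times> nat \<Rightarrow> ('v, 'k::comm_ring_1) mpol"
  assumes "\<And>i j. i < s \<Longrightarrow> j < s \<Longrightarrow> homog 1 (f (i, j))"
  shows "homog s (det (mat s s f))"
proof -
  have "homog s (signof p * (\<Prod>i = 0..<s. mat s s f $$ (i, p i)))" if p: "p permutes {0..<s}" for p
  proof -
    have "homog (\<Sum>i = 0..<s. 1) (\<Prod>i = 0..<s. mat s s f $$ (i, p i))"
    proof (rule homog_prod)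
      fix i assume i: "i \<in> {0..<s}"
      then have "p i < s" using permutes_in_image[OF p] by simp
      then show "homog 1 (mat s s f $$ (i, p i))" using assms i by simp
    qed
    moreover have "homog 0 (signof p :: ('v, 'k) mpol)"
      using signof_pm_one[of p, where 'a = "('v, 'k) mpol"] by (auto simp: homog_def in_keys_iff lookup_one when_def split: if_splits)
    ultimately show ?thesis using homog_mult[of 0 "signof p"] by fastforce
  qed
  then show ?thesis by (subst det_def'[of _ s]) (auto intro!: homog_sum)
qed

lemma carrier_det:
  fixes f :: "nat \<times> nat \<Rightarrow> ('v, 'k::comm_ring_1) mpol"
  assumes "\<And>i j. i < s \<Longrightarrow> j < s \<Longrightarrow> f (i, j) \<in> carrier (poly_ring V)"
  shows "det (mat s s f) \<in> carrier (poly_ring V)"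
proof -
  have "signof p * (\<Prod>i = 0..<s. mat s s f $$ (i, p i)) \<in> carrier (poly_ring V)" if p: "p permutes {0..<s}" for p
  proof (rule pcl_mult)
    show "(\<Prod>i = 0..<s. mat s s f $$ (i, p i)) \<in> carrier (poly_ring V)"
    proof (rule pcl_prod)
      fix i assume i: "i \<in> {0..<s}"
      then have "p i < s" using permutes_in_image[OF p] by simp
      then show "mat s s f $$ (i, p i) \<in> carrier (poly_ring V)" using assms i by simp
    qed
    show "signof p \<in> carrier (poly_ring V :: ('v, 'k) mpol ring)"
      using signof_pm_one[of p, where 'a = "('v, 'k) mpol"] pcl_1 pcl_uminus[OF pcl_1] by auto
  qed
  then show ?thesis by (subst det_def'[of _ s]) (auto intro!: pcl_sum)
qed

context
  fixes A B :: "nat set" and m n s :: nat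
  assumes A: "A \<subseteq> {..<m}" "card A = s" and B: "B \<subseteq> {..<n}" "card B = s"
begin

lemma homog_gen_minor: "homog s (gen_minor m n A B :: (nat \<times> nat, 'k::comm_ring_1) mpol)"
  unfolding gen_minor_eq[OF A B] by (rule homog_det) (simp only: prod.case homog_Var)

lemma gen_minor_carrier:
  "(gen_minor m n A B :: (nat \<times> nat, 'k::comm_ring_1) mpol) \<in> carrier (poly_ring (gen_vars m n))"
  unfolding gen_minor_eq[OF A B]
proof (rule carrier_det)
  fix i j assume "i < s" "j < s"
  then have "pick A i \<in> A" "pick B j \<in> B" using pick_in_set_le A B by auto
  then show "(case (i, j) of (p, q) \<Rightarrow> Var (pick A p, pick B q)) \<in> carrier (poly_ring (gen_vars m n) :: (nat \<times> nat, 'k) mpol ring)"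
    using A B by (auto simp: gen_vars_def intro!: pcl)
qed

text \<open>Setting the variables on the main diagonal to one and all others to zero turns the
  submatrix into the identity.\<close>

lemma gen_minor_nonzero: "(gen_minor m n A B :: (nat \<times> nat, 'k::comm_ring_1) mpol) \<noteq> 0"
proof
  assume z: "(gen_minor m n A B :: (nat \<times> nat, 'k) mpol) = 0"
  define \<delta> :: "nat \<times> nat \<Rightarrow> (nat \<times> nat, 'k) mpol" where
    "\<delta> v = (if \<exists>k<s. v = (pick A k, pick B k) then 1 else 0)" for v
  have inj: "pick C p = pick C q \<longleftrightarrow> p = q" if "p < s" "q < s" "card C = s" for C p q
    using that pick_mono_le[of p C q] pick_mono_le[of q C p] by (metis less_irrefl nat_neq_iff)
  have "mat s s (\<lambda>ij. psubst \<delta> (case ij of (p, q) \<Rightarrow> Var (pick A p, pick B q))) = 1\<^sub>m s"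
    by (rule eq_matI) (auto simp: psubst_Var \<delta>_def inj A B)
  then have "psubst \<delta> (gen_minor m n A B) = 1"
    unfolding gen_minor_eq[OF A B] psubst_det by simp
  then show False using z by (simp add: psubst_0)
qed

end

section \<open>The generic matrix of rank s with cleared denominators\<close>

definition bord :: "nat \<Rightarrow> nat \<Rightarrow> nat \<Rightarrow> (nat \<times> nat, 'k::comm_ring_1) mpol mat" where
  "bord s i j = mat (Suc s) (Suc s) (\<lambda>(p, q). Var (if p < s then p else i, if q < s then q else j))"

definition crn :: "nat \<Rightarrow> (nat \<times> nat, 'k::comm_ring_1) mpol" where
  "crn s = det (mat s s Var)"

text \<open>Up to the factor \<open>crn s\<close>, the substitution \<open>brk s\<close> keeps the first \<open>s\<close> rows and columns and
  completes them to the generic matrix of rank \<open>s\<close>.\<close>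

definition brk :: "nat \<Rightarrow> nat \<times> nat \<Rightarrow> (nat \<times> nat, 'k::comm_ring_1) mpol" where
  "brk s v = crn s * Var v - det (bord s (fst v) (snd v))"

text \<open>Expand the bordered determinant along its last row: the term of the entry
  \<open>(i, j)\<close> cancels \<open>crn s * Var (i, j)\<close>, and the other cofactors do not
  see the row \<open>i\<close>. So the matrix factors through rank \<open>s\<close>.\<close>

lemma brk_factor:
  "brk s (i, j) = (\<Sum>q<s. Var (i, q) * (- cofactor (bord s 0 j) s q :: (nat \<times> nat, 'k::comm_ring_1) mpol))"
proof -
  have carrier: "bord s i j \<in> carrier_mat (Suc s) (Suc s)" for i j by (simp add: bord_def)
  have cof: "cofactor (bord s i j) s q = (cofactor (bord s 0 j) s q :: (nat \<times> nat, 'k) mpol)" for q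
  proof -
    have "mat_delete (bord s i j) s q = (mat_delete (bord s 0 j) s q :: (nat \<times> nat, 'k) mpol mat)"
      by (rule eq_matI) (auto simp: mat_delete_def bord_def)
    then show ?thesis by (simp add: cofactor_def)
  qed
  have "mat_delete (bord s 0 j) s s = (mat s s Var :: (nat \<times> nat, 'k) mpol mat)"
    by (rule eq_matI) (auto simp: mat_delete_def bord_def)
  then have crn: "cofactor (bord s 0 j) s s = (crn s :: (nat \<times> nat, 'k) mpol)"
    by (simp add: cofactor_def crn_def)
  have "det (bord s i j) = (\<Sum>q<Suc s. bord s i j $$ (s, q) * cofactor (bord s i j) s q :: (nat \<times> nat, 'k) mpol)"
    by (rule laplace_expansion_row[OF carrier]) simp
  also have "\<dots> = (\<Sum>q<s. Var (i, q) * cofactor (bord s 0 j) s q) + Var (i, j) * crn s"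
    by (simp add: cof crn) (simp add: bord_def)
  finally show ?thesis by (simp add: brk_def sum_negf mult.commute)
qed

text \<open>Inside the first \<open>s\<close> rows or columns the bordered matrix repeats a row or
  column, so its determinant vanishes.\<close>

lemma brk_border: "i < s \<or> j < s \<Longrightarrow> brk s (i, j) = crn s * Var (i, j)"
proof -
  assume "i < s \<or> j < s"
  then have "det (bord s i j) = 0"
  proof
    assume "i < s"
    then show ?thesis
      by (intro det_identical_rows[of _ "Suc s" i s]) (auto simp: bord_def Matrix.row_def)
  next
    assume "j < s"
    then show ?thesis
      by (intro det_identical_columns[of _ "Suc s" j s]) (auto simp: bord_def Matrix.col_def)
  qed
  then show ?thesis by (simp add: brk_def)
qed

text \<open>The factors of sizes \<open>Suc s\<close> by \<open>s\<close> and \<open>s\<close> by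
  \<open>Suc s\<close> are padded by zeros to square matrices, so that multiplicativity of the
  determinant applies.\<close>

lemma det_brk: "det (mat (Suc s) (Suc s) (\<lambda>(p, q). brk s (a p, b q))) = (0 :: (nat \<times> nat, 'k::comm_ring_1) mpol)"
proof -
  let ?P = "mat (Suc s) (Suc s) (\<lambda>(p, k). if k < s then Var (a p, k) else 0) :: (nat \<times> nat, 'k) mpol mat"
  let ?Q = "mat (Suc s) (Suc s) (\<lambda>(k, q). if k < s then - cofactor (bord s 0 (b q)) s k else 0) :: (nat \<times> nat, 'k) mpol mat"
  have "mat (Suc s) (Suc s) (\<lambda>(p, q). brk s (a p, b q)) = ?P * ?Q"
    by (rule eq_matI) (auto simp: brk_factor scalar_prod_def lessThan_atLeast0)
  moreover have "det ?Q = (\<Sum>j<Suc s. ?Q $$ (s, j) * cofactor ?Q s j)"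
    by (rule laplace_expansion_row) auto
  then have "det ?Q = 0" by simp
  ultimately show ?thesis using det_mult[of ?P "Suc s" ?Q] by simp
qed

lemma psubst_brk_det_ideal:
  fixes f :: "(nat \<times> nat, 'k::comm_ring_1) mpol"
  assumes f: "f \<in> det_ideal m n (Suc s)"
  shows "psubst (brk s) f = 0"
proof -
  let ?Z = "{p \<in> carrier (poly_ring (gen_vars m n)). psubst (brk s) p = (0 :: (nat \<times> nat, 'k) mpol)}"
  have "det_ideal m n (Suc s) \<subseteq> ?Z"
    unfolding det_ideal_def
  proof (rule Idl_subset)
    show "ideal ?Z (poly_ring (gen_vars m n))"
      by (rule poly_idealI) (auto simp: pcl psubst_0 psubst_add psubst_mult)
    have "psubst (brk s) (gen_minor m n A B) = 0"
      if "A \<subseteq> {..<m}" "card A = Suc s" "B \<subseteq> {..<n}" "card B = Suc s" for A B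
    proof -
      have "psubst (brk s) (gen_minor m n A B) = det (mat (Suc s) (Suc s) (\<lambda>(p, q). brk s (pick A p, pick B q)))"
        unfolding gen_minor_eq[OF that] psubst_det
        by (intro arg_cong[where f = det] eq_matI) (auto simp: psubst_Var)
      then show ?thesis by (simp add: det_brk)
    qed
    then show "{gen_minor m n A B |A B. A \<subseteq> {..<m} \<and> B \<subseteq> {..<n} \<and> card A = Suc s \<and> card B = Suc s} \<subseteq> ?Z"
      using gen_minor_carrier by blast
  qed
  then show ?thesis using f by blast
qed

section \<open>Bounds for the monomials of powers and products\<close>

definition mon_pow :: "nat \<Rightarrow> 'v mon \<Rightarrow> 'v mon" where
  "mon_pow k d = (\<Sum>i<k. d)"

lemma lookup_mon_pow: "lookup (mon_pow k d) v = k * lookup d v"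
  by (simp add: mon_pow_def lookup_sum)

lemma mon_deg_mon_pow: "mon_deg (mon_pow k d) = k * mon_deg d"
  by (simp add: mon_pow_def mon_deg_sum)

lemma mon_pow_Suc: "mon_pow (Suc k) d = d + mon_pow k d"
  by (simp add: mon_pow_def add.commute)

lemma mon_pow_mons: "d \<in> mons V \<Longrightarrow> mon_pow k d \<in> mons V"
  by (simp add: mon_pow_def mons_sum)

lemma keys_below_1: "monomial_order V r \<Longrightarrow> keys_below r 0 (1 :: ('v, 'k::comm_ring_1) mpol)"
  using monomial_order_refl[of V r 0] by (simp add: keys_below_def)

lemma keys_below_power:
  fixes p :: "('v, 'k::comm_ring_1) mpol"
  assumes r: "monomial_order V r" and p: "keys_below r d p"
  shows "keys_below r (mon_pow k d) (p ^ k)" "lookup (p ^ k) (mon_pow k d) = lookup p d ^ k"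
proof (induction k)
  case 0
  show "keys_below r (mon_pow 0 d) (p ^ 0)" "lookup (p ^ 0) (mon_pow 0 d) = lookup p d ^ 0"
    using keys_below_1[OF r] by (simp_all add: mon_pow_def)
next
  case (Suc k)
  show "keys_below r (mon_pow (Suc k) d) (p ^ Suc k)"
    using keys_below_mult[OF r p Suc(1)] by (simp add: mon_pow_Suc)
  show "lookup (p ^ Suc k) (mon_pow (Suc k) d) = lookup p d ^ Suc k"
    using lookup_mult_top[OF r p Suc(1)] Suc(2) by (simp add: mon_pow_Suc)
qed

lemma keys_below_prod:
  fixes f :: "'a \<Rightarrow> ('v, 'k::comm_ring_1) mpol"
  assumes r: "monomial_order V r" and "\<And>a. a \<in> A \<Longrightarrow> keys_below r (d a) (f a)"
  shows "keys_below r (sum d A) (prod f A)"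
  using assms(2)
  by (induction A rule: infinite_finite_induct) (auto simp: keys_below_1[OF r] intro: keys_below_mult[OF r])

section \<open>The initial ideal of a determinantal ideal\<close>

lemma prod_Var_power: "(\<Prod>v\<in>keys u. Var v ^ lookup u v) = (single u 1 :: ('v, 'k::comm_ring_1) mpol)"
proof -
  have "Var v ^ k = (single (single v k) 1 :: ('v, 'k) mpol)" for v k
    by (induction k) (auto simp: Var_def mult_single simp flip: single_add)
  moreover have "(\<Prod>v\<in>A. single (f v) 1) = (single (sum f A) 1 :: ('v, 'k) mpol)" for f :: "'v \<Rightarrow> 'v mon" and A
    by (induction A rule: infinite_finite_induct) (auto simp: mult_single)
  ultimately show ?thesis by (simp add: poly_eq_sum_single)
qed

lemma keys_below_diff:
  fixes p q :: "('v, 'k::comm_ring_1) mpol"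
  shows "keys_below r w p \<Longrightarrow> keys_below r w q \<Longrightarrow> keys_below r w (p - q)"
  by (auto simp: keys_below_def elim!: in_keys_minusE)

lemma pick_lessThan: "p < s \<Longrightarrow> pick {..<s} p = p"
proof -
  assume "p < s"
  then have "{a \<in> {..<s}. a < p} = {..<p}" by auto
  then show ?thesis using pick_card_in_set[of p "{..<s}"] \<open>p < s\<close> by simp
qed

lemma pick_insert_lessThan:
  assumes "s \<le> i" "p < Suc s"
  shows "pick (insert i {..<s}) p = (if p < s then p else i)"
proof -
  have "{a \<in> insert i {..<s}. a < (if p < s then p else i)} = {..<p}" using assms by auto
  then show ?thesis
    using pick_card_in_set[of "if p < s then p else i" "insert i {..<s}"] assms(2) by (simp split: if_splits)
qed

lemma gen_minor_in_det_ideal: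
  assumes "A \<subseteq> {..<m}" "card A = t" "B \<subseteq> {..<n}" "card B = t"
  shows "gen_minor m n A B \<in> (det_ideal m n t :: (nat \<times> nat, 'k::comm_ring_1) mpol set)"
proof -
  let ?S = "{gen_minor m n A B | A B. A \<subseteq> {..<m} \<and> B \<subseteq> {..<n} \<and> card A = t \<and> card B = t} :: (nat \<times> nat, 'k) mpol set"
  have "?S \<subseteq> carrier (poly_ring (gen_vars m n))" using gen_minor_carrier by blast
  from Idl_superset[OF this] show ?thesis unfolding det_ideal_def using assms by blast
qed

text \<open>Besides the degree bound, this supplies that elements of \<open>det_ideal\<close> lie in
  the polynomial ring.\<close>

lemma det_ideal_degree:
  "(det_ideal m n t :: (nat \<times> nat, 'k::comm_ring_1) mpol set) \<subseteq> mon_ideal (gen_vars m n) (\<lambda>u. t \<le> mon_deg u)"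
  unfolding det_ideal_def
proof (rule Idl_subset)
  show "ideal (mon_ideal (gen_vars m n) (\<lambda>u. t \<le> mon_deg u) :: (nat \<times> nat, 'k) mpol set) (poly_ring (gen_vars m n))"
    by (rule ideal_mon_ideal) (simp add: mon_deg_add)
  show "{gen_minor m n A B |A B. A \<subseteq> {..<m} \<and> B \<subseteq> {..<n} \<and> card A = t \<and> card B = t}
      \<subseteq> (mon_ideal (gen_vars m n) (\<lambda>u. t \<le> mon_deg u) :: (nat \<times> nat, 'k) mpol set)"
  proof clarify
    fix A B assume "A \<subseteq> {..<m}" "B \<subseteq> {..<n}" "t = card A" "card B = card A"
    then show "(gen_minor m n A B :: (nat \<times> nat, 'k) mpol) \<in> mon_ideal (gen_vars m n) (\<lambda>u. card A \<le> mon_deg u)"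
      using homog_gen_minor[of A m "card A" B n, where 'k = 'k] gen_minor_carrier[of A m "card A" B n, where 'k = 'k]
      by (auto simp: mon_ideal_def homog_def)
  qed
qed

lemma diagonal_order_initial:
  assumes r: "diagonal_order TYPE('k::comm_ring_1) m n r" and T: "T \<subseteq> gen_vars m n" "increasing T"
  shows "initial_mon r (gen_minor m n (fst ` T) (snd ` T) :: (nat \<times> nat, 'k) mpol) = sqfree_mon T"
proof -
  have fin: "finite T" using T(1) by (rule finite_subset) (simp add: gen_vars_def)
  have sub: "fst ` T \<subseteq> {..<m}" "snd ` T \<subseteq> {..<n}" using T(1) by (auto simp: gen_vars_def)
  have card: "card (fst ` T) = card (snd ` T)" using increasing_pick(1,2)[OF fin T(2)] by simp
  note pick = r[unfolded diagonal_order_def, THEN conjunct2, rule_format, OF sub card]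
  show ?thesis unfolding pick increasing_pick(1)[OF fin T(2)] by (rule increasing_pick(3)[OF fin T(2)])
qed

lemma minor_keys_below:
  assumes r: "diagonal_order TYPE('k::comm_ring_1) m n r" and T: "T \<subseteq> gen_vars m n" "increasing T"
  defines "p \<equiv> gen_minor m n (fst ` T) (snd ` T) :: (nat \<times> nat, 'k) mpol"
  shows "keys_below r (sqfree_mon T) p" "lookup p (sqfree_mon T) \<noteq> 0"
proof -
  have fin: "finite T" using T(1) by (rule finite_subset) (simp add: gen_vars_def)
  have m: "fst ` T \<subseteq> {..<m}" "card (fst ` T) = card T" "snd ` T \<subseteq> {..<n}" "card (snd ` T) = card T"
    using T(1) increasing_pick[OF fin T(2)] by (auto simp: gen_vars_def)
  have mo: "monomial_order (gen_vars m n) r" using r by (simp add: diagonal_order_def)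
  have "p \<in> carrier (poly_ring (gen_vars m n))" "p \<noteq> 0"
    unfolding p_def by (rule gen_minor_carrier[OF m] gen_minor_nonzero[OF m])+
  from initial_mon_props[OF mo this] diagonal_order_initial[OF r T, folded p_def]
  show "keys_below r (sqfree_mon T) p" "lookup p (sqfree_mon T) \<noteq> 0"
    by (auto simp: keys_below_def in_keys_iff)
qed

text \<open>Clearing the denominator multiplies the bound for \<open>Var v\<close> by the corner
  diagonal and no more: for \<open>v\<close> outside the first \<open>s\<close> rows and columns the
  diagonal of the bordered minor is that of the corner extended by \<open>v\<close>, and otherwise
  the bordered determinant is zero.\<close>

lemma brk_keys_below:
  assumes r: "diagonal_order TYPE('k::comm_ring_1) m n r" and s: "s \<le> m" "s \<le> n"
  defines "d \<equiv> sqfree_mon ((\<lambda>k. (k, k)) ` {..<s})"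
  shows "keys_below r d (crn s :: (nat \<times> nat, 'k) mpol)" "lookup (crn s :: (nat \<times> nat, 'k) mpol) d \<noteq> 0"
    "v \<in> gen_vars m n \<Longrightarrow> keys_below r (single v 1 + d) (brk s v :: (nat \<times> nat, 'k) mpol)"
    "homog s (crn s :: (nat \<times> nat, 'k) mpol)" "homog (Suc s) (brk s v :: (nat \<times> nat, 'k) mpol)"
proof -
  let ?T = "(\<lambda>k. (k, k)) ` {..<s}"
  have mo: "monomial_order (gen_vars m n) r" using r by (simp add: diagonal_order_def)
  have T: "?T \<subseteq> gen_vars m n" "increasing ?T" "fst ` ?T = {..<s}" "snd ` ?T = {..<s}"
    using s by (auto simp: gen_vars_def increasing_def image_image)
  have crn: "crn s = (gen_minor m n {..<s} {..<s} :: (nat \<times> nat, 'k) mpol)"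
    unfolding crn_def by (subst gen_minor_eq[of _ _ s]) (use s in \<open>auto simp: pick_lessThan intro!: arg_cong[where f = det]\<close>)
  show kc: "keys_below r d (crn s :: (nat \<times> nat, 'k) mpol)" and "lookup (crn s :: (nat \<times> nat, 'k) mpol) d \<noteq> 0"
    using minor_keys_below[OF r T(1,2)] unfolding T(3,4) crn d_def by blast+
  show hc: "homog s (crn s :: (nat \<times> nat, 'k) mpol)"
    unfolding crn_def by (rule homog_det) (rule homog_Var)
  have "homog (Suc s) (det (bord s i j) :: (nat \<times> nat, 'k) mpol)" for i j
    unfolding bord_def by (rule homog_det) (simp only: prod.case homog_Var)
  then show "homog (Suc s) (brk s v :: (nat \<times> nat, 'k) mpol)"
    using homog_mult[OF hc homog_Var[of v]] by (simp add: brk_def homog_diff)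
  assume v: "v \<in> gen_vars m n"
  have kV: "keys_below r (single v 1) (Var v :: (nat \<times> nat, 'k) mpol)"
    using v monomial_order_refl[OF mo, of "single v 1"] by (simp add: keys_below_def Var_def)
  have cV: "keys_below r (single v 1 + d) (crn s * Var v :: (nat \<times> nat, 'k) mpol)"
    using keys_below_mult[OF mo kc kV] by (simp add: add.commute)
  obtain i j where ij: "v = (i, j)" "i < m" "j < n" using v by (auto simp: gen_vars_def)
  show "keys_below r (single v 1 + d) (brk s v :: (nat \<times> nat, 'k) mpol)"
  proof (cases "i < s \<or> j < s")
    case True
    then show ?thesis using cV by (simp add: ij(1) brk_border)
  next
    case False
    let ?T' = "insert (i, j) ?T"
    have T': "?T' \<subseteq> gen_vars m n" "increasing ?T'" "fst ` ?T' = insert i {..<s}" "snd ` ?T' = insert j {..<s}"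
      using T s ij False by (auto simp: gen_vars_def increasing_def image_image)
    have "det (bord s i j) = (gen_minor m n (insert i {..<s}) (insert j {..<s}) :: (nat \<times> nat, 'k) mpol)"
      unfolding bord_def
      by (subst gen_minor_eq[of _ _ "Suc s"])
        (use s ij False in \<open>auto simp: pick_insert_lessThan intro!: arg_cong[where f = det]\<close>)
    then have "keys_below r (sqfree_mon ?T') (det (bord s i j) :: (nat \<times> nat, 'k) mpol)"
      using minor_keys_below(1)[OF r T'(1,2)] unfolding T'(3,4) by simp
    moreover have "sqfree_mon ?T' = single v 1 + d"
    proof -
      have "(i, j) \<notin> ?T" using False by auto
      then show ?thesis by (simp add: d_def sqfree_mon_def ij(1))
    qed
    ultimately show ?thesis using keys_below_diff[OF cV] by (simp add: brk_def ij(1))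
  qed
qed

text \<open>If the initial monomial \<open>u\<close> of \<open>f \<in> I\<^sub>t\<close> involved only the first \<open>t - 1\<close> rows and columns,
  then \<open>u\<close> times a power of the initial monomial of the corner minor would survive in the image
  of \<open>f\<close> under the substitution by a matrix of rank \<open>t - 1\<close>, which is zero.\<close>

lemma initial_mon_det_ideal:
  fixes f :: "(nat \<times> nat, 'k::field) mpol"
  assumes r: "diagonal_order TYPE('k) m n r" and s: "s \<le> m" "s \<le> n"
    and f: "f \<in> det_ideal m n (Suc s)" "f \<noteq> 0"
  shows "\<exists>v\<in>keys (initial_mon r f). s \<le> fst v \<and> s \<le> snd v"
proof (rule ccontr)
  assume "\<not> (\<exists>v\<in>keys (initial_mon r f). s \<le> fst v \<and> s \<le> snd v)"
  then have border: "fst v < s \<or> snd v < s" if "v \<in> keys (initial_mon r f)" for v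
    using that by (meson not_le)
  let ?V = "gen_vars m n"
  define \<sigma> :: "nat \<times> nat \<Rightarrow> (nat \<times> nat, 'k) mpol" where "\<sigma> = brk s"
  define c :: "(nat \<times> nat, 'k) mpol" where "c = crn s"
  define d where "d = sqfree_mon ((\<lambda>k. (k, k)) ` {..<s})"
  note bk = brk_keys_below[OF r s, folded \<sigma>_def c_def d_def]
  have mo: "monomial_order ?V r" using r by (simp add: diagonal_order_def)
  have fc: "f \<in> carrier (poly_ring ?V)" using f(1) det_ideal_degree[of m n "Suc s"] by (auto simp: mon_ideal_def)
  define u where "u = initial_mon r f"
  have u: "u \<in> keys f" and umax: "\<And>w. w \<in> keys f \<Longrightarrow> (w, u) \<in> r"
    using initial_mon_props[OF mo fc f(2)] by (auto simp: u_def)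
  have mons: "w \<in> mons ?V" if "w \<in> keys f" for w using fc that by (auto simp: in_poly_ring)
  have dm: "d \<in> mons ?V" using s by (auto simp: d_def mons_def keys_sqfree_mon gen_vars_def)
  have deg_d: "mon_deg d = s" by (simp add: d_def mon_deg_sqfree_mon card_image inj_on_def)
  \<comment> \<open>Each variable of \<open>x^w\<close>, counted with multiplicity, contributes one
    factor \<open>d\<close>, hence \<open>mon_deg w\<close> of them.\<close>
  have below: "keys_below r (w + mon_pow (mon_deg w) d) (msub \<sigma> w)" if "w \<in> keys f" for w
  proof -
    have "v \<in> ?V" if "v \<in> keys w" for v using mons[OF \<open>w \<in> keys f\<close>] that by (auto simp: mons_def)
    then have "keys_below r (\<Sum>v\<in>keys w. mon_pow (lookup w v) (single v 1 + d)) (msub \<sigma> w)"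
      unfolding msub_def by (intro keys_below_prod[OF mo] keys_below_power(1)[OF mo] bk(3))
    moreover have "(\<Sum>v\<in>keys w. mon_pow (lookup w v) (single v 1 + d)) = w + mon_pow (mon_deg w) d"
    proof (rule poly_mapping_eqI)
      fix x
      have "(\<Sum>v\<in>keys w. lookup w v * lookup (single v 1) x) = (\<Sum>v\<in>keys w. if v = x then lookup w x else 0)"
        by (rule sum.cong) (auto simp: lookup_single when_def)
      then have "(\<Sum>v\<in>keys w. lookup w v * lookup (single v 1) x) = lookup w x"
        by (simp add: in_keys_iff)
      then show "lookup (\<Sum>v\<in>keys w. mon_pow (lookup w v) (single v 1 + d)) x = lookup (w + mon_pow (mon_deg w) d) x"
        by (simp add: lookup_sum lookup_mon_pow lookup_add distrib_left sum.distrib mon_deg_def sum_distrib_right del: One_nat_def)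
    qed
    ultimately show ?thesis by simp
  qed
  have hom: "homog (mon_deg w * Suc s) (msub \<sigma> w)" for w
  proof -
    have "homog (\<Sum>v\<in>keys w. lookup w v * Suc s) (msub \<sigma> w)"
      unfolding msub_def by (intro homog_prod homog_power bk(5))
    then show ?thesis by (simp only: mon_deg_def sum_distrib_right)
  qed
  \<comment> \<open>The bound for the image of \<open>x^u\<close>. It is attained: on the first
    \<open>s\<close> rows and columns the substitution only multiplies by the corner minor, so the
    image is \<open>c ^ mon_deg u * x^u\<close>.\<close>
  define w0 where "w0 = u + mon_pow (mon_deg u) d"
  have "lookup (msub \<sigma> u) w0 = lookup c d ^ mon_deg u"
  proof -
    have "\<sigma> v = c * Var v" if "v \<in> keys u" for v
      using border[of v] that brk_border[of "fst v" s "snd v"] by (simp add: u_def \<sigma>_def c_def)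
    then have "msub \<sigma> u = (\<Prod>v\<in>keys u. c ^ lookup u v * Var v ^ lookup u v)"
      unfolding msub_def by (intro prod.cong) (auto simp: power_mult_distrib)
    also have "\<dots> = c ^ mon_deg u * single u 1"
      by (simp add: prod.distrib prod_Var_power mon_deg_def power_sum)
    finally have eq: "msub \<sigma> u = c ^ mon_deg u * single u 1" .
    have "keys_below r u (single u (1 :: 'k))"
      using monomial_order_refl[OF mo mons[OF u]] by (simp add: keys_below_def)
    from lookup_mult_top[OF mo keys_below_power(1)[OF mo bk(1)] this]
    show ?thesis unfolding eq w0_def by (simp add: keys_below_power(2)[OF mo bk(1)] add.commute)
  qed
  then have nz: "lookup (msub \<sigma> u) w0 \<noteq> 0" using bk(2) by simp
  have zero: "lookup (msub \<sigma> w) w0 = 0" if w: "w \<in> keys f" "w \<noteq> u" for w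
  proof (rule ccontr)
    assume "lookup (msub \<sigma> w) w0 \<noteq> 0"
    then have k: "w0 \<in> keys (msub \<sigma> w)" by (simp add: in_keys_iff)
    then have "mon_deg w0 = mon_deg w * Suc s" using hom[of w] unfolding homog_def by blast
    moreover have "mon_deg w0 = mon_deg u * Suc s"
      by (simp add: w0_def mon_deg_add mon_deg_mon_pow deg_d)
    \<comment> \<open>Equal degree means that the bounds for \<open>w\<close> and for
      \<open>u\<close> carry the same multiple of \<open>d\<close>, so they compare as
      \<open>w\<close> and \<open>u\<close> do.\<close>
    ultimately have deg: "mon_deg w = mon_deg u" by (metis mult_cancel2 nat.distinct(1))
    have "(w0, w + mon_pow (mon_deg u) d) \<in> r" using k below[OF w(1)] by (simp add: keys_below_def deg)
    moreover have "(w + mon_pow (mon_deg u) d, w0) \<in> r"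
      unfolding w0_def by (intro monomial_order_add[OF mo umax[OF w(1)]] mon_pow_mons dm)
    ultimately have "w0 = w + mon_pow (mon_deg u) d" by (rule monomial_order_antisym[OF mo])
    then show False using w(2) by (simp add: w0_def)
  qed
  have "0 = lookup (psubst \<sigma> f) w0"
    using psubst_brk_det_ideal[OF f(1)] by (simp add: \<sigma>_def)
  also have "\<dots> = (\<Sum>w\<in>keys f. if w = u then lookup f u * lookup (msub \<sigma> u) w0 else 0)"
    unfolding psubst_def lookup_sum lookup_const_mult by (rule sum.cong) (auto simp: zero)
  also have "\<dots> = lookup f u * lookup (msub \<sigma> u) w0" using u by simp
  finally show False using nz u by (simp add: in_keys_iff)
qed

text \<open>A set avoiding the \<open>t\<close>-diagonals meets each line parallel to the main diagonal in at most
  \<open>s = t - 1\<close> points; pushing these points to the start of the line moves the set injectively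
  into the union of the first \<open>s\<close> rows and columns.\<close>

lemma card_diagonal_cover:
  assumes C: "C \<subseteq> gen_vars m n" and s: "s \<le> m" "s \<le> n"
    and cover: "\<And>T. T \<subseteq> gen_vars m n \<Longrightarrow> increasing T \<Longrightarrow> card T = Suc s \<Longrightarrow> T \<inter> C \<noteq> {}"
  shows "(m - s) * (n - s) \<le> card C"
proof -
  let ?V = "gen_vars m n"
  have finV: "finite ?V" by (simp add: gen_vars_def)
  define U where "U = ?V - C"
  \<comment> \<open>The points of \<open>U\<close> before \<open>x\<close> on its line; equality of
    differences is written with sums to avoid truncated subtraction.\<close>
  define L where "L x = {y \<in> U. fst y < fst x \<and> fst y + snd x = snd y + fst x}" for x :: "nat \<times> nat"
  define \<rho> where "\<rho> x = card (L x)" for x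
  have finL: "finite (L x)" for x
    by (rule finite_subset[OF _ finV]) (auto simp: L_def U_def)
  have \<rho>_s: "\<rho> x < s" if x: "x \<in> U" for x
  proof (rule ccontr)
    assume "\<not> \<rho> x < s"
    have "x \<notin> L x" by (simp add: L_def)
    then have "Suc s \<le> card (insert x (L x))"
      using \<open>\<not> \<rho> x < s\<close> finL[of x] by (simp add: \<rho>_def)
    then obtain T where T: "T \<subseteq> insert x (L x)" "card T = Suc s"
      by (meson obtain_subset_with_card_n)
    have "T \<subseteq> U" using T(1) x by (auto simp: L_def)
    moreover have "increasing T"
      unfolding increasing_def
    proof (intro ballI impI)
      fix y z assume "y \<in> T" "z \<in> T" "y \<noteq> z"
      then have "fst y + snd x = snd y + fst x" "fst z + snd x = snd z + fst x" "y \<noteq> z"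
        using T(1) by (auto simp: L_def)
      then show "fst y < fst z \<and> snd y < snd z \<or> fst z < fst y \<and> snd z < snd y"
        by (cases y; cases z) auto
    qed
    ultimately show False using cover[of T] T(2) by (auto simp: U_def)
  qed
  have \<rho>_min: "\<rho> x \<le> min (fst x) (snd x)" for x
  proof -
    have "inj_on fst (L x)" by (auto simp: inj_on_def L_def)
    moreover have "fst ` L x \<subseteq> {fst x - min (fst x) (snd x)..<fst x}" by (auto simp: L_def)
    ultimately have "card (L x) \<le> card {fst x - min (fst x) (snd x)..<fst x}"
      by (intro card_inj_on_le) auto
    then show ?thesis by (simp add: \<rho>_def)
  qed
  \<comment> \<open>Subtracting the minimum of the coordinates leads to the first grid point of the
    line through \<open>x\<close>.\<close>
  define g where "g x = (fst x - min (fst x) (snd x) + \<rho> x, snd x - min (fst x) (snd x) + \<rho> x)" for x :: "nat \<times> nat"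
  have "inj_on g U"
  proof (rule inj_onI)
    have less: False if xy: "x \<in> U" "y \<in> U" "g x = g y" "fst x < fst y" for x y
    proof -
      have e: "fst x - min (fst x) (snd x) + \<rho> x = fst y - min (fst y) (snd y) + \<rho> y"
        "snd x - min (fst x) (snd x) + \<rho> x = snd y - min (fst y) (snd y) + \<rho> y"
        using xy(3) by (simp_all add: g_def)
      \<comment> \<open>One coordinate of each line start is zero, so the smaller coordinate of
        \<open>g x\<close> is the rank and their difference is the line.\<close>
      have \<rho>: "\<rho> x = \<rho> y" and line: "fst x + snd y = snd x + fst y"
        using e by (auto simp: min_def split: if_splits)
      have "insert x (L x) \<subseteq> L y" using xy(1,4) line by (auto simp: L_def)
      moreover have "x \<notin> L x" by (simp add: L_def)
      ultimately have "Suc (\<rho> x) \<le> \<rho> y"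
        unfolding \<rho>_def using card_mono[OF finL, of "insert x (L x)" y] finL[of x] by simp
      then show False using \<rho> by simp
    qed
    fix x y assume xy: "x \<in> U" "y \<in> U" "g x = g y"
    then have "fst x = fst y" using less[of x y] less[of y x] by (metis nat_neq_iff)
    moreover have "snd x = snd y"
      using xy(3) \<open>fst x = fst y\<close> by (auto simp: g_def min_def split: if_splits)
    ultimately show "x = y" by (rule prod_eqI)
  qed
  \<comment> \<open>The zero coordinate of the line start becomes the rank, which is below
    \<open>s\<close>; \<open>\<rho>_min\<close> keeps the image inside the grid.\<close>
  moreover have "g ` U \<subseteq> ?V - {s..<m} \<times> {s..<n}"
  proof (rule image_subsetI)
    fix x assume x: "x \<in> U"
    then have "fst x < m" "snd x < n" by (auto simp: U_def gen_vars_def)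
    then show "g x \<in> ?V - {s..<m} \<times> {s..<n}"
      using \<rho>_s[OF x] \<rho>_min[of x] by (auto simp: g_def gen_vars_def min_def split: if_splits)
  qed
  ultimately have "card U \<le> card (?V - {s..<m} \<times> {s..<n})"
    using finV by (intro card_inj_on_le) auto
  moreover have "card U + card C = card ?V"
    using C finV card_mono[OF finV C] by (simp add: U_def card_Diff_subset finite_subset)
  moreover have "{s..<m} \<times> {s..<n} \<subseteq> ?V" by (auto simp: gen_vars_def)
  then have "card (?V - {s..<m} \<times> {s..<n}) + (m - s) * (n - s) = card ?V"
    using finV card_mono[OF finV, of "{s..<m} \<times> {s..<n}"] by (simp add: card_Diff_subset)
  ultimately show ?thesis by simp
qed

lemma prime_contains_variable:
  fixes P :: "('v, 'k::field) mpol set"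
  assumes P: "primeideal P (poly_ring V)" and T: "finite T" "T \<subseteq> V" "single (sqfree_mon T) 1 \<in> P"
  shows "\<exists>v\<in>T. Var v \<in> P"
  using T
proof (induction T rule: finite_induct)
  case empty
  then have "1 \<in> P" by (simp add: sqfree_mon_def)
  then have "P = carrier (poly_ring V)"
    using ideal.one_imp_carrier[OF primeideal.axioms(1)[OF P]] by simp
  then show ?case using primeideal.I_notcarr[OF P] by simp
next
  case (insert v T)
  have "Var v * single (sqfree_mon T) 1 = (single (sqfree_mon (insert v T)) 1 :: ('v, 'k) mpol)"
    using insert.hyps by (simp add: sqfree_mon_def Var_def mult_single)
  moreover have "Var v \<in> carrier (poly_ring V :: ('v, 'k) mpol ring)"
    "single (sqfree_mon T) 1 \<in> carrier (poly_ring V :: ('v, 'k) mpol ring)"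
    using insert.prems(1) insert.hyps(1) by (auto simp: mons_def keys_sqfree_mon intro!: pcl)
  ultimately have "Var v \<in> P \<or> single (sqfree_mon T) 1 \<in> P"
    using primeideal.I_prime[OF P, of "Var v" "single (sqfree_mon T) 1"] insert.prems(2) by simp
  then show ?case using insert.IH insert.prems(1) by auto
qed

section \<open>Height and Betti number of the initial ideal\<close>

context
  fixes m n s :: nat and r :: "(nat \<times> nat) mon rel" and I :: "(nat \<times> nat, 'k::field) mpol set"
  assumes r: "diagonal_order TYPE('k) m n r" and s: "s \<le> m" "s \<le> n"
    and I: "I = initial_ideal (gen_vars m n) r (det_ideal m n (Suc s))"
begin

lemma initial_order: "monomial_order (gen_vars m n) r"
  using r by (simp add: diagonal_order_def)

lemma det_ideal_initial:
  assumes "f \<in> (det_ideal m n (Suc s) :: (nat \<times> nat, 'k) mpol set)" "f \<noteq> 0"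
  shows "initial_mon r f \<in> mons (gen_vars m n)" "Suc s \<le> mon_deg (initial_mon r f)"
proof -
  have f: "f \<in> mon_ideal (gen_vars m n) (\<lambda>u. Suc s \<le> mon_deg u)"
    using assms(1) det_ideal_degree by blast
  then have fc: "f \<in> carrier (poly_ring (gen_vars m n))" by (simp add: mon_ideal_def)
  have "initial_mon r f \<in> keys f" by (rule initial_mon_props(1)[OF initial_order fc assms(2)])
  then show "initial_mon r f \<in> mons (gen_vars m n)" "Suc s \<le> mon_deg (initial_mon r f)"
    using f by (auto simp: mon_ideal_def in_poly_ring)
qed

lemma initial_gens_carrier:
  "{single (initial_mon r f) 1 | f. f \<in> (det_ideal m n (Suc s) :: (nat \<times> nat, 'k) mpol set) \<and> f \<noteq> 0} \<subseteq> carrier (poly_ring (gen_vars m n) :: (nat \<times> nat, 'k) mpol ring)"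
  using det_ideal_initial(1) by (auto intro: pcl_single)

lemma initial_ideal_ideal: "ideal I (poly_ring (gen_vars m n))"
  unfolding I initial_ideal_def
  by (rule Idl_ideal) (use initial_gens_carrier in blast)

text \<open>Reduces a bound for the whole ideal to a property of initial monomials; used for the
  degree bound and for containment in a prime generated by variables.\<close>

lemma initial_ideal_subset:
  assumes "\<And>u w. P u \<Longrightarrow> P (w + u)"
    and "\<And>f. f \<in> (det_ideal m n (Suc s) :: (nat \<times> nat, 'k) mpol set) \<Longrightarrow> f \<noteq> 0 \<Longrightarrow> P (initial_mon r f)"
  shows "I \<subseteq> mon_ideal (gen_vars m n) P"
  unfolding I initial_ideal_def
proof (rule Idl_subset)
  show "ideal (mon_ideal (gen_vars m n) P :: (nat \<times> nat, 'k) mpol set) (poly_ring (gen_vars m n))"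
    by (rule ideal_mon_ideal) (rule assms(1))
  show "{single (initial_mon r f) 1 | f. f \<in> (det_ideal m n (Suc s) :: (nat \<times> nat, 'k) mpol set) \<and> f \<noteq> 0}
      \<subseteq> (mon_ideal (gen_vars m n) P :: (nat \<times> nat, 'k) mpol set)"
    using assms(2) det_ideal_initial(1) by (auto simp: mon_ideal_def pcl_single)
qed

lemma initial_ideal_diagonal:
  assumes T: "T \<subseteq> gen_vars m n" "increasing T" "card T = Suc s"
  shows "single (sqfree_mon T) 1 \<in> I"
proof -
  have fin: "finite T" using T(1) by (rule finite_subset) (simp add: gen_vars_def)
  have m: "fst ` T \<subseteq> {..<m}" "card (fst ` T) = Suc s" "snd ` T \<subseteq> {..<n}" "card (snd ` T) = Suc s"
    using T increasing_pick[OF fin T(2)] by (auto simp: gen_vars_def)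
  let ?p = "gen_minor m n (fst ` T) (snd ` T) :: (nat \<times> nat, 'k) mpol"
  have "?p \<in> det_ideal m n (Suc s)" "?p \<noteq> 0" "initial_mon r ?p = sqfree_mon T"
    by (rule gen_minor_in_det_ideal[OF m] gen_minor_nonzero[OF m] diagonal_order_initial[OF r T(1,2)])+
  then have "single (sqfree_mon T) 1 \<in> {single (initial_mon r f) (1 :: 'k) | f. f \<in> (det_ideal m n (Suc s) :: (nat \<times> nat, 'k) mpol set) \<and> f \<noteq> 0}"
    by force
  then show ?thesis
    unfolding I initial_ideal_def using Idl_superset[OF initial_gens_carrier] by blast
qed

lemma ideal_height_initial: "ideal_height (poly_ring (gen_vars m n)) I = enat ((m - s) * (n - s))"
proof (rule antisym)
  let ?V = "gen_vars m n"
  let ?C = "{s..<m} \<times> {s..<n}"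
  let ?P = "mon_ideal ?V (\<lambda>u. keys u \<inter> ?C \<noteq> {}) :: (nat \<times> nat, 'k) mpol set"
  have finV: "finite ?V" by (simp add: gen_vars_def)
  have CV: "?C \<subseteq> ?V" by (auto simp: gen_vars_def)
  have "I \<subseteq> ?P"
  proof (rule initial_ideal_subset)
    fix f :: "(nat \<times> nat, 'k) mpol" assume f: "f \<in> det_ideal m n (Suc s)" "f \<noteq> 0"
    obtain v where "v \<in> keys (initial_mon r f)" "s \<le> fst v" "s \<le> snd v"
      using initial_mon_det_ideal[OF r s f] by blast
    moreover from this have "v \<in> ?V" using det_ideal_initial(1)[OF f] by (auto simp: mons_def)
    ultimately have "v \<in> keys (initial_mon r f) \<inter> ?C" by (cases v) (simp add: gen_vars_def)
    then show "keys (initial_mon r f) \<inter> ?C \<noteq> {}" by blast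
  qed (auto simp: in_keys_iff lookup_add disjoint_iff)
  moreover have "primeideal ?P (poly_ring ?V)" by (rule primeideal_mon_ideal[OF initial_order CV])
  ultimately have "ideal_height (poly_ring ?V) I \<le> prime_height (poly_ring ?V) ?P"
    unfolding ideal_height_def by (intro INF_lower) simp
  also have "\<dots> \<le> enat ((m - s) * (n - s))"
  proof (rule prime_height_le[OF finV growth_mon_ideal[OF finV]])
    show "card (?V - ?C) + (m - s) * (n - s) = card ?V"
      using CV card_mono[OF finV CV] by (simp add: card_Diff_subset)
  qed
  finally show "ideal_height (poly_ring ?V) I \<le> enat ((m - s) * (n - s))" .
  show "enat ((m - s) * (n - s)) \<le> ideal_height (poly_ring ?V) I"
    unfolding ideal_height_def
  proof (rule INF_greatest)
    fix P assume "P \<in> {P. primeideal P (poly_ring ?V) \<and> I \<subseteq> P}"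
    then have P: "primeideal P (poly_ring ?V)" "I \<subseteq> P" by auto
    define C where "C = {v \<in> ?V. Var v \<in> P}"
    have C: "C \<subseteq> ?V" "Var ` C \<subseteq> P" by (auto simp: C_def)
    have "(m - s) * (n - s) \<le> card C"
    proof (rule card_diagonal_cover[OF C(1) s])
      fix T assume T: "T \<subseteq> ?V" "increasing T" "card T = Suc s"
      have "finite T" by (rule finite_subset[OF T(1) finV])
      then have "\<exists>v\<in>T. Var v \<in> P"
        using initial_ideal_diagonal[OF T] P(2) by (intro prime_contains_variable[OF P(1) _ T(1)]) auto
      then show "T \<inter> C \<noteq> {}" using T(1) by (auto simp: C_def)
    qed
    then have "enat ((m - s) * (n - s)) \<le> enat (card C)" by simp
    also have "\<dots> \<le> prime_height (poly_ring ?V) P"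
      using finite_subset[OF C(1) finV] by (rule prime_height_ge[OF initial_order P(1) C(1) _ C(2)])
    finally show "enat ((m - s) * (n - s)) \<le> prime_height (poly_ring ?V) P" .
  qed
qed

text \<open>The block \<open>B a\<close> of size \<open>h\<close> and the \<open>t - 1\<close> points \<open>D a\<close>, of which \<open>a\<close> lie in the upper left and
  \<open>t - 1 - a\<close> in the lower right corner, are arranged such that every point of \<open>B a\<close> completes
  \<open>D a\<close> to a \<open>t\<close>-diagonal.\<close>

lemma betti_initial:
  assumes big: "Suc s < m \<or> Suc s < n" and s': "s < m" "s < n"
  shows "Suc s \<le> betti (gen_vars m n) I ((m - s) * (n - s)) ((m - s) * (n - s) + Suc s - 1)"
proof -
  \<comment> \<open>The side lengths are \<open>m - s\<close> and \<open>n - s\<close> for every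
    \<open>a \<le> s\<close>; varying \<open>a\<close> only shifts the block diagonally.\<close>
  define B where "B a = {a..<m - (s - a)} \<times> {a..<n - (s - a)}" for a
  define D where "D a = (\<lambda>i. (i, i)) ` {..<a} \<union> (\<lambda>i. (m - Suc i, n - Suc i)) ` {..<s - a}" for a
  have BV: "B a \<subseteq> gen_vars m n" if "a < Suc s" for a
    using that s by (auto simp: B_def gen_vars_def)
  have DV: "D a \<subseteq> gen_vars m n" if "a < Suc s" for a
    using that s' by (auto simp: D_def gen_vars_def)
  have Bcard: "card (B a) = (m - s) * (n - s)" if "a < Suc s" for a
    using that by (simp add: B_def)
  have Dcard: "card (D a) = s" if a: "a < Suc s" for a
  proof -
    have "(\<lambda>i. (i, i)) ` {..<a} \<inter> (\<lambda>i. (m - Suc i, n - Suc i)) ` {..<s - a} = {}"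
      using s' a by auto
    moreover have "inj_on (\<lambda>i. (m - Suc i, n - Suc i)) {..<s - a}"
      using s' by (auto simp: inj_on_def)
    moreover have "inj_on (\<lambda>i::nat. (i, i)) {..<a}" by (simp add: inj_on_def)
    ultimately show ?thesis using a by (simp add: D_def card_Un_disjoint card_image)
  qed
  have DB: "D a \<inter> B a = {}" if "a < Suc s" for a
    using that s' by (auto simp: D_def B_def)
  have inc: "increasing (insert b (D a))" if a: "a < Suc s" and b: "b \<in> B a" for a b
  proof -
    \<comment> \<open>The upper left points, then \<open>b\<close>, then the lower right points
      follow each other in both coordinates.\<close>
    define lt where "lt x y \<longleftrightarrow> fst x < fst y \<and> snd x < snd y" for x y :: "nat \<times> nat"
    have b': "a \<le> fst b" "fst b < m - (s - a)" "a \<le> snd b" "snd b < n - (s - a)"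
      using b by (auto simp: B_def)
    have lt1: "lt (i, i) (j, j)" if "i < j" for i j
      using that by (simp add: lt_def)
    have lt2: "lt (i, i) b" if "i < a" for i
      using that b'(1,3) by (simp add: lt_def)
    have lt3: "lt b (m - Suc j, n - Suc j)" if "j < s - a" for j
    proof -
      have "m - (s - a) \<le> m - Suc j" "n - (s - a) \<le> n - Suc j" using that by simp_all
      then show ?thesis using b'(2,4) by (simp add: lt_def)
    qed
    have lt4: "lt (i, i) (m - Suc j, n - Suc j)" if "i < a" "j < s - a" for i j
      using lt2[OF that(1)] lt3[OF that(2)] by (simp add: lt_def)
    have lt5: "lt (m - Suc j, n - Suc j) (m - Suc i, n - Suc i)" if "i < j" "j < s - a" for i j
    proof -
      have "Suc i < Suc j" "Suc i < m" "Suc i < n" using that s' by linarith+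
      then show ?thesis by (simp add: lt_def diff_less_mono2)
    qed
    have "lt x y \<or> lt y x" if xy: "x \<in> insert b (D a)" "y \<in> insert b (D a)" "x \<noteq> y" for x y
    proof -
      have cases: "x = b \<or> (\<exists>i<a. x = (i, i)) \<or> (\<exists>i<s - a. x = (m - Suc i, n - Suc i))"
        if "x \<in> insert b (D a)" for x
        using that by (auto simp: D_def)
      show ?thesis
        using cases[OF xy(1)]
      proof (elim disjE exE conjE)
        assume "x = b"
        then show ?thesis using cases[OF xy(2)] xy(3) lt2 lt3 by blast
      next
        fix i assume i: "i < a" "x = (i, i)"
        show ?thesis using cases[OF xy(2)]
        proof (elim disjE exE conjE)
          fix j assume "j < a" "y = (j, j)"
          then show ?thesis using i xy(3) lt1 by (cases i j rule: linorder_cases) auto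
        qed (use i lt2 lt4 in auto)
      next
        fix i assume i: "i < s - a" "x = (m - Suc i, n - Suc i)"
        show ?thesis using cases[OF xy(2)]
        proof (elim disjE exE conjE)
          fix j assume "j < s - a" "y = (m - Suc j, n - Suc j)"
          then show ?thesis using i xy(3) lt5 by (cases i j rule: linorder_cases) auto
        qed (use i lt3 lt4 in auto)
      qed
    qed
    then show ?thesis unfolding increasing_def lt_def by blast
  qed
  have dist: False if aa: "a < a'" "a' < Suc s" "B a \<union> D a = B a' \<union> D a'" for a a'
  proof (cases "Suc s < n")
    case True
    \<comment> \<open>The witness lies one step off the diagonal: it is in \<open>B a\<close>
      because the block has more than one column, its row is too small for \<open>B a'\<close> and
      for the lower right points, and the upper left points are on the diagonal.\<close>
    then have "(a, Suc a) \<in> B a" using aa s' by (auto simp: B_def)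
    moreover have "(a, Suc a) \<notin> B a' \<union> D a'" using aa s' by (auto simp: B_def D_def)
    ultimately show False using aa(3) by blast
  next
    case False
    then have "(Suc a, a) \<in> B a" using big aa s' by (auto simp: B_def)
    moreover have "(Suc a, a) \<notin> B a' \<union> D a'" using aa s' by (auto simp: B_def D_def)
    ultimately show False using aa(3) by blast
  qed
  show ?thesis
  proof (rule betti_lower_bound[where B = B and D = D])
    show "finite (gen_vars m n)" by (simp add: gen_vars_def)
    show "ideal I (poly_ring (gen_vars m n))" by (rule initial_ideal_ideal)
    show "Suc s \<le> mon_deg u" if "p \<in> I" "u \<in> keys p" for p u
    proof -
      have "I \<subseteq> mon_ideal (gen_vars m n) (\<lambda>u. Suc s \<le> mon_deg u)"
        using det_ideal_initial(2) by (intro initial_ideal_subset) (auto simp: mon_deg_add)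
      then show ?thesis using that by (auto simp: mon_ideal_def)
    qed
    show "single (sqfree_mon (insert b (D a))) 1 \<in> I" if a: "a < Suc s" and b: "b \<in> B a" for a b
    proof (rule initial_ideal_diagonal[OF _ inc[OF a b]])
      show "insert b (D a) \<subseteq> gen_vars m n" using BV[OF a] DV[OF a] b by auto
      have "finite (D a)" by (simp add: D_def)
      moreover have "b \<notin> D a" using DB[OF a] b by blast
      ultimately show "card (insert b (D a)) = Suc s" using Dcard[OF a] by simp
    qed
    show "a = a'" if "a < Suc s" "a' < Suc s" "B a \<union> D a = B a' \<union> D a'" for a a'
      using dist[of a a'] dist[of a' a] that by (metis nat_neq_iff)
    show "0 < (m - s) * (n - s)" using s' by simp
  qed (simp_all add: BV DV Bcard Dcard DB)
qed

end

theorem theorem1p2: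
  fixes m n t h :: nat
    and r :: "(nat \<times> nat) mon rel"
    and in_It :: "(nat \<times> nat, 'k::field_char_0) mpol set"
  assumes "2 \<le> t" and "t \<le> min m n" and "t < max m n"
    and "diagonal_order TYPE('k) m n r"
    and "in_It = initial_ideal (gen_vars m n) r (det_ideal m n t)"
    and "h = (m - t + 1) * (n - t + 1)"
  shows "ideal_height (poly_ring (gen_vars m n)) in_It = enat h \<and>
    betti (gen_vars m n) in_It h (h + t - 1) \<ge> t"
proof -
  obtain s where t: "t = Suc s" using assms(1) by (cases t) auto
  have s: "s < m" "s < n" "Suc s < m \<or> Suc s < n" using assms(2,3) t by auto
  \<comment> \<open>On natural numbers \<open>m - t + 1 = m - s\<close> relies on
    \<open>s < m\<close>, and likewise for \<open>n\<close>.\<close>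
  have h: "h = (m - s) * (n - s)" using assms(6) s by (simp add: t Suc_diff_Suc)
  have I: "in_It = initial_ideal (gen_vars m n) r (det_ideal m n (Suc s))" using assms(5) t by simp
  show ?thesis
    using ideal_height_initial[OF assms(4) _ _ I] betti_initial[OF assms(4) _ _ I s(3,1,2)] s
    by (simp add: h t)
qed

end
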